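(* Let $n\ge 1$, let $\Omega\subset\mathbb{R}^n$ be a bounded and connected open set with $C^2$ boundary and let $\varphi:\mathbb{R}^n\to\mathbb{R}$ be such that $$\varphi\in L^\infty_{loc}(\mathbb{R}^n)\quad\text{and}\quad \overline{\alpha}\big(\mathcal{S}g(\varphi)\big)<\frac{\omega_{n+1}}{2}.$$ Let $A\subset\subset\Omega$ be a bounded open set (possibly empty) with $C^2$ boundary. Assume that either a) $\psi\in C^2(\overline A)$, or b) $\psi\in C(\overline A)\cap C^2(A)$ is such that $$\mathfrak{O}:=(\Omega\times\mathbb{R})\setminus\{(x,t)\in\mathbb{R}^{n+1}\,:\,x\in\overline A,\ t\le\psi(x)\}$$ is an open set with $C^2$ boundary. Define $$k_0:=2+\Big\lceil\max\{\|\psi\|_{L^\infty(A)},\|\varphi\|_{L^\infty(\Omega_1\setminus\Omega)}\}\Big\rceil .$$ For every $s\in(0,1)$ let $u_s\in\mathcal{W}^s_{\varphi,\psi}(\Omega,A)$ be the unique solution of the obstacle problem in $\Omega$ with exterior data $\varphi$ and obstacle $\psi$ in $A$. Then, for every $k\ge k_0$ there exists $s_k\in(0,1)$ such that $$u_s\le -k\quad\text{a.e. in }\Omega\setminus A\qquad\text{and}\qquad u_s=\psi\quad\text{a.e. in }A,$$ for every $s\in(0,s_k)$. In particular, $$\lim_{s\to0}u_s(x)=-\infty\quad\text{uniformly in }x\in\Omega\setminus A.$$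
   Context: Notation. $\omega_{n+1}=\mathcal{H}^n(\partial\mathcal{B}_1)=\frac{2\pi^{(n+1)/2}}{\Gamma((n+1)/2)}$, where $\mathcal{B}_1$ is the unit ball of $\mathbb{R}^{n+1}$ centered at the origin; $\lceil\cdot\rceil$ is the ceiling function. The subgraph of $u:\mathbb{R}^n\to\mathbb{R}$ is $\mathcal{S}g(u)=\{(x,x_{n+1})\in\mathbb{R}^{n}\times\mathbb{R}: x_{n+1}<u(x)\}$. For a measurable $E\subset\mathbb{R}^{n+1}$, $$\overline\alpha(E):=\limsup_{s\to0^+}s\int_{\mathbb{R}^{n+1}\setminus\mathcal{B}_1}\frac{\chi_E(Y)}{|Y|^{n+1+s}}\,dY.$$ For $\delta\in\mathbb{R}$, $\Omega_\delta:=\{x\in\mathbb{R}^n:\bar d_\Omega(x)<\delta\}$, where $\bar d_\Omega(x)=d(x,\Omega)-d(x,\mathbb{R}^n\setminus\Omega)$ is the signed distance from $\partial\Omega$, negative inside $\Omega$. Obstacle problem. For $s\in(0,1)$ set $g_s(t)=(1+t^2)^{-\frac{n+1+s}{2}}$, $G_s(t)=\int_0^t g_s(\tau)\,d\tau$, $\mathcal{G}_s(t)=\int_0^tG_s(\tau)\,d\tau$, and $Q(\Omega)=\mathbb{R}^{2n}\setminus(\mathbb{R}^n\setminus\Omega)^2$. Functions are measurable and identified when equal a.e. $\mathcal{W}^s(\Omega)$ is the set of $u:\mathbb{R}^n\to\mathbb{R}$ with $u|_\Omega\in W^{s,1}(\Omega)$, i.e. $\|u\|_{L^1(\Omega)}+\int_\Omega\int_\Omega\frac{|u(x)-u(y)|}{|x-y|^{n+s}}\,dx\,dy<\infty$.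 For $A\subset\Omega$ open and $\psi\in L^\infty(A)$, $$\mathcal{W}^s_{\varphi,\psi}(\Omega,A):=\{u\in\mathcal{W}^s(\Omega):u=\varphi\text{ on }\mathbb{R}^n\setminus\Omega,\ u\ge\psi\text{ a.e. in }A\}.$$ A function $u$ solves the obstacle problem (in $\Omega$, with exterior data $\varphi$ and obstacle $\psi$ in $A$) if $u\in\mathcal{W}^s_{\varphi,\psi}(\Omega,A)$ and for every $v\in\mathcal{W}^s_{\varphi,\psi}(\Omega,A)$ $$\iint_{Q(\Omega)}\left\{\mathcal{G}_s\Big(\tfrac{u(x)-u(y)}{|x-y|}\Big)-\mathcal{G}_s\Big(\tfrac{v(x)-v(y)}{|x-y|}\Big)\right\}\frac{dx\,dy}{|x-y|^{n-1+s}}\le0.$$ Under the stated hypotheses such a solution exists and is unique for every $s\in(0,1)$. *)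

theory Defs
  imports "HOL-Analysis.Analysis" "HOL-Probability.Essential_Supremum"
begin

section \<open>Functions of class \<open>C\<^sup>2\<close> and open sets with \<open>C\<^sup>2\<close> boundary\<close>

definition C2_derivs ::
  "'a::euclidean_space set \<Rightarrow> ('a \<Rightarrow> real) \<Rightarrow> ('a \<Rightarrow> 'a \<Rightarrow>\<^sub>L real) \<Rightarrow> ('a \<Rightarrow> 'a \<Rightarrow>\<^sub>L 'a \<Rightarrow>\<^sub>L real) \<Rightarrow> bool"
  where "C2_derivs S f f' f'' \<longleftrightarrow>
    (\<forall>x\<in>S. (f has_derivative blinfun_apply (f' x)) (at x) \<and>
           (f' has_derivative blinfun_apply (f'' x)) (at x))"

definition C2_on :: "'a::euclidean_space set \<Rightarrow> ('a \<Rightarrow> real) \<Rightarrow> bool"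
  where "C2_on S f \<longleftrightarrow> (\<exists>f' f''. C2_derivs S f f' f'' \<and> continuous_on S f'')"

text \<open>
  The space \<open>C\<^sup>2\<close> of the closure of an open set \<open>S\<close>: \<open>f\<close> is \<open>C\<^sup>2\<close> in \<open>S\<close>, and \<open>f\<close> and its derivatives
  of order one and two are continuous up to the boundary. The functions \<open>f'\<close>, \<open>f''\<close> are
  the derivatives only on \<open>S\<close>; on the boundary they are the continuous extensions.
\<close>

definition C2_on_closure :: "'a::euclidean_space set \<Rightarrow> ('a \<Rightarrow> real) \<Rightarrow> bool"
  where "C2_on_closure S f \<longleftrightarrow>
    (\<exists>f' f''. C2_derivs S f f' f'' \<and> continuous_on (closure S) f \<and>
       continuous_on (closure S) f' \<and> continuous_on (closure S) f'')"

text \<open>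
  Near each boundary point and after a rotation taking the unit vector \<open>e\<close> to the last coordinate
  direction, the set lies strictly on one side of the graph of a \<open>C\<^sup>2\<close> function \<open>g\<close> of the remaining
  coordinates; \<open>x - (x \<bullet> e) *\<^sub>R e\<close> is the projection to the hyperplane orthogonal to \<open>e\<close>, so only the
  values of \<open>g\<close> on that hyperplane matter.
\<close>

definition C2_boundary :: "'a::euclidean_space set \<Rightarrow> bool"
  where "C2_boundary S \<longleftrightarrow>
    (\<forall>p\<in>frontier S. \<exists>r>0. \<exists>e g. norm e = 1 \<and> C2_on UNIV g \<and>
       S \<inter> ball p r = {x \<in> ball p r. x \<bullet> e < g (x - (x \<bullet> e) *\<^sub>R e)})"

section \<open>Norms, neighbourhoods, subgraphs\<close>

text \<open>With values in the extended nonnegative reals the essential supremum over the empty set is \<open>0\<close>.\<close>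

definition Linf_norm :: "'a::euclidean_space set \<Rightarrow> ('a \<Rightarrow> real) \<Rightarrow> real"
  where "Linf_norm S f = enn2real (esssup (restrict_space lebesgue S) (\<lambda>x. ennreal \<bar>f x\<bar>))"

definition Linf_loc :: "('a::euclidean_space \<Rightarrow> real) \<Rightarrow> bool"
  where "Linf_loc f \<longleftrightarrow> f \<in> borel_measurable lebesgue \<and>
    (\<forall>K. compact K \<longrightarrow> (\<exists>C. AE x in lebesgue. x \<in> K \<longrightarrow> \<bar>f x\<bar> \<le> C))"

definition signed_dist :: "'a::euclidean_space set \<Rightarrow> 'a \<Rightarrow> real"
  where "signed_dist \<Omega> x = infdist x \<Omega> - infdist x (- \<Omega>)"

definition nbhd :: "'a::euclidean_space set \<Rightarrow> real \<Rightarrow> 'a set"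
  where "nbhd \<Omega> \<delta> = {x. signed_dist \<Omega> x < \<delta>}"

definition subgraph :: "('a \<Rightarrow> real) \<Rightarrow> ('a \<times> real) set"
  where "subgraph u = {(x, t). t < u x}"

text \<open>\<open>omega m\<close> is the surface measure of the unit sphere of \<open>m\<close>-dimensional space.\<close>

definition omega :: "nat \<Rightarrow> real"
  where "omega m = 2 * pi powr (real m / 2) / Gamma (real m / 2)"

text \<open>
  The ambient space of \<open>E\<close> plays the role of \<open>\<real>\<^sup>n\<^sup>+\<^sup>1\<close>, so \<open>DIM('b)\<close> is \<open>n + 1\<close> here, whereas
  \<open>DIM('a)\<close> is \<open>n\<close> in the definitions of the obstacle problem.
\<close>

definition alpha_bar :: "'b::euclidean_space set \<Rightarrow> ennreal"
  where "alpha_bar E = Limsup (at_right 0) (\<lambda>s::real.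
    ennreal s * (\<integral>\<^sup>+Y\<in>- ball 0 1. ennreal (indicator E Y / norm Y powr (real DIM('b) + s)) \<partial>lebesgue))"

section \<open>The obstacle problem\<close>

definition g_kernel :: "nat \<Rightarrow> real \<Rightarrow> real \<Rightarrow> real"
  where "g_kernel n s t = (1 + t\<^sup>2) powr (- (real n + 1 + s) / 2)"

text \<open>Interval integrals are oriented, so the next two definitions also cover \<open>t < 0\<close>.\<close>

definition G_prim :: "nat \<Rightarrow> real \<Rightarrow> real \<Rightarrow> real"
  where "G_prim n s t = (LBINT \<tau>=0..ereal t. g_kernel n s \<tau>)"

definition G_cal :: "nat \<Rightarrow> real \<Rightarrow> real \<Rightarrow> real"
  where "G_cal n s t = (LBINT \<tau>=0..ereal t. G_prim n s \<tau>)"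

definition Q_dom :: "'a set \<Rightarrow> ('a \<times> 'a) set"
  where "Q_dom \<Omega> = UNIV - (UNIV - \<Omega>) \<times> (UNIV - \<Omega>)"

definition W_space :: "real \<Rightarrow> 'a::euclidean_space set \<Rightarrow> ('a \<Rightarrow> real) set"
  where "W_space s \<Omega> = {u \<in> borel_measurable lebesgue.
    (\<integral>\<^sup>+x\<in>\<Omega>. ennreal \<bar>u x\<bar> \<partial>lebesgue) +
    (\<integral>\<^sup>+x\<in>\<Omega>. (\<integral>\<^sup>+y\<in>\<Omega>. ennreal (\<bar>u x - u y\<bar> / norm (x - y) powr (real DIM('a) + s)) \<partial>lebesgue)
      \<partial>lebesgue) < \<infinity>}"

definition W_obst ::
  "real \<Rightarrow> 'a::euclidean_space set \<Rightarrow> 'a set \<Rightarrow> ('a \<Rightarrow> real) \<Rightarrow> ('a \<Rightarrow> real) \<Rightarrow> ('a \<Rightarrow> real) set"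
  where "W_obst s \<Omega> A \<phi> \<psi> = {u \<in> W_space s \<Omega>.
    (AE x in lebesgue. x \<notin> \<Omega> \<longrightarrow> u x = \<phi> x) \<and> (AE x in lebesgue. x \<in> A \<longrightarrow> \<psi> x \<le> u x)}"

text \<open>
  For competitors with the same exterior data in a bounded open set with \<open>C\<^sup>2\<close> boundary the integrand
  below is absolutely integrable, by the Lipschitz continuity of \<open>G_cal n s\<close> and the fractional
  Hardy inequality, although the two energies separately may be infinite.
\<close>

definition solves_obstacle ::
  "real \<Rightarrow> 'a::euclidean_space set \<Rightarrow> 'a set \<Rightarrow> ('a \<Rightarrow> real) \<Rightarrow> ('a \<Rightarrow> real) \<Rightarrow> ('a \<Rightarrow> real) \<Rightarrow> bool"
  where "solves_obstacle s \<Omega> A \<phi> \<psi> u \<longleftrightarrow> u \<in> W_obst s \<Omega> A \<phi> \<psi> \<and>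
    (\<forall>v \<in> W_obst s \<Omega> A \<phi> \<psi>.
      set_lebesgue_integral lebesgue (Q_dom \<Omega>) (\<lambda>(x, y).
        (G_cal DIM('a) s ((u x - u y) / norm (x - y)) - G_cal DIM('a) s ((v x - v y) / norm (x - y)))
          / norm (x - y) powr (real DIM('a) - 1 + s)) \<le> 0)"

end

theory Submission
  imports Defs "HOL-Probability.Sinc_Integral"
begin

text \<open>
  The reason for the stickiness is that, as \<open>s\<close> tends to \<open>0\<close>, the fractional mean curvature of a subgraph is
  governed by what happens far away. At a boundary point \<open>X\<close> of a set \<open>F\<close> of \<open>\<real>\<^sup>n\<^sup>+\<^sup>1\<close> it is the principal
  value of the integral of \<open>\<chi>\<close> of the complement of \<open>F\<close> minus \<open>\<chi>\<close> of \<open>F\<close> against \<open>\<bar>X - Y\<bar>\<close> to the power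
  \<open>-(n+1+s)\<close>. The part at distance at least \<open>1\<close> is of order \<open>1/s\<close>, and its leading coefficient is
  positive for the subgraphs at hand, because their exterior data satisfy \<open>alpha_bar < omega/2\<close>. The part
  near \<open>X\<close> is bounded below, uniformly in \<open>s\<close>, as soon as a ball of a fixed radius touches \<open>F\<close> from outside
  at \<open>X\<close>: the ball cancels against its reflection about \<open>X\<close>, and what is left over between the two
  tangent balls is too thin to matter. So for small \<open>s\<close> every exterior tangent ball of radius \<open>\<delta>\<close>, in a
  bounded range of heights, meets a strictly positive curvature (\<open>riesz_measure_exterior_ball\<close>).

  This is turned into a comparison principle for the obstacle problem. Let \<open>D\<close> be a ball of radius \<open>\<delta>\<close>
  contained in \<open>\<Omega> \<times> \<real>\<close> and above the obstacle, and let \<open>w\<close> be the function whose graph is its lower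
  hemisphere. Subtracting from a solution \<open>u\<close> the excess of \<open>u\<close> over \<open>w\<close>, truncated at height \<open>1\<close>, gives an
  admissible competitor. By convexity of the energy density, minimality becomes a first order inequality;
  by monotonicity of \<open>G_prim\<close> the increments of the competitor may be replaced there by those of \<open>w\<close> inside the
  ball, by \<open>-\<infinity>\<close> in the rest of a bounded region, and by those of the exterior datum far away. Integration along
  vertical lines identifies the result with the excess integrated against the positive curvature of an
  explicit set \<open>barrier_set\<close> that \<open>D\<close> touches from outside. Hence the excess vanishes and \<open>u \<le> w\<close>
  (\<open>ball_barrier\<close>), for all such balls at once (\<open>solutions_below_balls\<close>).

  What remains is geometry. Since the boundaries are \<open>C\<^sup>2\<close>, the set \<open>\<Omega> - closure A\<close> is a union of balls of
  a fixed radius (\<open>C2_boundary_uniform_balls\<close>); placing their centres at height \<open>-k\<close> yields \<open>u \<le> -k\<close> there, and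
  the boundary of \<open>A\<close> is a null set (\<open>C2_boundary_frontier_null\<close>). Likewise every point slightly above the
  graph of the obstacle over \<open>A\<close> lies in a ball of a fixed radius above the obstacle and inside
  \<open>\<Omega> \<times> \<real>\<close> (\<open>obstacle_uniform_balls\<close>), which yields \<open>u \<le> \<psi>\<close> on \<open>A\<close>.
\<close>

section \<open>The kernel and its primitives\<close>

lemma g_kernel_pos: "0 < g_kernel n s t"
proof -
  have "0 < 1 + t\<^sup>2" by (simp add: add_pos_nonneg)
  then show ?thesis by (simp add: g_kernel_def)
qed

lemma continuous_g_kernel: "continuous_on S (g_kernel n s)"
proof -
  have "1 + t\<^sup>2 \<noteq> 0" for t :: real by (smt (verit) zero_le_power2)
  then show ?thesis unfolding g_kernel_def by (intro continuous_intros) auto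
qed

lemma borel_measurable_g_kernel [measurable]: "g_kernel n s \<in> borel_measurable borel"
  by (rule borel_measurable_continuous_onI[OF continuous_g_kernel])

lemma g_kernel_integrable:
  assumes "1 \<le> n" "0 \<le> s"
  shows "integrable lborel (g_kernel n s)"
proof (rule Bochner_Integration.integrable_bound)
  show "integrable lborel (\<lambda>x::real. inverse (1 + x\<^sup>2))"
    using integrable_inverse_1_plus_square by (simp add: set_integrable_def)
  show "AE x in lborel. norm (g_kernel n s x) \<le> norm (inverse (1 + x\<^sup>2))"
  proof (rule AE_I2)
    fix x :: real
    have x: "1 \<le> 1 + x\<^sup>2" by simp
    have "g_kernel n s x \<le> (1 + x\<^sup>2) powr (- 1)"
      unfolding g_kernel_def by (rule powr_mono) (use assms x in auto)
    also have "\<dots> = inverse (1 + x\<^sup>2)" using x by (simp add: powr_minus)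
    finally show "norm (g_kernel n s x) \<le> norm (inverse (1 + x\<^sup>2))"
      using g_kernel_pos[of n s x] by simp
  qed
qed simp

text \<open>
  The limit of \<open>G_prim n s\<close> at \<open>\<infinity>\<close>.
\<close>

definition G_lim :: "nat \<Rightarrow> real \<Rightarrow> real"
  where "G_lim n s = (LINT \<tau>|lborel. g_kernel n s \<tau>) / 2"

text \<open>
  The representation by two half lines, instead of the oriented integral from \<open>0\<close>, is what a vertical
  line sees of a subgraph and of its complement; it holds because the kernel is even.
\<close>

lemma G_prim_eq:
  assumes "1 \<le> n" "0 \<le> s"
  shows "G_prim n s t = (LINT \<tau>|lborel. (if \<tau> < t then g_kernel n s \<tau> else - g_kernel n s \<tau>)) / 2"
proof -
  let ?g = "g_kernel n s"
  note int[simp] = g_kernel_integrable[OF assms]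
  have ii: "integrable lborel (\<lambda>\<tau>. indicator A \<tau> * ?g \<tau>)" if "A \<in> sets borel" for A
    using integrable_mult_indicator[OF _ int, of A] that by simp
  have odd: "(LINT \<tau>|lborel. sgn \<tau> * ?g \<tau>) = 0"
  proof -
    have "(LINT \<tau>|lborel. sgn \<tau> * ?g \<tau>) = (LINT \<tau>|lborel. sgn (- \<tau>) * ?g (- \<tau>))"
      using lborel_integral_real_affine[of "-1" "\<lambda>\<tau>. sgn \<tau> * ?g \<tau>" 0] by simp
    also have "\<dots> = - (LINT \<tau>|lborel. sgn \<tau> * ?g \<tau>)"
      by (simp add: g_kernel_def sgn_minus)
    finally show ?thesis by simp
  qed
  have sg: "integrable lborel (\<lambda>\<tau>. sgn \<tau> * ?g \<tau>)"
    by (rule Bochner_Integration.integrable_bound[OF int])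
       (auto simp: abs_mult abs_sgn_eq)
  have ae: "AE \<tau> in lborel. \<tau> \<noteq> (0::real)" by (rule AE_lborel_singleton)
  have ae2: "AE \<tau> in lborel. \<tau> \<noteq> t" by (rule AE_lborel_singleton)
  show ?thesis
  proof (cases "0 \<le> t")
    case True
    have "G_prim n s t = (LINT \<tau>|lborel. indicator {0<..<t} \<tau> * ?g \<tau>)"
      using True by (simp add: G_prim_def interval_lebesgue_integral_def set_lebesgue_integral_def
          einterval_def greaterThanLessThan_def greaterThan_def lessThan_def Int_def zero_ereal_def)
    moreover have "(LINT \<tau>|lborel. (if \<tau> < t then ?g \<tau> else - ?g \<tau>))
        = (LINT \<tau>|lborel. 2 * (indicator {0<..<t} \<tau> * ?g \<tau>) - sgn \<tau> * ?g \<tau>)"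
    proof (rule integral_cong_AE)
      show "AE \<tau> in lborel. (if \<tau> < t then ?g \<tau> else - ?g \<tau>) = 2 * (indicator {0<..<t} \<tau> * ?g \<tau>) - sgn \<tau> * ?g \<tau>"
        using ae ae2 by eventually_elim (use True in \<open>auto simp: indicator_def sgn_if\<close>)
    qed simp_all
    ultimately show ?thesis using odd sg ii[of "{0<..<t}"] by simp
  next
    case False
    have "G_prim n s t = - (LINT \<tau>|lborel. indicator {t<..<0} \<tau> * ?g \<tau>)"
      using False by (simp add: G_prim_def interval_lebesgue_integral_def set_lebesgue_integral_def
          einterval_def greaterThanLessThan_def greaterThan_def lessThan_def Int_def zero_ereal_def)
    moreover have "(LINT \<tau>|lborel. (if \<tau> < t then ?g \<tau> else - ?g \<tau>))
        = (LINT \<tau>|lborel. - (2 * (indicator {t<..<0} \<tau> * ?g \<tau>)) - sgn \<tau> * ?g \<tau>)"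
    proof (rule integral_cong_AE)
      show "AE \<tau> in lborel. (if \<tau> < t then ?g \<tau> else - ?g \<tau>) = - (2 * (indicator {t<..<0} \<tau> * ?g \<tau>)) - sgn \<tau> * ?g \<tau>"
        using ae ae2 by eventually_elim (use False in \<open>auto simp: indicator_def sgn_if\<close>)
    qed simp_all
    ultimately show ?thesis using odd sg ii[of "{t<..<0}"] by simp
  qed
qed

lemma G_prim_integrand_integrable:
  assumes "1 \<le> n" "0 \<le> s"
  shows "integrable lborel (\<lambda>\<tau>. if \<tau> < t then g_kernel n s \<tau> else - g_kernel n s \<tau>)"
  by (rule Bochner_Integration.integrable_bound[OF g_kernel_integrable[OF assms]])
     (auto intro!: AE_I2)

lemma G_prim_mono:
  assumes "1 \<le> n" "0 \<le> s" "a \<le> b"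
  shows "G_prim n s a \<le> G_prim n s b"
  unfolding G_prim_eq[OF assms(1,2)]
  by (intro divide_right_mono integral_mono G_prim_integrand_integrable assms)
     (use assms g_kernel_pos[of n s] in \<open>auto simp: less_eq_real_def add_pos_pos intro: add_pos_pos\<close>)

lemma G_prim_bounds:
  assumes "1 \<le> n" "0 \<le> s"
  shows "G_prim n s t \<le> G_lim n s" "- G_lim n s \<le> G_prim n s t"
proof -
  have "G_prim n s t \<le> (LINT \<tau>|lborel. g_kernel n s \<tau>) / 2"
    unfolding G_prim_eq[OF assms(1,2)]
    by (intro divide_right_mono integral_mono G_prim_integrand_integrable g_kernel_integrable assms)
       (use g_kernel_pos[of n s] in \<open>auto simp: less_eq_real_def intro: add_pos_pos\<close>)
  then show "G_prim n s t \<le> G_lim n s" by (simp add: G_lim_def)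
  have "(LINT \<tau>|lborel. - g_kernel n s \<tau>) / 2 \<le> G_prim n s t"
    unfolding G_prim_eq[OF assms(1,2)]
    by (intro divide_right_mono integral_mono G_prim_integrand_integrable
         integrable_minus g_kernel_integrable assms)
       (use g_kernel_pos[of n s] in \<open>auto simp: less_eq_real_def intro: add_pos_pos\<close>)
  then show "- G_lim n s \<le> G_prim n s t" by (simp add: G_lim_def)
qed

lemma abs_G_prim_le:
  assumes "1 \<le> n" "0 \<le> s"
  shows "\<bar>G_prim n s t\<bar> \<le> G_lim n s"
  using G_prim_bounds[OF assms, of t] by (simp add: abs_le_iff)

lemma G_lim_nonneg: "0 \<le> G_lim n s"
  unfolding G_lim_def by (simp add: less_imp_le[OF g_kernel_pos])

lemma LBINT_from_0_has_derivative:
  fixes f :: "real \<Rightarrow> real"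
  assumes "continuous_on UNIV f"
  shows "((\<lambda>t. LBINT \<tau>=0..ereal t. f \<tau>) has_real_derivative f t) (at t)"
proof -
  let ?a = "-\<bar>t\<bar> - 1" and ?b = "\<bar>t\<bar> + 1"
  have "((\<lambda>t. LBINT \<tau>=ereal 0..ereal t. f \<tau>) has_vector_derivative f t) (at t within {?a..?b})"
    by (rule interval_integral_FTC2) (use assms in \<open>auto intro: continuous_on_subset\<close>)
  moreover have "at t within {?a..?b} = at t"
    by (rule at_within_interior) auto
  ultimately show ?thesis
    by (simp add: has_real_derivative_iff_has_vector_derivative zero_ereal_def)
qed

lemma G_prim_has_derivative: "(G_prim n s has_real_derivative g_kernel n s t) (at t)"
  using LBINT_from_0_has_derivative[OF continuous_g_kernel] by (simp add: G_prim_def[abs_def])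

lemma continuous_G_prim: "continuous_on S (G_prim n s)"
  by (rule DERIV_continuous_on) (rule DERIV_subset[OF G_prim_has_derivative], simp)

lemma borel_measurable_G_prim [measurable]: "G_prim n s \<in> borel_measurable borel"
  by (rule borel_measurable_continuous_onI[OF continuous_G_prim])

lemma G_cal_has_derivative: "(G_cal n s has_real_derivative G_prim n s t) (at t)"
  using LBINT_from_0_has_derivative[OF continuous_G_prim] by (simp add: G_cal_def[abs_def])

lemma borel_measurable_G_cal [measurable]: "G_cal n s \<in> borel_measurable borel"
  by (intro borel_measurable_continuous_onI DERIV_continuous_on)
     (rule DERIV_subset[OF G_cal_has_derivative], simp)

lemma G_cal_diff:
  obtains \<xi> where "min a b \<le> \<xi>" "\<xi> \<le> max a b" "G_cal n s a - G_cal n s b = G_prim n s \<xi> * (a - b)"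
proof -
  consider "a < b" | "a = b" | "b < a" by linarith
  then show ?thesis
  proof cases
    case 1
    obtain z where "a < z" "z < b" "G_cal n s b - G_cal n s a = (b - a) * G_prim n s z"
      using MVT2[OF 1, of "G_cal n s" "G_prim n s"] G_cal_has_derivative by blast
    then show ?thesis using that[of z] 1 by (auto simp: algebra_simps)
  next
    case 2 then show ?thesis using that[of a] by auto
  next
    case 3
    obtain z where "b < z" "z < a" "G_cal n s a - G_cal n s b = (a - b) * G_prim n s z"
      using MVT2[OF 3, of "G_cal n s" "G_prim n s"] G_cal_has_derivative by blast
    then show ?thesis using that[of z] 3 by (auto simp: algebra_simps)
  qed
qed

lemma G_cal_convex:
  assumes "1 \<le> n" "0 \<le> s"
  shows "G_prim n s b * (a - b) \<le> G_cal n s a - G_cal n s b"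
proof -
  obtain \<xi> where x: "min a b \<le> \<xi>" "\<xi> \<le> max a b"
    and e: "G_cal n s a - G_cal n s b = G_prim n s \<xi> * (a - b)" by (rule G_cal_diff)
  show ?thesis
  proof (cases "b \<le> a")
    case True
    then have "G_prim n s b \<le> G_prim n s \<xi>" using x by (intro G_prim_mono assms) auto
    then show ?thesis unfolding e using True by (intro mult_right_mono) auto
  next
    case False
    then have "G_prim n s \<xi> \<le> G_prim n s b" using x by (intro G_prim_mono assms) auto
    then show ?thesis unfolding e using False by (intro mult_right_mono_neg) auto
  qed
qed

lemma G_cal_lipschitz:
  assumes "1 \<le> n" "0 \<le> s"
  shows "\<bar>G_cal n s a - G_cal n s b\<bar> \<le> G_lim n s * \<bar>a - b\<bar>"
proof -
  obtain \<xi> where e: "G_cal n s a - G_cal n s b = G_prim n s \<xi> * (a - b)" by (rule G_cal_diff)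
  show ?thesis unfolding e abs_mult by (intro mult_right_mono abs_G_prim_le assms) auto
qed

lemma G_prim_minus: 
  assumes "1 \<le> n" "0 \<le> s"
  shows "G_prim n s (- t) = - G_prim n s t"
proof -
  have "((\<lambda>t. G_prim n s (- t) + G_prim n s t) has_real_derivative 0) (at t within UNIV)" for t
    using G_prim_has_derivative[of n s "-t"] G_prim_has_derivative[of n s t]
    by (auto intro!: derivative_eq_intros DERIV_chain2[of "G_prim n s"] simp: g_kernel_def)
  then have "G_prim n s (- t) + G_prim n s t = G_prim n s (- 0) + G_prim n s 0"
    using DERIV_isconst_all[of "\<lambda>t. G_prim n s (- t) + G_prim n s t" t 0] by simp
  moreover have "G_prim n s 0 = 0" by (simp add: G_prim_def zero_ereal_def)
  ultimately show ?thesis by simp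
qed

lemma vertical_kernel_scaling:
  fixes r t \<tau> s :: real
  assumes "0 < r"
  shows "sqrt (r\<^sup>2 + (t + r * \<tau> - t)\<^sup>2) powr - (real n + 1 + s)
      = r powr - (real n + 1 + s) * g_kernel n s \<tau>"
proof -
  have p: "0 < 1 + \<tau>\<^sup>2" by (simp add: add_pos_nonneg)
  have "r\<^sup>2 + (t + r * \<tau> - t)\<^sup>2 = r\<^sup>2 * (1 + \<tau>\<^sup>2)" by (simp add: power_mult_distrib algebra_simps)
  then have "sqrt (r\<^sup>2 + (t + r * \<tau> - t)\<^sup>2) = r * sqrt (1 + \<tau>\<^sup>2)"
    using assms by (simp add: real_sqrt_mult)
  moreover have "sqrt (1 + \<tau>\<^sup>2) powr - (real n + 1 + s) = g_kernel n s \<tau>"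
    unfolding g_kernel_def using p by (simp add: powr_half_sqrt[symmetric] powr_powr)
  ultimately show ?thesis using assms p by (simp add: powr_mult)
qed

text \<open>
  Integrating the kernel of \<open>\<real>\<^sup>n\<^sup>+\<^sup>1\<close> along a vertical line at horizontal distance \<open>r\<close> gives back \<open>G_prim\<close>,
  by scaling. This turns the Euler-Lagrange expression of a function into a curvature of its subgraph.
\<close>

lemma vertical_integral_kernel:
  fixes r t b s :: real
  assumes "1 \<le> n" "0 \<le> s" "0 < r"
  shows "integrable lborel (\<lambda>\<tau>. sqrt (r\<^sup>2 + (\<tau> - t)\<^sup>2) powr - (real n + 1 + s))"
    and "(LINT \<tau>|lborel. sqrt (r\<^sup>2 + (\<tau> - t)\<^sup>2) powr - (real n + 1 + s))
           = 2 * (G_lim n s / r powr (real n + s))"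
    and "(LINT \<tau>|lborel. (if \<tau> < b then - 1 else 1) * sqrt (r\<^sup>2 + (\<tau> - t)\<^sup>2) powr - (real n + 1 + s))
           = 2 * (G_prim n s ((t - b) / r) / r powr (real n + s))"
proof -
  let ?k = "\<lambda>\<tau>. sqrt (r\<^sup>2 + (\<tau> - t)\<^sup>2) powr - (real n + 1 + s)"
  have r: "r * r powr - (real n + 1 + s) = 1 / r powr (real n + s)"
  proof -
    have "r powr 1 * r powr - (real n + 1 + s) = r powr (- (real n + s))"
      by (subst powr_add[symmetric]) (simp add: algebra_simps)
    also have "\<dots> = 1 / r powr (real n + s)" by (rule powr_minus_divide)
    finally show ?thesis using assms(3) by simp
  qed
  note sc = vertical_kernel_scaling[OF assms(3), of t _ n s]
  show "integrable lborel ?k"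
    by (subst lborel_integrable_real_affine_iff[where c=r and t=t, symmetric])
       (use assms sc g_kernel_integrable[OF assms(1,2)] in auto)
  show "(LINT \<tau>|lborel. ?k \<tau>) = 2 * (G_lim n s / r powr (real n + s))"
  proof -
    have "(LINT \<tau>|lborel. ?k \<tau>) = r * (LINT \<tau>|lborel. ?k (t + r * \<tau>))"
      using assms by (subst lborel_integral_real_affine[where c=r and t=t]) auto
    also have "\<dots> = r * r powr - (real n + 1 + s) * (LINT \<tau>|lborel. g_kernel n s \<tau>)"
      by (simp only: sc integral_mult_right_zero mult.assoc)
    also have "\<dots> = 2 * (G_lim n s / r powr (real n + s))"
      unfolding r G_lim_def by simp
    finally show ?thesis .
  qed
  have "(LINT \<tau>|lborel. (if \<tau> < b then - 1 else 1) * ?k \<tau>)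
      = r * (LINT \<tau>|lborel. (if t + r * \<tau> < b then - 1 else 1) * (r powr - (real n + 1 + s) * g_kernel n s \<tau>))"
    by (subst lborel_integral_real_affine[where c=r and t=t])
       (use assms in \<open>simp_all only: sc, simp\<close>)
  also have "\<dots> = r * (LINT \<tau>|lborel. - (r powr - (real n + 1 + s)) *
      (if \<tau> < (b - t) / r then g_kernel n s \<tau> else - g_kernel n s \<tau>))"
  proof -
    have "t + r * x < b \<longleftrightarrow> x < (b - t) / r" for x using assms(3) by (auto simp: field_simps)
    then show ?thesis
      by (intro arg_cong[where f="\<lambda>z. r * z"] Bochner_Integration.integral_cong refl) simp
  qed
  also have "\<dots> = - (r * r powr - (real n + 1 + s)) *
      (LINT \<tau>|lborel. (if \<tau> < (b - t) / r then g_kernel n s \<tau> else - g_kernel n s \<tau>))"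
    unfolding integral_mult_right_zero by (simp only: mult_minus_left mult_minus_right mult.assoc)
  also have "\<dots> = - (1 / r powr (real n + s)) * (2 * G_prim n s ((b - t) / r))"
    unfolding r G_prim_eq[OF assms(1,2)] by simp
  also have "(b - t) / r = - ((t - b) / r)" by (metis minus_diff_eq minus_divide_left)
  finally show "(LINT \<tau>|lborel. (if \<tau> < b then - 1 else 1) * ?k \<tau>)
           = 2 * (G_prim n s ((t - b) / r) / r powr (real n + s))"
    by (simp add: G_prim_minus[OF assms(1,2)])
qed

section \<open>Radial integrals\<close>

text \<open>
  Polar coordinates for radial integrands: both measures agree on half lines, where the right one is
  the derivative of the volume of balls.
\<close>

lemma distr_norm_lborel:
  "distr lborel borel (norm :: 'a::euclidean_space \<Rightarrow> real) =
    density lborel (\<lambda>r. ennreal (real DIM('a) * unit_ball_vol DIM('a) * r ^ (DIM('a) - 1)) * indicator {0..} r)"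
  (is "?M = ?N")
proof (rule measure_eqI_generator_eq[where E="range atMost" and \<Omega>=UNIV and A="\<lambda>i. {..real i}"])
  show "Int_stable (range (atMost :: real \<Rightarrow> _))"
    unfolding Int_stable_def
  proof clarify
    fix a b :: real
    have "{..a} \<inter> {..b} = {..min a b}" by auto
    then show "{..a} \<inter> {..b} \<in> range atMost" by blast
  qed
  show "sets ?M = sigma_sets UNIV (range atMost)" "sets ?N = sigma_sets UNIV (range atMost)"
    by (simp_all add: borel_eq_atMost)
  have M: "emeasure ?M {..r} = emeasure lborel (cball 0 r :: 'a set)" for r
    by (subst emeasure_distr) (auto intro!: arg_cong[where f="emeasure lborel"] simp: cball_def dist_norm)
  show "emeasure ?M X = emeasure ?N X" if X: "X \<in> range atMost" for X
  proof -
    obtain r where r: "X = {..r}" using X by auto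
    have N: "emeasure ?N X = (\<integral>\<^sup>+x. ennreal (real DIM('a) * unit_ball_vol DIM('a) * x ^ (DIM('a) - 1)) * indicator {0..r} x \<partial>lborel)"
      unfolding r by (subst emeasure_density) (auto intro!: nn_integral_cong simp: indicator_def)
    show ?thesis
    proof (cases "0 \<le> r")
      case True
      have "((\<lambda>x. unit_ball_vol DIM('a) * x ^ DIM('a)) has_real_derivative
          real DIM('a) * unit_ball_vol DIM('a) * x ^ (DIM('a) - 1)) (at x)" for x
        by (auto intro!: derivative_eq_intros)
      then have "emeasure ?N X = ennreal (unit_ball_vol DIM('a) * r ^ DIM('a) - unit_ball_vol DIM('a) * 0 ^ DIM('a))"
        unfolding N by (intro nn_integral_FTC_Icc) (use True in auto)
      then show ?thesis using True unfolding r M by (simp add: emeasure_cball)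
    next
      case False
      then show ?thesis unfolding N unfolding r M by (simp add: cball_empty)
    qed
  qed
  show "emeasure ?M {..real i} \<noteq> \<infinity>" for i
    unfolding M by (simp add: emeasure_cball)
  show "(\<Union>i. {..real i}) = UNIV" by (auto simp: real_arch_simple)
qed auto

lemma nn_integral_radial:
  assumes [measurable]: "h \<in> borel_measurable borel"
  shows "(\<integral>\<^sup>+Y. h (norm (Y::'a::euclidean_space)) \<partial>lborel) =
    (\<integral>\<^sup>+r. ennreal (real DIM('a) * unit_ball_vol DIM('a) * r ^ (DIM('a) - 1)) * indicator {0..} r * h r \<partial>lborel)"
proof -
  have "(\<integral>\<^sup>+Y. h (norm (Y::'a)) \<partial>lborel) = (\<integral>\<^sup>+r. h r \<partial>distr lborel borel (norm :: 'a \<Rightarrow> real))"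
    by (subst nn_integral_distr) auto
  then show ?thesis unfolding distr_norm_lborel by (subst (asm) nn_integral_density) auto
qed

lemma omega_eq: "omega N = real N * unit_ball_vol N" if "0 < N"
proof -
  have "Gamma (real N / 2 + 1) = real N / 2 * Gamma (real N / 2)"
    by (rule Gamma_plus1) (use that in auto)
  moreover have "0 < Gamma (real N / 2)" using that by (simp add: Gamma_real_pos)
  ultimately show ?thesis unfolding omega_def unit_ball_vol_def using that by (simp only:) (simp add: field_simps)
qed

text \<open>
  The only exact constant in the whole argument: it makes \<open>omega\<close> the coefficient of \<open>1/s\<close>.
\<close>

lemma nn_integral_riesz_tail:
  assumes "0 < c" "0 < s"
  shows "(\<integral>\<^sup>+Y. ennreal (norm (Y::'a::euclidean_space) powr - (real DIM('a) + s)) * indicator {Y. c \<le> norm Y} Y \<partial>lborel)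
    = ennreal (omega DIM('a) * c powr - s / s)"
proof -
  let ?N = "DIM('a)" and ?V = "unit_ball_vol DIM('a)"
  have "(\<integral>\<^sup>+Y. ennreal (norm (Y::'a) powr - (real ?N + s)) * indicator {Y. c \<le> norm Y} Y \<partial>lborel)
     = (\<integral>\<^sup>+Y. (\<lambda>r. ennreal (r powr - (real ?N + s)) * indicator {c..} r) (norm (Y::'a)) \<partial>lborel)"
    by (intro nn_integral_cong) (auto simp: indicator_def)
  also have "\<dots> = (\<integral>\<^sup>+r. ennreal (real ?N * ?V * r ^ (?N - 1)) * indicator {0..} r *
      (ennreal (r powr - (real ?N + s)) * indicator {c..} r) \<partial>lborel)"
    by (rule nn_integral_radial) simp
  also have "\<dots> = (\<integral>\<^sup>+r. ennreal (real ?N * ?V) * (ennreal (r powr (- 1 - s)) * indicator {c..} r) \<partial>lborel)"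
  proof (rule nn_integral_cong)
    fix r :: real
    show "ennreal (real ?N * ?V * r ^ (?N - 1)) * indicator {0..} r * (ennreal (r powr - (real ?N + s)) * indicator {c..} r)
      = ennreal (real ?N * ?V) * (ennreal (r powr (- 1 - s)) * indicator {c..} r)"
    proof (cases "c \<le> r")
      case True
      then have r: "0 < r" using assms by simp
      have "r ^ (?N - 1) * r powr - (real ?N + s) = r powr (- 1 - s)"
        using r by (simp add: powr_realpow[symmetric] powr_add[symmetric] of_nat_diff)
      then show ?thesis using True r by (simp add: ennreal_mult'[symmetric] mult.assoc)
    qed (simp add: indicator_def)
  qed
  also have "\<dots> = ennreal (real ?N * ?V) * (\<integral>\<^sup>+r. ennreal (r powr (- 1 - s)) * indicator {c..} r \<partial>lborel)"
    by (rule nn_integral_cmult) simp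
  also have "(\<integral>\<^sup>+r. ennreal (r powr (- 1 - s)) * indicator {c..} r \<partial>lborel) = ennreal (- (c powr (- 1 - s + 1)) / (- 1 - s + 1))"
    by (rule nn_integral_has_integral_lebesgue'[OF _ has_integral_powr_to_inf]) (use assms in auto)
  finally show ?thesis using assms by (simp add: omega_eq ennreal_mult'[symmetric])
qed

lemma nn_integral_riesz_ball_finite:
  assumes "0 < \<beta>" "0 < c"
  shows "(\<integral>\<^sup>+Y. ennreal (norm (Y::'a::euclidean_space) powr (\<beta> - real DIM('a))) * indicator {Y. norm Y \<le> c} Y \<partial>lborel) < \<infinity>"
proof -
  let ?N = "DIM('a)" and ?V = "unit_ball_vol DIM('a)"
  have "(\<integral>\<^sup>+Y. ennreal (norm (Y::'a) powr (\<beta> - real ?N)) * indicator {Y. norm Y \<le> c} Y \<partial>lborel)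
     = (\<integral>\<^sup>+Y. (\<lambda>r. ennreal (r powr (\<beta> - real ?N)) * indicator {..c} r) (norm (Y::'a)) \<partial>lborel)"
    by (intro nn_integral_cong) (auto simp: indicator_def)
  also have "\<dots> = (\<integral>\<^sup>+r. ennreal (real ?N * ?V * r ^ (?N - 1)) * indicator {0..} r *
      (ennreal (r powr (\<beta> - real ?N)) * indicator {..c} r) \<partial>lborel)"
    by (rule nn_integral_radial) simp
  also have "\<dots> = (\<integral>\<^sup>+r. ennreal (real ?N * ?V) * (ennreal (r powr (\<beta> - 1)) * indicator {0..c} r) \<partial>lborel)"
  proof (rule nn_integral_cong)
    fix r :: real
    show "ennreal (real ?N * ?V * r ^ (?N - 1)) * indicator {0..} r * (ennreal (r powr (\<beta> - real ?N)) * indicator {..c} r)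
      = ennreal (real ?N * ?V) * (ennreal (r powr (\<beta> - 1)) * indicator {0..c} r)"
    proof (cases "0 < r \<and> r \<le> c")
      case True
      then have r: "0 < r" by simp
      have "r ^ (?N - 1) * r powr (\<beta> - real ?N) = r powr (\<beta> - 1)"
        using r by (simp add: powr_realpow[symmetric] powr_add[symmetric] of_nat_diff)
      then show ?thesis using True r by (simp add: ennreal_mult'[symmetric] mult.assoc)
    qed (auto simp: indicator_def)
  qed
  also have "\<dots> = ennreal (real ?N * ?V) * (\<integral>\<^sup>+r. ennreal (r powr (\<beta> - 1)) * indicator {0..c} r \<partial>lborel)"
    by (rule nn_integral_cmult) simp
  also have "(\<integral>\<^sup>+r. ennreal (r powr (\<beta> - 1)) * indicator {0..c} r \<partial>lborel) = ennreal (c powr (\<beta> - 1 + 1) / (\<beta> - 1 + 1))"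
    by (rule nn_integral_has_integral_lebesgue'[OF _ has_integral_powr_from_0]) (use assms in auto)
  finally show ?thesis by (simp add: ennreal_mult'[symmetric])
qed

lemma nn_integral_lborel_translate:
  assumes [measurable]: "f \<in> borel_measurable borel"
  shows "(\<integral>\<^sup>+Y. f (Y - X) \<partial>lborel) = (\<integral>\<^sup>+Y. f (Y :: 'a::euclidean_space) \<partial>lborel)"
proof -
  have "(\<integral>\<^sup>+Y. f Y \<partial>lborel) = (\<integral>\<^sup>+Y. f Y \<partial>distr lborel borel ((+) (- X)))"
    by (simp only: lborel_distr_plus)
  then show ?thesis by (subst (asm) nn_integral_distr) auto
qed

lemma nn_integral_lborel_reflect:
  assumes [measurable]: "f \<in> borel_measurable borel"
  shows "(\<integral>\<^sup>+Y. f (X - Y) \<partial>lborel) = (\<integral>\<^sup>+Y. f (Y :: 'a::euclidean_space) \<partial>lborel)"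
proof -
  have "(\<integral>\<^sup>+Y. f Y \<partial>lborel) = (\<integral>\<^sup>+Y. f Y \<partial>distr lborel borel (\<lambda>x. X + (-1) *\<^sub>R x))"
    by (subst lborel_affine[of "-1" X]) (simp_all add: density_1)
  then show ?thesis by (subst (asm) nn_integral_distr) auto
qed

section \<open>Packing of translates\<close>

text \<open>
  A set with many disjoint translates inside one ball has small measure. This replaces changes of
  variables in the estimates of slabs and graphs, whose directions are not coordinate directions.
\<close>

lemma packing_translates:
  fixes S :: "'a::euclidean_space set"
  assumes S: "S \<in> sets borel" "S \<subseteq> cball a r" and J: "finite J"
    and t: "\<And>j. j \<in> J \<Longrightarrow> norm (t j) \<le> r'"
    and disj: "\<And>i j x y. i \<in> J \<Longrightarrow> j \<in> J \<Longrightarrow> i \<noteq> j \<Longrightarrow> x \<in> S \<Longrightarrow> y \<in> S \<Longrightarrow> x + t i \<noteq> y + t j"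
  shows "of_nat (card J) * emeasure lborel S \<le> emeasure lborel (cball a (r + r'))"
proof -
  let ?T = "\<lambda>j. (\<lambda>x. x - t j) -` S"
  have m: "?T j \<in> sets borel" for j
    using measurable_sets_borel[OF _ S(1), of "\<lambda>x. x - t j"] by simp
  have e: "emeasure lborel (?T j) = emeasure lborel S" for j
    using nn_integral_lborel_translate[of "indicator S" "t j"] S(1) m[of j]
    by (subst (1 2) nn_integral_indicator[symmetric])
       (auto simp: indicator_def[abs_def] vimage_def intro!: nn_integral_cong)
  have d: "disjoint_family_on ?T J"
    unfolding disjoint_family_on_def using disj by (auto) (metis diff_add_cancel)
  have "of_nat (card J) * emeasure lborel S = (\<Sum>j\<in>J. emeasure lborel (?T j))"
    by (simp add: e)
  also have "\<dots> = emeasure lborel (\<Union>j\<in>J. ?T j)"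
    by (rule sum_emeasure) (use m d J in auto)
  also have "\<dots> \<le> emeasure lborel (cball a (r + r'))"
  proof (rule emeasure_mono)
    show "(\<Union>j\<in>J. ?T j) \<subseteq> cball a (r + r')"
    proof clarsimp
      fix j x assume j: "j \<in> J" and x: "x - t j \<in> S"
      have "dist a x \<le> dist a (x - t j) + dist (x - t j) x" by (rule dist_triangle)
      moreover have "dist a (x - t j) \<le> r" using x S(2) by auto
      moreover have "dist (x - t j) x \<le> r'" using t[OF j] by (simp add: dist_norm)
      ultimately show "dist a x \<le> r + r'" by simp
    qed
  qed simp
  finally show ?thesis .
qed

text \<open>
  About \<open>r / (3 \<eta>)\<close> translates of the slab in the direction \<open>\<nu>\<close>, by multiples of \<open>3 \<eta>\<close>, are disjoint.
\<close>

lemma emeasure_slab_le: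
  fixes \<nu> :: "'a::euclidean_space"
  assumes "norm \<nu> = 1" "0 < r" "0 < \<eta>"
  shows "emeasure lborel {Z. norm Z \<le> r \<and> \<bar>\<nu> \<bullet> Z\<bar> \<le> \<eta>}
    \<le> ennreal (3 * \<eta> / r * (unit_ball_vol DIM('a) * (2 * r) ^ DIM('a)))" (is "emeasure _ ?S \<le> _")
proof -
  \<comment> \<open>The largest translation, by \<open>3 * \<eta> * (m - 1)\<close>, has length at most \<open>r\<close>.\<close>
  define m where "m = nat \<lfloor>r / (3 * \<eta>)\<rfloor> + 1"
  have m: "r / (3 * \<eta>) \<le> real m"
    unfolding m_def using assms by (simp add: of_nat_nat) linarith
  have [measurable]: "?S \<in> sets borel" by measurable
  have nn: "\<nu> \<bullet> \<nu> = 1" using assms(1) by (simp add: dot_square_norm)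
  have "of_nat (card {..<m}) * emeasure lborel ?S \<le> emeasure lborel (cball (0::'a) (r + r))"
  proof (rule packing_translates[where t="\<lambda>j. (3 * \<eta> * real j) *\<^sub>R \<nu>"])
    show "?S \<subseteq> cball 0 r" by auto
    fix j assume "j \<in> {..<m}"
    moreover have "0 \<le> \<lfloor>r / (3 * \<eta>)\<rfloor>" using assms by simp
    ultimately have "int j \<le> \<lfloor>r / (3 * \<eta>)\<rfloor>" unfolding m_def lessThan_iff by linarith
    then have "real j \<le> r / (3 * \<eta>)" by (simp add: le_floor_iff)
    then show "norm ((3 * \<eta> * real j) *\<^sub>R \<nu>) \<le> r" using assms by (simp add: field_simps)
  next
    fix i j :: nat and x y assume ij: "i \<noteq> j" and x: "x \<in> ?S" and y: "y \<in> ?S"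
    show "x + (3 * \<eta> * real i) *\<^sub>R \<nu> \<noteq> y + (3 * \<eta> * real j) *\<^sub>R \<nu>"
    proof
      assume "x + (3 * \<eta> * real i) *\<^sub>R \<nu> = y + (3 * \<eta> * real j) *\<^sub>R \<nu>"
      then have "\<nu> \<bullet> (x + (3 * \<eta> * real i) *\<^sub>R \<nu>) = \<nu> \<bullet> (y + (3 * \<eta> * real j) *\<^sub>R \<nu>)" by simp
      then have "\<nu> \<bullet> x - \<nu> \<bullet> y = 3 * \<eta> * (real j - real i)"
        by (simp add: inner_add_right nn algebra_simps)
      moreover have "\<bar>\<nu> \<bullet> x - \<nu> \<bullet> y\<bar> \<le> 2 * \<eta>" using x y by auto
      moreover have "3 * \<eta> * 1 \<le> 3 * \<eta> * \<bar>real j - real i\<bar>"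
        using ij assms by (intro mult_left_mono) auto
      moreover have "\<bar>3 * \<eta> * (real j - real i)\<bar> = 3 * \<eta> * \<bar>real j - real i\<bar>"
        using assms by (simp only: abs_mult)
      ultimately show False using assms(3) by linarith
    qed
  qed (use assms in auto)
  also have "emeasure lborel (cball (0::'a) (r + r)) = ennreal (unit_ball_vol DIM('a) * (r + r) ^ DIM('a))"
    by (rule emeasure_cball) (use assms in auto)
  also have "r + r = 2 * r" by simp
  also have "card {..<m} = m" by simp
  finally have a: "of_nat m * emeasure lborel ?S \<le> ennreal (unit_ball_vol DIM('a) * (2 * r) ^ DIM('a))" .
  have "ennreal (r / (3 * \<eta>)) * emeasure lborel ?S \<le> of_nat m * emeasure lborel ?S"
    using m by (intro mult_right_mono) (auto simp: ennreal_of_nat_eq_real_of_nat)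
  with a have "ennreal (r / (3 * \<eta>)) * emeasure lborel ?S \<le> ennreal (unit_ball_vol DIM('a) * (2 * r) ^ DIM('a))"
    by order
  then have "ennreal (3 * \<eta> / r) * (ennreal (r / (3 * \<eta>)) * emeasure lborel ?S)
    \<le> ennreal (3 * \<eta> / r) * ennreal (unit_ball_vol DIM('a) * (2 * r) ^ DIM('a))"
    by (intro mult_left_mono) auto
  moreover have "ennreal (3 * \<eta> / r) * ennreal (r / (3 * \<eta>)) = 1"
    using assms by (subst ennreal_mult'[symmetric]) auto
  ultimately have "emeasure lborel ?S \<le> ennreal (3 * \<eta> / r) * ennreal (unit_ball_vol DIM('a) * (2 * r) ^ DIM('a))"
    by (simp only: mult.assoc[symmetric] mult_1)
  also have "\<dots> = ennreal (3 * \<eta> / r * (unit_ball_vol DIM('a) * (2 * r) ^ DIM('a)))"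
    by (rule ennreal_mult'[symmetric]) (use assms in auto)
  finally show ?thesis .
qed

lemma ennreal_le_suminf: "f i \<le> suminf f" for f :: "nat \<Rightarrow> ennreal"
  using sum_le_suminf[of f "{i}"] by simp

text \<open>
  The region between two balls tangent at \<open>0\<close>. In a dyadic shell of radius \<open>r\<close> it is contained in a slab of
  width comparable to \<open>r\<^sup>2\<close>, so it has measure of order \<open>r\<close> to the power \<open>N + 1\<close>; this beats the
  singularity of order \<open>N + 1/2\<close>. The bound does not depend on the direction \<open>\<nu>\<close>.
\<close>

lemma nn_integral_tangent_region_le:
  fixes \<kappa> \<rho> :: real
  assumes "0 < \<kappa>" "0 < \<rho>"
  obtains C where "0 \<le> C" "\<And>\<nu> :: 'a::euclidean_space. norm \<nu> = 1 \<Longrightarrow>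
    (\<integral>\<^sup>+Z. ennreal (norm Z powr - (real DIM('a) + 1 / 2)) *
       indicator {Z. norm Z < \<rho> \<and> \<bar>\<nu> \<bullet> Z\<bar> \<le> \<kappa> * (norm Z)\<^sup>2} Z \<partial>lborel) \<le> ennreal C"
proof -
  let ?N = "DIM('a)" and ?V = "unit_ball_vol DIM('a)"
  define r where "r j = \<rho> / 2 ^ j" for j :: nat
  have r: "0 < r j" for j using assms by (simp add: r_def)
  define C where "C = 3 * \<kappa> * ?V * 2 ^ ?N * 2 powr (real ?N + 1 / 2)"
  have C: "0 \<le> C" using assms by (simp add: C_def)
  define q where "q j = C * (\<rho> powr (1/2) * (2 powr - (1/2)) ^ j)" for j :: nat
  have sq: "summable q"
    unfolding q_def
  proof (intro summable_mult summable_geometric)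
    have "(2::real) powr - (1/2) < 2 powr 0" by (rule powr_less_mono) auto
    then show "norm ((2::real) powr - (1/2)) < 1" by simp
  qed
  have q0: "0 \<le> q j" for j using C by (simp add: q_def)
  show thesis
  proof (rule that)
    show "0 \<le> suminf q" by (rule suminf_nonneg[OF sq q0])
    fix \<nu> :: 'a assume nu: "norm \<nu> = 1"
    let ?S = "\<lambda>j. {Z. norm Z \<le> r j \<and> \<bar>\<nu> \<bullet> Z\<bar> \<le> \<kappa> * (r j)\<^sup>2}"
    let ?h = "\<lambda>j Z. ennreal ((r j / 2) powr - (real ?N + 1/2)) * indicator (?S j) Z"
    have [measurable]: "?S j \<in> sets borel" for j by measurable
    have "(\<integral>\<^sup>+Z. ennreal (norm Z powr - (real ?N + 1 / 2)) *
       indicator {Z. norm Z < \<rho> \<and> \<bar>\<nu> \<bullet> Z\<bar> \<le> \<kappa> * (norm Z)\<^sup>2} Z \<partial>lborel)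
      \<le> (\<integral>\<^sup>+Z. (\<Sum>j. ?h j Z) \<partial>lborel)"
    proof (rule nn_integral_mono)
      fix Z :: 'a
      show "ennreal (norm Z powr - (real ?N + 1 / 2)) *
        indicator {Z. norm Z < \<rho> \<and> \<bar>\<nu> \<bullet> Z\<bar> \<le> \<kappa> * (norm Z)\<^sup>2} Z \<le> (\<Sum>j. ?h j Z)"
      proof (cases "Z \<noteq> 0 \<and> norm Z < \<rho> \<and> \<bar>\<nu> \<bullet> Z\<bar> \<le> \<kappa> * (norm Z)\<^sup>2")
        case True
        have "\<exists>j. r j \<le> norm Z"
        proof -
          obtain j where "(1/2::real) ^ j < norm Z / \<rho>"
            using real_arch_pow_inv[of "norm Z / \<rho>" "1/2"] True assms by auto
          then have "r j \<le> norm Z" using assms by (simp add: r_def field_simps)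
          then show ?thesis by blast
        qed
        then obtain j where j: "r j \<le> norm Z" and least: "\<And>i. i < j \<Longrightarrow> norm Z < r i"
          using exists_least_iff[of "\<lambda>j. r j \<le> norm Z"] by (auto simp: not_le)
        have "j \<noteq> 0" using j True by (cases j) (auto simp: r_def)
        then obtain i where i: "j = Suc i" using not0_implies_Suc by blast
        have up: "norm Z \<le> r i" using least[of i] i by simp
        have lo: "r i / 2 \<le> norm Z" using j by (simp add: i r_def)
        have "Z \<in> ?S i"
        proof -
          have "\<kappa> * (norm Z)\<^sup>2 \<le> \<kappa> * (r i)\<^sup>2"
            using up assms by (intro mult_left_mono power_mono) auto
          then show ?thesis using True up by auto
        qed
        moreover have "norm Z powr - (real ?N + 1 / 2) \<le> (r i / 2) powr - (real ?N + 1/2)"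
          by (rule powr_mono2') (use lo r[of i] in auto)
        ultimately have "ennreal (norm Z powr - (real ?N + 1 / 2)) \<le> ?h i Z"
          by (auto intro: ennreal_leI)
        also have "?h i Z \<le> (\<Sum>j. ?h j Z)" by (rule ennreal_le_suminf)
        finally show ?thesis using True by simp
      qed (auto simp: indicator_def)
    qed
    also have "\<dots> = (\<Sum>j. \<integral>\<^sup>+Z. ?h j Z \<partial>lborel)"
      by (rule nn_integral_suminf) simp
    also have "\<dots> \<le> (\<Sum>j. ennreal (q j))"
    proof (rule suminf_le)
      fix j
      have "(\<integral>\<^sup>+Z. ?h j Z \<partial>lborel) = ennreal ((r j / 2) powr - (real ?N + 1/2)) * emeasure lborel (?S j)"
        by (simp add: nn_integral_cmult_indicator)
      also have "\<dots> \<le> ennreal ((r j / 2) powr - (real ?N + 1/2)) *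
          ennreal (3 * (\<kappa> * (r j)\<^sup>2) / r j * (?V * (2 * r j) ^ ?N))"
        by (intro mult_left_mono emeasure_slab_le) (use nu r[of j] assms in auto)
      also have "\<dots> = ennreal (q j)"
      proof -
        have rr: "r j powr - (real ?N + 1/2) * (r j * r j ^ ?N) = \<rho> powr (1/2) * (2 powr - (1/2)) ^ j"
        proof -
          have "r j powr - (real ?N + 1/2) * (r j * r j ^ ?N) = r j powr (1/2)"
          proof -
            have "r j * r j ^ ?N = r j powr (real ?N + 1)"
              using r[of j] by (simp add: powr_add powr_realpow)
            then show ?thesis by (simp add: powr_add[symmetric])
          qed
          also have "\<dots> = \<rho> powr (1/2) / (2 ^ j) powr (1/2)"
            unfolding r_def using assms by (simp add: powr_divide)
          also have "(2 ^ j) powr (1/2) = (2 powr (1/2::real)) ^ j"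
            by (simp add: powr_realpow[symmetric] powr_powr mult.commute)
          finally show ?thesis unfolding powr_minus_divide[of 2 "1/2"] by (simp only: power_divide) simp
        qed
        have "(r j / 2) powr - (real ?N + 1/2) * (3 * (\<kappa> * (r j)\<^sup>2) / r j * (?V * (2 * r j) ^ ?N))
          = C * (r j powr - (real ?N + 1/2) * (r j * r j ^ ?N))"
        proof -
          define a where "a = real ?N + 1/2"
          have p: "(r j / 2) powr - a = 2 powr a * r j powr - a"
            using r[of j] by (simp add: powr_divide powr_minus divide_simps)
          have q: "(r j)\<^sup>2 / r j = r j" using r[of j] by (simp add: power2_eq_square)
          have "(r j / 2) powr - a * (3 * (\<kappa> * (r j)\<^sup>2) / r j * (?V * (2 * r j) ^ ?N))
            = 2 powr a * r j powr - a * (3 * \<kappa> * ((r j)\<^sup>2 / r j) * (?V * (2 ^ ?N * r j ^ ?N)))"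
            unfolding p power_mult_distrib by (simp only: times_divide_eq_right times_divide_eq_left mult_ac)
          then show ?thesis unfolding C_def a_def[symmetric] q by (simp only: mult_ac)
        qed
        then show ?thesis unfolding q_def rr using r[of j] by (subst ennreal_mult'[symmetric]) auto
      qed
      finally show "(\<integral>\<^sup>+Z. ?h j Z \<partial>lborel) \<le> ennreal (q j)" .
    qed auto
    also have "\<dots> = ennreal (suminf q)"
      by (rule suminf_ennreal2[OF q0 sq])
    finally show "(\<integral>\<^sup>+Z. ennreal (norm Z powr - (real ?N + 1 / 2)) *
       indicator {Z. norm Z < \<rho> \<and> \<bar>\<nu> \<bullet> Z\<bar> \<le> \<kappa> * (norm Z)\<^sup>2} Z \<partial>lborel) \<le> ennreal (suminf q)" .
  qed
qed

lemma borel_measurable_fst_snd: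
  "(fst :: 'a::euclidean_space \<times> 'b::euclidean_space \<Rightarrow> 'a) \<in> borel \<rightarrow>\<^sub>M borel"
  "(snd :: 'a \<times> 'b \<Rightarrow> 'b) \<in> borel \<rightarrow>\<^sub>M borel"
  by (intro borel_measurable_continuous_onI continuous_intros)+

section \<open>The Riesz measure and the curvature estimate\<close>

definition riesz :: "real \<Rightarrow> 'b::euclidean_space \<Rightarrow> real"
  where "riesz s Z = norm Z powr - (real DIM('b) + s)"

text \<open>
  Weighting Lebesgue measure by the kernel centred at \<open>X\<close> makes curvature estimates a matter of
  monotonicity and additivity of a measure.
\<close>

definition riesz_measure :: "real \<Rightarrow> 'b::euclidean_space \<Rightarrow> 'b measure"
  where "riesz_measure s X = density lborel (\<lambda>Y. ennreal (riesz s (Y - X)))"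

lemma borel_measurable_riesz [measurable]: "riesz s \<in> borel_measurable borel"
  unfolding riesz_def[abs_def] by measurable

lemma riesz_nonneg: "0 \<le> riesz s Z"
  by (simp add: riesz_def)

lemma riesz_minus: "riesz s (X - Y) = riesz s (Y - X)"
  by (simp add: riesz_def norm_minus_commute)

lemma sets_riesz_measure [simp, measurable_cong]: "sets (riesz_measure s X) = sets borel"
  by (simp add: riesz_measure_def)

lemma emeasure_riesz_measure:
  "S \<in> sets borel \<Longrightarrow> emeasure (riesz_measure s X) S = (\<integral>\<^sup>+Y. ennreal (riesz s (Y - X)) * indicator S Y \<partial>lborel)"
  unfolding riesz_measure_def by (subst emeasure_density) auto

lemma emeasure_riesz_measure_tail:
  fixes X :: "'b::euclidean_space"
  assumes "0 < c" "0 < s"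
  shows "emeasure (riesz_measure s X) {Y. c \<le> norm (Y - X)} = ennreal (omega DIM('b) * c powr - s / s)"
proof -
  have "emeasure (riesz_measure s X) {Y. c \<le> norm (Y - X)}
      = (\<integral>\<^sup>+Y. (\<lambda>Z. ennreal (riesz s Z) * indicator {Z. c \<le> norm Z} Z) (Y - X) \<partial>lborel)"
    by (subst emeasure_riesz_measure) (auto intro!: nn_integral_cong simp: indicator_def)
  also have "\<dots> = (\<integral>\<^sup>+Z. ennreal (riesz s Z) * indicator {Z::'b. c \<le> norm Z} Z \<partial>lborel)"
    by (rule nn_integral_lborel_translate) measurable
  finally show ?thesis unfolding riesz_def by (simp only: nn_integral_riesz_tail[OF assms])
qed

lemma emeasure_riesz_measure_reflect:
  fixes X :: "'b::euclidean_space"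
  assumes [measurable]: "S \<in> sets borel"
  shows "emeasure (riesz_measure s X) ((\<lambda>Y. X + X - Y) -` S) = emeasure (riesz_measure s X) S"
proof -
  have [measurable]: "(\<lambda>Y. X + X - Y) -` S \<in> sets borel"
    using measurable_sets_borel[OF _ assms, of "\<lambda>Y. X + X - Y"] by simp
  have "emeasure (riesz_measure s X) ((\<lambda>Y. X + X - Y) -` S)
      = (\<integral>\<^sup>+Y. (\<lambda>Y. ennreal (riesz s (Y - X)) * indicator S Y) (X + X - Y) \<partial>lborel)"
    by (subst emeasure_riesz_measure)
      (auto intro!: nn_integral_cong simp: indicator_def riesz_minus[of s X])
  also have "\<dots> = emeasure (riesz_measure s X) S"
    by (subst nn_integral_lborel_reflect) (auto simp: emeasure_riesz_measure)
  finally show ?thesis .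
qed

text \<open>
  The points outside the ball around \<open>c\<close> through \<open>X\<close> and outside its reflection about \<open>X\<close> lie, after
  translation, in the region of \<open>nn_integral_tangent_region_le\<close>. Because distances are at most \<open>1\<close>, the exponent may be replaced by
  the one for \<open>s = 1/2\<close>, which makes the bound uniform in \<open>s\<close>.
\<close>

lemma emeasure_riesz_measure_tangent_balls:
  assumes "0 < \<delta>" "2 * \<delta> \<le> 1"
  obtains C where "0 \<le> C" "\<And>s (X :: 'b::euclidean_space) c. 0 < s \<Longrightarrow> s \<le> 1/2 \<Longrightarrow> norm (X - c) = \<delta> \<Longrightarrow>
    emeasure (riesz_measure s X) {Y. norm (Y - X) < 2 * \<delta> \<and> \<delta> \<le> norm (Y - c) \<and> \<delta> \<le> norm (X + X - Y - c)} \<le> ennreal C"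
proof -
  obtain C where C: "0 \<le> C" "\<And>\<nu> :: 'b. norm \<nu> = 1 \<Longrightarrow>
    (\<integral>\<^sup>+Z. ennreal (norm Z powr - (real DIM('b) + 1 / 2)) *
       indicator {Z. norm Z < 2 * \<delta> \<and> \<bar>\<nu> \<bullet> Z\<bar> \<le> 1 / (2 * \<delta>) * (norm Z)\<^sup>2} Z \<partial>lborel) \<le> ennreal C"
    using nn_integral_tangent_region_le[of "1 / (2 * \<delta>)" "2 * \<delta>"] assms by auto
  show thesis
  proof (rule that[OF C(1)])
    fix s :: real and X c :: 'b
    assume s: "0 < s" "s \<le> 1/2" and Xc: "norm (X - c) = \<delta>"
    let ?S = "{Y. norm (Y - X) < 2 * \<delta> \<and> \<delta> \<le> norm (Y - c) \<and> \<delta> \<le> norm (X + X - Y - c)}"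
    define \<nu> where "\<nu> = (1 / \<delta>) *\<^sub>R (X - c)"
    have nu: "norm \<nu> = 1" using Xc assms by (simp add: \<nu>_def)
    have Xc': "X - c = \<delta> *\<^sub>R \<nu>" using assms by (simp add: \<nu>_def)
    let ?h = "\<lambda>Z. ennreal (norm Z powr - (real DIM('b) + 1 / 2)) *
       indicator {Z. norm Z < 2 * \<delta> \<and> \<bar>\<nu> \<bullet> Z\<bar> \<le> 1 / (2 * \<delta>) * (norm Z)\<^sup>2} Z"
    have "emeasure (riesz_measure s X) ?S \<le> (\<integral>\<^sup>+Y. ?h (Y - X) \<partial>lborel)"
    proof (subst emeasure_riesz_measure)
      show "(\<integral>\<^sup>+Y. ennreal (riesz s (Y - X)) * indicator ?S Y \<partial>lborel) \<le> (\<integral>\<^sup>+Y. ?h (Y - X) \<partial>lborel)"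
      proof (rule nn_integral_mono)
        fix Y :: 'b
        define Z where "Z = Y - X"
        show "ennreal (riesz s (Y - X)) * indicator ?S Y \<le> ?h (Y - X)"
        proof (cases "Y \<in> ?S")
          case True
          have y1: "Y - c = Z + \<delta> *\<^sub>R \<nu>" unfolding Xc'[symmetric] Z_def by simp
          have y2: "X + X - Y - c = \<delta> *\<^sub>R \<nu> - Z" unfolding Xc'[symmetric] Z_def by simp
          have "\<delta>\<^sup>2 \<le> (norm (Z + \<delta> *\<^sub>R \<nu>))\<^sup>2" "\<delta>\<^sup>2 \<le> (norm (\<delta> *\<^sub>R \<nu> - Z))\<^sup>2"
            using True assms unfolding y1[symmetric] y2[symmetric] by (auto intro!: power_mono)
          moreover have "(norm (Z + \<delta> *\<^sub>R \<nu>))\<^sup>2 = (norm Z)\<^sup>2 + 2 * (\<delta> * (\<nu> \<bullet> Z)) + \<delta>\<^sup>2 * (\<nu> \<bullet> \<nu>)"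
            unfolding power2_norm_eq_inner
            by (simp add: inner_add_left inner_add_right inner_commute[of Z \<nu>] power2_eq_square algebra_simps)
          moreover have "(norm (\<delta> *\<^sub>R \<nu> - Z))\<^sup>2 = (norm Z)\<^sup>2 - 2 * (\<delta> * (\<nu> \<bullet> Z)) + \<delta>\<^sup>2 * (\<nu> \<bullet> \<nu>)"
            unfolding power2_norm_eq_inner
            by (simp add: inner_diff_left inner_diff_right inner_commute[of Z \<nu>] power2_eq_square algebra_simps)
          moreover have "\<nu> \<bullet> \<nu> = 1" using nu by (simp add: dot_square_norm)
          ultimately have "\<bar>2 * (\<delta> * (\<nu> \<bullet> Z))\<bar> \<le> (norm Z)\<^sup>2" by simp
          then have "\<bar>\<nu> \<bullet> Z\<bar> \<le> 1 / (2 * \<delta>) * (norm Z)\<^sup>2"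
            using assms by (simp add: abs_mult field_simps)
          moreover have "norm Z < 2 * \<delta>" using True by (simp add: Z_def)
          moreover have "riesz s Z \<le> norm Z powr - (real DIM('b) + 1 / 2)"
          proof (cases "Z = 0")
            case False
            have "norm Z \<le> 1" using \<open>norm Z < 2 * \<delta>\<close> assms by simp
            then show ?thesis unfolding riesz_def by (intro powr_mono') (use s False in auto)
          qed (simp add: riesz_def)
          ultimately show ?thesis unfolding Z_def[symmetric] by (auto simp: indicator_def intro: ennreal_leI)
        qed simp
      qed
    qed measurable
    also have "\<dots> = (\<integral>\<^sup>+Z. ?h Z \<partial>lborel)"
      by (rule nn_integral_lborel_translate) measurable
    also have "\<dots> \<le> ennreal C" by (rule C(2)[OF nu])
    finally show "emeasure (riesz_measure s X) ?S \<le> ennreal C" .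
  qed
qed

text \<open>
  Along an unbounded vertical tube the kernel decays at least like the inverse square of the height, so
  the tube contributes a bounded amount and not one of order \<open>1/s\<close>.
\<close>

lemma emeasure_riesz_measure_tube:
  assumes "0 < \<rho>" "\<rho> \<le> 1"
  obtains C where "0 \<le> C" "\<And>s (X :: 'a::euclidean_space \<times> real). 0 < s \<Longrightarrow> s \<le> 1 \<Longrightarrow>
    emeasure (riesz_measure s X) {Y. norm (fst Y) < R \<and> \<rho> \<le> norm (Y - X)} \<le> ennreal C"
proof -
  let ?N = "DIM('a \<times> real)"
  define c where "c = 2 * \<rho> powr - (real ?N + 2)"
  have c: "0 \<le> c" by (simp add: c_def)
  have N: "2 \<le> real ?N" using DIM_positive[where 'a='a] by simp
  have int: "integrable lborel (\<lambda>x::real. inverse (1 + x\<^sup>2))"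
    using integrable_inverse_1_plus_square by (simp add: set_integrable_def)
  define I where "I = (LINT x|lborel. inverse (1 + (x::real)\<^sup>2))"
  have I: "(\<integral>\<^sup>+x. ennreal (inverse (1 + (x::real)\<^sup>2)) \<partial>lborel) = ennreal I" "0 \<le> I"
    unfolding I_def by (subst nn_integral_eq_integral[OF int]) auto
  define V where "V = measure lborel (ball (0::'a) R)"
  have V: "emeasure lborel (ball (0::'a) R) = ennreal V"
    unfolding V_def using emeasure_lborel_ball_finite[of "0::'a" R] by (intro emeasure_eq_ennreal_measure) (auto simp: less_top)
  show thesis
  proof (rule that[of "c * (V * I)"])
    show "0 \<le> c * (V * I)" using c I(2) by (simp add: V_def)
    fix s :: real and X :: "'a \<times> real"
    assume s: "0 < s" "s \<le> 1"
    define t where "t = snd X"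
    have m1: "(\<lambda>Y::'a \<times> real. indicator (ball 0 R) (fst Y) :: ennreal) \<in> borel_measurable borel"
      by (rule measurable_compose[OF borel_measurable_fst_snd(1)], rule borel_measurable_indicator, rule borel_open, rule open_ball)
    have m2: "(\<lambda>Y::'a \<times> real. ennreal (inverse (1 + (snd Y - t)\<^sup>2))) \<in> borel_measurable borel"
      by (rule measurable_compose[OF borel_measurable_fst_snd(2), of "\<lambda>\<tau>. ennreal (inverse (1 + (\<tau> - t)\<^sup>2))"]) measurable
    note mm = borel_measurable_times_ennreal[OF m1 m2]
    let ?S = "{Y. norm (fst Y) < R \<and> \<rho> \<le> norm (Y - X)}"
    have "emeasure (riesz_measure s X) ?S
       \<le> (\<integral>\<^sup>+Y. ennreal c * (indicator (ball 0 R) (fst Y) * ennreal (inverse (1 + (snd Y - t)\<^sup>2))) \<partial>(lborel :: ('a \<times> real) measure))"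
    proof (subst emeasure_riesz_measure)
      show "(\<integral>\<^sup>+Y. ennreal (riesz s (Y - X)) * indicator ?S Y \<partial>lborel) \<le> (\<integral>\<^sup>+Y. ennreal c * (indicator (ball 0 R) (fst Y) * ennreal (inverse (1 + (snd Y - t)\<^sup>2))) \<partial>(lborel :: ('a \<times> real) measure))"
      proof (rule nn_integral_mono)
        fix Y :: "'a \<times> real"
        show "ennreal (riesz s (Y - X)) * indicator ?S Y \<le> ennreal c * (indicator (ball 0 R) (fst Y) * ennreal (inverse (1 + (snd Y - t)\<^sup>2)))"
        proof (cases "Y \<in> ?S")
          case True
          define d where "d = norm (Y - X)"
          have d: "\<rho> \<le> d" "0 < d" using True assms by (auto simp: d_def)
          have "\<bar>snd Y - t\<bar> \<le> d" unfolding d_def using norm_snd_le[of "snd (Y - X)" "fst (Y - X)"]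
            by (metis prod.collapse real_norm_def snd_diff t_def)
          then have "(snd Y - t)\<^sup>2 \<le> d\<^sup>2" using d by (simp add: abs_le_square_iff[symmetric])
          moreover have "\<rho>\<^sup>2 \<le> d\<^sup>2" using d assms by (intro power_mono) auto
          moreover have "\<rho>\<^sup>2 * (snd Y - t)\<^sup>2 \<le> 1 * (snd Y - t)\<^sup>2"
            using assms by (intro mult_right_mono) (auto simp: power_le_one)
          ultimately have dd: "\<rho>\<^sup>2 * (1 + (snd Y - t)\<^sup>2) \<le> 2 * d\<^sup>2" by (simp add: algebra_simps)
          have pos: "0 < 1 + (snd Y - t)\<^sup>2" by (simp add: add_pos_nonneg)
          have "riesz s (Y - X) = d powr - 2 * d powr - (real ?N - 2 + s)"
            unfolding riesz_def d_def[symmetric] by (subst powr_add[symmetric]) (simp add: algebra_simps)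
          also have "\<dots> \<le> (2 * \<rho> powr - 2 * inverse (1 + (snd Y - t)\<^sup>2)) * \<rho> powr - real ?N"
          proof (rule mult_mono)
            have "d powr - 2 = 1 / d\<^sup>2" using d by (simp add: powr_minus divide_inverse powr_realpow[of d 2, simplified])
            also have "\<dots> \<le> 2 / (\<rho>\<^sup>2 * (1 + (snd Y - t)\<^sup>2))"
              using dd d assms pos by (simp add: divide_simps mult.commute)
            also have "\<dots> = 2 * \<rho> powr - 2 * inverse (1 + (snd Y - t)\<^sup>2)"
              using assms by (simp add: powr_minus divide_inverse powr_realpow[of \<rho> 2, simplified])
            finally show "d powr - 2 \<le> 2 * \<rho> powr - 2 * inverse (1 + (snd Y - t)\<^sup>2)" .
            have "- (real ?N - 2 + s) \<le> 0" using N s by linarith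
            then have "d powr - (real ?N - 2 + s) \<le> \<rho> powr - (real ?N - 2 + s)"
              by (rule powr_mono2') (use d assms in auto)
            also have "\<dots> \<le> \<rho> powr - real ?N"
              by (rule powr_mono') (use assms s in auto)
            finally show "d powr - (real ?N - 2 + s) \<le> \<rho> powr - real ?N" .
          qed auto
          also have "\<dots> = c * inverse (1 + (snd Y - t)\<^sup>2)"
            unfolding c_def by (simp add: powr_add[symmetric] mult_ac)
          finally show ?thesis using True c by (simp add: ennreal_mult'[symmetric] ennreal_leI)
        qed simp
      qed
    qed (unfold Collect_conj_eq, intro sets.Int borel_open[OF open_Collect_less] borel_closed[OF closed_Collect_le] continuous_intros)
    also have "\<dots> = ennreal c * (\<integral>\<^sup>+Y. indicator (ball 0 R) (fst Y) * ennreal (inverse (1 + (snd Y - t)\<^sup>2)) \<partial>(lborel :: ('a \<times> real) measure))"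
      by (rule nn_integral_cmult) (use mm in simp)
    also have "(\<integral>\<^sup>+Y. indicator (ball 0 R) (fst Y) * ennreal (inverse (1 + (snd Y - t)\<^sup>2)) \<partial>(lborel :: ('a \<times> real) measure))
      = (\<integral>\<^sup>+y. (\<integral>\<^sup>+\<tau>. indicator (ball 0 R) (y::'a) * ennreal (inverse (1 + (\<tau> - t)\<^sup>2)) \<partial>lborel) \<partial>lborel)"
      unfolding lborel_prod[symmetric] using mm by (subst lborel.nn_integral_fst[symmetric]) (auto simp: lborel_prod)
    also have "\<dots> = (\<integral>\<^sup>+y. indicator (ball (0::'a) R) y * ennreal I \<partial>lborel)"
    proof (rule nn_integral_cong)
      fix y :: 'a
      have "(\<integral>\<^sup>+\<tau>. indicator (ball 0 R) y * ennreal (inverse (1 + (\<tau> - t)\<^sup>2)) \<partial>lborel)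
        = indicator (ball 0 R) y * (\<integral>\<^sup>+\<tau>. ennreal (inverse (1 + (\<tau> - t)\<^sup>2)) \<partial>lborel)"
        by (rule nn_integral_cmult) measurable
      also have "(\<integral>\<^sup>+\<tau>. ennreal (inverse (1 + (\<tau> - t)\<^sup>2)) \<partial>lborel) = ennreal I"
        using nn_integral_lborel_translate[of "\<lambda>x::real. ennreal (inverse (1 + x\<^sup>2))" t] I by simp
      finally show "(\<integral>\<^sup>+\<tau>. indicator (ball 0 R) y * ennreal (inverse (1 + (\<tau> - t)\<^sup>2)) \<partial>lborel)
        = indicator (ball 0 R) y * ennreal I" .
    qed
    also have "\<dots> = ennreal V * ennreal I"
    proof -
      have "(\<integral>\<^sup>+y. indicator (ball (0::'a) R) y * ennreal I \<partial>lborel) = (\<integral>\<^sup>+y. indicator (ball (0::'a) R) y \<partial>lborel) * ennreal I"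
        by (rule nn_integral_multc) (intro borel_measurable_indicator, simp)
      then show ?thesis by (simp add: V)
    qed
    also have "ennreal c * (ennreal V * ennreal I) = ennreal (c * (V * I))"
      using c I(2) by (simp add: ennreal_mult'[symmetric] V_def)
    finally show "emeasure (riesz_measure s X) ?S \<le> ennreal (c * (V * I))" .
  qed
qed

text \<open>
  Far from the origin the kernels centred at \<open>X\<close> and at \<open>0\<close> differ by a factor close to \<open>1\<close>, uniformly for \<open>X\<close>
  in a ball; the strict inequality for \<open>alpha_bar\<close> leaves room for that factor.
\<close>

lemma emeasure_riesz_measure_far:
  fixes E :: "('a::euclidean_space \<times> real) set"
  assumes E[measurable]: "E \<in> sets borel" and alpha: "alpha_bar E < ennreal (omega (DIM('a) + 1) / 2)"
    and R1: "0 \<le> R1"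
  obtains \<gamma> R where "0 \<le> \<gamma>" "\<gamma> < omega (DIM('a) + 1) / 2" "R1 + 1 < R"
    "\<forall>\<^sub>F s in at_right 0. \<forall>X. norm X \<le> R1 \<longrightarrow> 
       ennreal s * emeasure (riesz_measure s X) (E \<inter> {Y. R \<le> norm (fst Y)}) \<le> ennreal \<gamma>"
proof -
  let ?N = "DIM('a \<times> real)"
  have N: "?N = DIM('a) + 1" by simp
  obtain b where b: "alpha_bar E < b" "b < ennreal (omega ?N / 2)"
    using dense[OF alpha] by (auto simp: N)
  define \<beta> where "\<beta> = enn2real b"
  have bt: "b < top" using b(2) by (rule less_trans) simp
  have bb: "b = ennreal \<beta>" using bt by (simp add: \<beta>_def)
  have "0 < b" using b(1) by (rule le_less_trans[rotated]) simp
  then have beta0: "0 < \<beta>" using bt by (simp add: \<beta>_def enn2real_positive_iff)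
  have beta1: "\<beta> < omega ?N / 2"
    using b(2) beta0 unfolding bb by (simp add: ennreal_less_iff)
  define \<gamma> where "\<gamma> = (\<beta> + omega ?N / 2) / 2"
  have g: "\<beta> < \<gamma>" "\<gamma> < omega ?N / 2" using beta1 by (auto simp: \<gamma>_def)
  \<comment> \<open>The admissible loss: \<open>norm (Y - X) \<ge> \<theta> * norm Y\<close> costs the factor \<open>\<gamma> / \<beta>\<close>.\<close>
  define \<theta> where "\<theta> = (\<beta> / \<gamma>) powr (1 / (real ?N + 1))"
  have th0: "0 < \<theta>" using beta0 g by (simp add: \<theta>_def)
  have "\<theta> < 1 powr (1 / (real ?N + 1))" unfolding \<theta>_def
    by (rule powr_less_mono2) (use beta0 g in auto)
  then have th1: "\<theta> < 1" by simp
  have th: "\<theta> powr - (real ?N + 1) = \<gamma> / \<beta>"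
  proof -
    have "(1 / (real ?N + 1)) * - (real ?N + 1) = - 1" by (simp add: field_simps)
    then have "\<theta> powr - (real ?N + 1) = (\<beta> / \<gamma>) powr - 1"
      unfolding \<theta>_def powr_powr by (simp only:)
    also have "\<dots> = \<gamma> / \<beta>" using beta0 g by (simp add: powr_minus)
    finally show ?thesis .
  qed
  define R where "R = max (R1 + 2) (R1 / (1 - \<theta>))"
  have R: "R1 + 1 < R" "1 \<le> R" "R1 \<le> (1 - \<theta>) * R"
  proof -
    show "R1 + 1 < R" "1 \<le> R" using R1 by (auto simp: R_def)
    have "R1 / (1 - \<theta>) \<le> R" by (simp add: R_def)
    then show "R1 \<le> (1 - \<theta>) * R" using th1 by (simp add: field_simps)
  qed
  let ?a = "\<lambda>s. ennreal s * (\<integral>\<^sup>+Y\<in>- ball 0 1. ennreal (indicator E Y / norm Y powr (real ?N + s)) \<partial>lebesgue)"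
  have ev: "\<forall>\<^sub>F s in at_right 0. ?a s < b"
    using Limsup_lessD[OF b(1)[unfolded alpha_bar_def]] .
  have ev2: "\<forall>\<^sub>F s::real in at_right 0. s \<le> 1" 
    using eventually_at_right_less[of "0::real"] eventually_at_right_field[of "\<lambda>s::real. s \<le> 1" 0]
    by (auto intro!: exI[of _ 1])
  show thesis
  proof (rule that[OF _ _ R(1)])
    show "0 \<le> \<gamma>" using beta0 g by simp
    show "\<gamma> < omega (DIM('a) + 1) / 2" using g N by simp
    show "\<forall>\<^sub>F s in at_right 0. \<forall>X. norm X \<le> R1 \<longrightarrow> 
       ennreal s * emeasure (riesz_measure s X) (E \<inter> {Y. R \<le> norm (fst Y)}) \<le> ennreal \<gamma>"
      using ev ev2 eventually_at_right_less[of 0]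
    proof eventually_elim
      case (elim s)
      show ?case
      proof (intro allI impI)
        fix X :: "'a \<times> real" assume X: "norm X \<le> R1"
        have "emeasure (riesz_measure s X) (E \<inter> {Y. R \<le> norm (fst Y)})
          \<le> (\<integral>\<^sup>+Y. ennreal (\<gamma> / \<beta>) * (ennreal (indicator E Y / norm Y powr (real ?N + s)) * indicator (- ball 0 1) Y) \<partial>lborel)"
        proof (subst emeasure_riesz_measure)
          show "(\<integral>\<^sup>+Y. ennreal (riesz s (Y - X)) * indicator (E \<inter> {Y. R \<le> norm (fst Y)}) Y \<partial>lborel)
             \<le> (\<integral>\<^sup>+Y. ennreal (\<gamma> / \<beta>) * (ennreal (indicator E Y / norm Y powr (real ?N + s)) * indicator (- ball 0 1) Y) \<partial>lborel)"
          proof (rule nn_integral_mono)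
            fix Y :: "'a \<times> real"
            show "ennreal (riesz s (Y - X)) * indicator (E \<inter> {Y. R \<le> norm (fst Y)}) Y
              \<le> ennreal (\<gamma> / \<beta>) * (ennreal (indicator E Y / norm Y powr (real ?N + s)) * indicator (- ball 0 1) Y)"
            proof (cases "Y \<in> E \<and> R \<le> norm (fst Y)")
              case True
              have Y: "R \<le> norm Y" using True norm_fst_le[of "fst Y" "snd Y"] by simp
              have Y0: "0 < norm Y" "1 \<le> norm Y" using Y R(2) by linarith+
              have "(1 - \<theta>) * R \<le> (1 - \<theta>) * norm Y" using Y th1 by (intro mult_left_mono) auto
              then have "\<theta> * norm Y \<le> norm Y - norm X" using X R(3) by (simp add: algebra_simps)
              also have "\<dots> \<le> norm (Y - X)" by (rule norm_triangle_ineq2)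
              finally have ge: "\<theta> * norm Y \<le> norm (Y - X)" .
              have "riesz s (Y - X) \<le> (\<theta> * norm Y) powr - (real ?N + s)"
                unfolding riesz_def by (rule powr_mono2') (use ge th0 Y0 elim in auto)
              also have "\<dots> = \<theta> powr - (real ?N + s) * norm Y powr - (real ?N + s)"
                by (rule powr_mult) 
              also have "\<dots> \<le> \<theta> powr - (real ?N + 1) * norm Y powr - (real ?N + s)"
                by (intro mult_right_mono powr_mono') (use th0 th1 elim in auto)
              also have "\<dots> = \<gamma> / \<beta> * (1 / norm Y powr (real ?N + s))"
                unfolding th powr_minus_divide[of "norm Y"] by (rule refl)
              finally have "ennreal (riesz s (Y - X)) \<le> ennreal (\<gamma> / \<beta> * (1 / norm Y powr (real ?N + s)))"
                by (rule ennreal_leI)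
              also have "\<dots> = ennreal (\<gamma> / \<beta>) * ennreal (1 / norm Y powr (real ?N + s))"
                by (rule ennreal_mult) (use g beta0 in auto)
              finally show ?thesis using True Y0 by simp
            qed auto
          qed
        qed (intro sets.Int E borel_closed[OF closed_Collect_le] continuous_intros)
        also have "\<dots> = ennreal (\<gamma> / \<beta>) * (\<integral>\<^sup>+Y. (ennreal (indicator E Y / norm Y powr (real ?N + s)) * indicator (- ball 0 1) Y) \<partial>lborel)"
          by (rule nn_integral_cmult) measurable
        finally have "ennreal s * emeasure (riesz_measure s X) (E \<inter> {Y. R \<le> norm (fst Y)})
          \<le> ennreal s * (ennreal (\<gamma> / \<beta>) * (\<integral>\<^sup>+Y. (ennreal (indicator E Y / norm Y powr (real ?N + s)) * indicator (- ball 0 1) Y) \<partial>lborel))"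
          by (intro mult_left_mono) auto
        also have "\<dots> = ennreal (\<gamma> / \<beta>) * ?a s"
          by (simp only: nn_integral_completion mult.left_commute)
        also have "\<dots> \<le> ennreal (\<gamma> / \<beta>) * ennreal \<beta>"
          using elim(1) unfolding bb by (intro mult_left_mono) auto
        also have "\<dots> = ennreal \<gamma>"
          using beta0 g by (simp add: ennreal_mult'[symmetric])
        finally show "ennreal s * emeasure (riesz_measure s X) (E \<inter> {Y. R \<le> norm (fst Y)}) \<le> ennreal \<gamma>" .
      qed
    qed
  qed
qed

text \<open>
  The curvature estimate. Here \<open>F\<close> avoids a ball of radius \<open>\<delta>\<close> with \<open>X\<close> on its boundary and is contained in
  \<open>E\<close> outside a large tube. The conclusion says that the complement of \<open>F\<close> outweighs \<open>F\<close> by at least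
  \<open>c/s\<close>, with the singularity at \<open>X\<close> removed by a vertical cylinder: that is the truncation which
  a cut-off \<open>\<epsilon> < \<bar>x - y\<bar>\<close> in \<open>\<real>\<^sup>n\<close> produces.
\<close>

lemma riesz_measure_exterior_ball:
  fixes E :: "('a::euclidean_space \<times> real) set"
  assumes E[measurable]: "E \<in> sets borel" and alpha: "alpha_bar E < ennreal (omega (DIM('a) + 1) / 2)"
    and R1: "0 \<le> R1" and delta: "0 < \<delta>" "2 * \<delta> \<le> 1"
  obtains c R where "0 < c" "R1 < R"
    "\<forall>\<^sub>F s in at_right 0. \<forall>X p F \<epsilon>. norm X \<le> R1 \<longrightarrow> norm (X - p) = \<delta> \<longrightarrow> 0 < \<epsilon> \<longrightarrow> \<epsilon> \<le> 1 \<longrightarrow>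
       F \<in> sets borel \<longrightarrow> F \<inter> ball p \<delta> = {} \<longrightarrow> F \<inter> {Y. R \<le> norm (fst Y)} \<subseteq> E \<longrightarrow>
       2 * emeasure (riesz_measure s X) (F \<inter> {Y. \<epsilon> < norm (fst Y - fst X)}) + ennreal (c / s)
         \<le> emeasure (riesz_measure s X) {Y. \<epsilon> < norm (fst Y - fst X)}"
proof -
  let ?N = "DIM('a) + 1"
  obtain \<gamma> R where g: "0 \<le> \<gamma>" "\<gamma> < omega ?N / 2" and R: "R1 + 1 < R"
    and far: "\<forall>\<^sub>F s in at_right 0. \<forall>X. norm X \<le> R1 \<longrightarrow> 
       ennreal s * emeasure (riesz_measure s X) (E \<inter> {Y. R \<le> norm (fst Y)}) \<le> ennreal \<gamma>"
    using emeasure_riesz_measure_far[OF E alpha R1] by blast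
  obtain C1 where C1: "0 \<le> C1" "\<And>s (X :: 'a \<times> real) c. 0 < s \<Longrightarrow> s \<le> 1/2 \<Longrightarrow> norm (X - c) = \<delta> \<Longrightarrow>
    emeasure (riesz_measure s X) {Y. norm (Y - X) < 2 * \<delta> \<and> \<delta> \<le> norm (Y - c) \<and> \<delta> \<le> norm (X + X - Y - c)} \<le> ennreal C1"
    using emeasure_riesz_measure_tangent_balls[OF delta] by blast
  obtain C2 where C2: "0 \<le> C2" "\<And>s (X :: 'a \<times> real). 0 < s \<Longrightarrow> s \<le> 1 \<Longrightarrow>
    emeasure (riesz_measure s X) {Y. norm (fst Y) < R \<and> 2 * \<delta> \<le> norm (Y - X)} \<le> ennreal C2"
    using emeasure_riesz_measure_tube[of "2 * \<delta>" R] delta by auto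
  define c where "c = omega ?N / 2 - \<gamma>"
  have c: "0 < c" using g by (simp add: c_def)
  have lim: "((\<lambda>s. omega ?N * (2 * \<delta>) powr - s - 2 * \<gamma> - s * (2 * C1 + 3 * C2)) \<longlongrightarrow>
      omega ?N * (2 * \<delta>) powr - 0 - 2 * \<gamma> - 0 * (2 * C1 + 3 * C2)) (at_right 0)"
    by (intro tendsto_intros) (use delta in auto)
  have ev: "\<forall>\<^sub>F s in at_right 0. c < omega ?N * (2 * \<delta>) powr - s - 2 * \<gamma> - s * (2 * C1 + 3 * C2)"
    by (rule order_tendstoD(1)[OF lim]) (use c delta in \<open>auto simp: c_def\<close>)
  have ev2: "\<forall>\<^sub>F s::real in at_right 0. s \<le> 1/2" 
    using eventually_at_right_field[of "\<lambda>s::real. s \<le> 1/2" 0] by (auto intro!: exI[of _ "1/2"])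
  show thesis
  proof (rule that[OF c])
    show "R1 < R" using R by simp
    show "\<forall>\<^sub>F s in at_right 0. \<forall>X p F \<epsilon>. norm X \<le> R1 \<longrightarrow> norm (X - p) = \<delta> \<longrightarrow> 0 < \<epsilon> \<longrightarrow> \<epsilon> \<le> 1 \<longrightarrow>
       F \<in> sets borel \<longrightarrow> F \<inter> ball p \<delta> = {} \<longrightarrow> F \<inter> {Y. R \<le> norm (fst Y)} \<subseteq> E \<longrightarrow>
       2 * emeasure (riesz_measure s X) (F \<inter> {Y. \<epsilon> < norm (fst Y - fst X)}) + ennreal (c / s)
         \<le> emeasure (riesz_measure s X) {Y. \<epsilon> < norm (fst Y - fst X)}"
      using far ev ev2 eventually_at_right_less[of 0]
    proof eventually_elim
      case (elim s)
      show ?case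
      proof (intro allI impI)
        fix X p :: "'a \<times> real" and F :: "('a \<times> real) set" and \<epsilon> :: real
        assume X: "norm X \<le> R1" and Xp: "norm (X - p) = \<delta>" and eps: "0 < \<epsilon>" "\<epsilon> \<le> 1"
          and F[measurable]: "F \<in> sets borel" and FD: "F \<inter> ball p \<delta> = {}"
          and FE: "F \<inter> {Y. R \<le> norm (fst Y)} \<subseteq> E"
        have s: "0 < s" "s \<le> 1/2" "s \<le> 1" using elim by auto
        let ?M = "riesz_measure s X"
        define Z where "Z = {Y::'a \<times> real. \<epsilon> < norm (fst Y - fst X)}"
        define D where "D = ball p \<delta>"
        \<comment> \<open>The reflection of the ball about \<open>X\<close>; it has the same mass as the ball.\<close>
        define D' where "D' = (\<lambda>Y. X + X - Y) -` D"
        define T where "T = {Y::'a \<times> real. norm (fst Y) < R \<and> 2 * \<delta> \<le> norm (Y - X)}"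
        define Nst where "Nst = {Y. norm (Y - X) < 2 * \<delta> \<and> \<delta> \<le> norm (Y - p) \<and> \<delta> \<le> norm (X + X - Y - p)}"
        define B where "B = {Y. 2 * \<delta> \<le> norm (Y - X)}"
        define Ef where "Ef = E \<inter> {Y. R \<le> norm (fst Y)}"
        have [measurable]: "Z \<in> sets borel"
          unfolding Z_def by (intro borel_open open_Collect_less continuous_intros)
        have [measurable]: "D \<in> sets borel" unfolding D_def by simp
        have [measurable]: "T \<in> sets borel"
          unfolding T_def Collect_conj_eq
          by (intro sets.Int borel_open[OF open_Collect_less] borel_closed[OF closed_Collect_le] continuous_intros)
        have [measurable]: "Nst \<in> sets borel" unfolding Nst_def by measurable
        have [measurable]: "B \<in> sets borel" unfolding B_def by measurable
        have [measurable]: "Ef \<in> sets borel"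
          unfolding Ef_def by (intro sets.Int E borel_closed[OF closed_Collect_le] continuous_intros)
        have [measurable]: "D' \<in> sets borel"
          unfolding D'_def using measurable_sets_borel[of "\<lambda>Y. X + X - Y" borel D] by simp
        have refl: "emeasure ?M (D' \<inter> Z) = emeasure ?M (D \<inter> Z)"
        proof -
          have "D' \<inter> Z = (\<lambda>Y. X + X - Y) -` (D \<inter> Z)"
            by (auto simp: D'_def Z_def norm_minus_commute)
          then show ?thesis using emeasure_riesz_measure_reflect[of "D \<inter> Z" s X] by simp
        qed
        have "F \<inter> Z \<subseteq> (D' \<inter> Z) \<union> (Nst \<union> (T \<union> Ef))"
        proof
          fix Y assume Y: "Y \<in> F \<inter> Z"
          show "Y \<in> (D' \<inter> Z) \<union> (Nst \<union> (T \<union> Ef))"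
          proof (cases "R \<le> norm (fst Y)")
            case True then show ?thesis using Y FE by (auto simp: Ef_def)
          next
            case False
            have "Y \<notin> D" using Y FD by (auto simp: D_def)
            then have "\<delta> \<le> norm (Y - p)" by (simp add: D_def dist_norm norm_minus_commute)
            then show ?thesis using False Y
              by (auto simp: D'_def D_def T_def Nst_def dist_norm norm_minus_commute not_less not_le)
          qed
        qed
        then have "emeasure ?M (F \<inter> Z) \<le> emeasure ?M ((D' \<inter> Z) \<union> (Nst \<union> (T \<union> Ef)))"
          by (intro emeasure_mono) auto
        also have "\<dots> \<le> emeasure ?M (D' \<inter> Z) + (emeasure ?M Nst + (emeasure ?M T + emeasure ?M Ef))"
          by (intro order_trans[OF emeasure_subadditive] add_left_mono) auto
        also have "\<dots> \<le> emeasure ?M (D' \<inter> Z) + (ennreal C1 + (ennreal C2 + ennreal (\<gamma> / s)))"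
        proof (intro add_mono order_refl)
          show "emeasure ?M Nst \<le> ennreal C1" unfolding Nst_def by (rule C1(2)) (use s Xp in auto)
          show "emeasure ?M T \<le> ennreal C2" unfolding T_def by (rule C2(2)) (use s in auto)
          have "ennreal (1 / s) * (ennreal s * emeasure ?M Ef) \<le> ennreal (1 / s) * ennreal \<gamma>"
            using elim(1)[rule_format, OF X] unfolding Ef_def by (intro mult_left_mono) auto
          moreover have "ennreal (1 / s) * (ennreal s * emeasure ?M Ef) = emeasure ?M Ef"
          proof -
            have "ennreal (1 / s) * ennreal s = 1" using s by (subst ennreal_mult'[symmetric]) auto
            then show ?thesis by (simp only: mult.assoc[symmetric] mult_1)
          qed
          moreover have "ennreal (1 / s) * ennreal \<gamma> = ennreal (\<gamma> / s)"
            using s g by (subst ennreal_mult'[symmetric]) auto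
          ultimately show "emeasure ?M Ef \<le> ennreal (\<gamma> / s)" by simp
        qed
        also have "ennreal C1 + (ennreal C2 + ennreal (\<gamma> / s)) = ennreal (C1 + C2 + \<gamma> / s)"
          using C1 C2 g s by (simp add: ennreal_plus[symmetric] del: ennreal_plus)
        finally have FZ: "emeasure ?M (F \<inter> Z) \<le> emeasure ?M (D' \<inter> Z) + ennreal (C1 + C2 + \<gamma> / s)" .
        have Bm: "emeasure ?M B = ennreal (omega ?N * (2 * \<delta>) powr - s / s)"
          unfolding B_def using emeasure_riesz_measure_tail[of "2 * \<delta>" s X] delta s by simp
        have "B \<subseteq> (B \<inter> Z) \<union> T"
        proof
          fix Y assume Y: "Y \<in> B"
          show "Y \<in> (B \<inter> Z) \<union> T"
          proof (cases "Y \<in> Z")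
            case False
            have "norm (fst Y) \<le> norm (fst Y - fst X) + norm (fst X)"
              using norm_triangle_ineq[of "fst Y - fst X" "fst X"] by simp
            also have "\<dots> \<le> \<epsilon> + R1"
              using False X norm_fst_le[of "fst X" "snd X"] by (intro add_mono) (auto simp: Z_def)
            finally have "norm (fst Y) < R" using R eps by simp
            then show ?thesis using Y by (simp add: T_def B_def)
          qed (use Y in auto)
        qed
        then have "emeasure ?M B \<le> emeasure ?M ((B \<inter> Z) \<union> T)" by (intro emeasure_mono) auto
        also have "\<dots> \<le> emeasure ?M (B \<inter> Z) + emeasure ?M T"
          by (intro emeasure_subadditive) auto
        also have "\<dots> \<le> emeasure ?M (B \<inter> Z) + ennreal C2"
          unfolding T_def by (intro add_left_mono C2(2)) (use s in auto)
        finally have BZ: "emeasure ?M B \<le> emeasure ?M (B \<inter> Z) + ennreal C2" .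
        have disj: "D \<inter> D' = {}"
        proof (rule ccontr)
          assume "D \<inter> D' \<noteq> {}"
          then obtain Y where Y: "Y \<in> D" "X + X - Y \<in> D" unfolding D'_def by blast
          have "norm (2 *\<^sub>R (X - p)) = norm ((Y - p) + (X + X - Y - p))" by (simp add: scaleR_2 algebra_simps)
          also have "\<dots> \<le> norm (Y - p) + norm (X + X - Y - p)" by (rule norm_triangle_ineq)
          also have "\<dots> < \<delta> + \<delta>"
            using Y unfolding D_def by (intro add_strict_mono) (auto simp: dist_norm norm_minus_commute)
          finally show False using Xp by simp
        qed
        have DB: "D \<inter> B = {}"
        proof (rule ccontr)
          assume "D \<inter> B \<noteq> {}"
          then obtain Y where Y: "Y \<in> D" "Y \<in> B" by auto
          have "norm (Y - X) \<le> norm (Y - p) + norm (p - X)"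
            using norm_triangle_ineq[of "Y - p" "p - X"] by simp
          also have "\<dots> < \<delta> + \<delta>"
            using Y(1) Xp unfolding D_def by (auto simp: dist_norm norm_minus_commute)
          finally show False using Y(2) by (simp add: B_def)
        qed
        have D'B: "D' \<inter> B = {}"
        proof (rule ccontr)
          assume "D' \<inter> B \<noteq> {}"
          then obtain Y where Y: "X + X - Y \<in> D" "Y \<in> B" unfolding D'_def by blast
          then have "X + X - Y \<in> B" by (simp add: B_def norm_minus_commute)
          then show False using Y(1) DB by auto
        qed
        have "emeasure ?M (D \<inter> Z) + (emeasure ?M (D' \<inter> Z) + emeasure ?M (B \<inter> Z))
            = emeasure ?M ((D \<inter> Z) \<union> ((D' \<inter> Z) \<union> (B \<inter> Z)))"
          using disj DB D'B by (subst plus_emeasure, auto)+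
        also have "\<dots> \<le> emeasure ?M Z" by (rule emeasure_mono) auto
        finally have "emeasure ?M (D' \<inter> Z) + (emeasure ?M (D' \<inter> Z) + emeasure ?M (B \<inter> Z)) \<le> emeasure ?M Z"
          unfolding refl .
        \<comment> \<open>The total of all errors; only its last part is of order \<open>1/s\<close>.\<close>
        define d where "d = 2 * C1 + 3 * C2 + 2 * \<gamma> / s"
        have d0: "0 \<le> d" using C1 C2 g s by (simp add: d_def)
        have key: "d + c / s \<le> omega ?N * (2 * \<delta>) powr - s / s"
        proof -
          have "(s * (2 * C1 + 3 * C2) + 2 * \<gamma> + c) / s \<le> omega ?N * (2 * \<delta>) powr - s / s"
            by (rule divide_right_mono) (use elim(2) s in auto)
          moreover have "(s * (2 * C1 + 3 * C2) + 2 * \<gamma> + c) / s = d + c / s"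
            using s by (simp add: d_def add_divide_distrib)
          ultimately show ?thesis by simp
        qed
        let ?f = "emeasure ?M (F \<inter> Z)" and ?d' = "emeasure ?M (D' \<inter> Z)" and ?b = "emeasure ?M (B \<inter> Z)"
        have "ennreal d + (2 * ?f + ennreal (c / s)) = 2 * ?f + ennreal (d + c / s)"
          using d0 c s by (simp add: ennreal_plus add_ac)
        also have "\<dots> \<le> (?f + ?f) + emeasure ?M B"
          unfolding Bm mult_2[of ?f] by (intro add_left_mono ennreal_leI key)
        also have "\<dots> \<le> ((?d' + ennreal (C1 + C2 + \<gamma> / s)) + (?d' + ennreal (C1 + C2 + \<gamma> / s))) + (?b + ennreal C2)"
          by (intro add_mono FZ BZ)
        also have "\<dots> = (?d' + (?d' + ?b)) + (ennreal (C1 + C2 + \<gamma> / s) + ennreal (C1 + C2 + \<gamma> / s) + ennreal C2)"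
          by (simp only: ac_simps)
        also have "ennreal (C1 + C2 + \<gamma> / s) + ennreal (C1 + C2 + \<gamma> / s) + ennreal C2 = ennreal d"
          using C1 C2 g s unfolding d_def by (simp add: ennreal_plus[symmetric] del: ennreal_plus)
        also have "(?d' + (?d' + ?b)) + ennreal d \<le> ennreal d + emeasure ?M Z"
          using \<open>?d' + (?d' + ?b) \<le> emeasure ?M Z\<close> by (simp add: add.commute add_left_mono)
        finally have "2 * ?f + ennreal (c / s) \<le> emeasure ?M Z"
          by (simp add: ennreal_add_left_cancel_le)
        then show "2 * emeasure ?M (F \<inter> {Y. \<epsilon> < norm (fst Y - fst X)}) + ennreal (c / s)
           \<le> emeasure ?M {Y. \<epsilon> < norm (fst Y - fst X)}" unfolding Z_def .
      qed
    qed
  qed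
qed

section \<open>Fractional Sobolev seminorms\<close>

definition gagliardo :: "real \<Rightarrow> ('a::euclidean_space \<Rightarrow> real) \<Rightarrow> ennreal"
  where "gagliardo s f =
    (\<integral>\<^sup>+x. \<integral>\<^sup>+y. ennreal (\<bar>f x - f y\<bar> / norm (x - y) powr (real DIM('a) + s)) \<partial>lborel \<partial>lborel)"

text \<open>
  The points in question lie in an annulus of width \<open>norm z\<close>; Bernoulli's inequality bounds its volume.
\<close>

lemma emeasure_ball_minus_translate_le:
  fixes z a :: "'a::euclidean_space"
  assumes "0 < \<delta>"
  shows "emeasure lborel {x \<in> ball a \<delta>. x + z \<notin> ball a \<delta>}
    \<le> ennreal (unit_ball_vol DIM('a) * \<delta> ^ DIM('a) * (real DIM('a) / \<delta>) * norm z)" (is "emeasure _ ?S \<le> _")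
proof -
  let ?V = "unit_ball_vol DIM('a)" and ?n = "DIM('a)"
  have V: "0 \<le> ?V * \<delta> ^ ?n" using assms by simp
  have S: "?S \<in> sets borel"
    using measurable_sets_borel[of "\<lambda>x. x + z" borel "- ball a \<delta>"]
    by (simp add: Collect_conj_eq vimage_def)
  have n: "1 \<le> real ?n" using DIM_positive[where 'a='a] by linarith
  show ?thesis
  proof (cases "norm z \<le> \<delta>")
    case False
    have "emeasure lborel ?S \<le> emeasure lborel (ball a \<delta>)" by (rule emeasure_mono) auto
    also have "\<dots> = ennreal (?V * \<delta> ^ ?n)" using assms by (intro emeasure_ball) auto
    also have "\<dots> \<le> ennreal (?V * \<delta> ^ ?n * (real ?n / \<delta>) * norm z)"
    proof (rule ennreal_leI)
      have "1 \<le> norm z / \<delta>" using False assms by (simp add: field_simps)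
      then have "1 * 1 \<le> real ?n * (norm z / \<delta>)" by (intro mult_mono n) auto
      from mult_left_mono[OF this V] show "?V * \<delta> ^ ?n \<le> ?V * \<delta> ^ ?n * (real ?n / \<delta>) * norm z"
        by simp
    qed
    finally show ?thesis .
  next
    case True
    let ?r = "\<delta> - norm z"
    have sub: "?S \<subseteq> ball a \<delta> - ball a ?r"
    proof
      fix x assume x: "x \<in> ?S"
      have "\<delta> \<le> dist a (x + z)" using x by auto
      also have "\<dots> \<le> dist a x + norm z" using dist_triangle[of a "x + z" x] by (simp add: dist_norm)
      finally show "x \<in> ball a \<delta> - ball a ?r" using x by auto
    qed
    have fin: "emeasure lborel (ball a ?r) \<noteq> \<infinity>" using emeasure_lborel_ball_finite[of a ?r] by simp
    have "emeasure lborel ?S \<le> emeasure lborel (ball a \<delta> - ball a ?r)"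
      by (rule emeasure_mono[OF sub]) simp
    also have "\<dots> = emeasure lborel (ball a \<delta>) - emeasure lborel (ball a ?r)"
      by (rule emeasure_Diff) (use fin in \<open>auto intro!: subset_ball\<close>)
    also have "\<dots> = ennreal (?V * \<delta> ^ ?n) - ennreal (?V * ?r ^ ?n)"
      using True assms by (subst (1 2) emeasure_ball) auto
    also have "\<dots> = ennreal (?V * \<delta> ^ ?n - ?V * ?r ^ ?n)"
      using True by (intro ennreal_minus) auto
    also have "\<dots> \<le> ennreal (?V * \<delta> ^ ?n * (real ?n / \<delta>) * norm z)"
    proof (rule ennreal_leI)
      have "- 1 \<le> - (norm z / \<delta>)" using True assms by simp
      from Bernoulli_inequality[OF this, of ?n]
      have "1 - real ?n * (norm z / \<delta>) \<le> (1 - norm z / \<delta>) ^ ?n" by simp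
      from mult_left_mono[OF this V]
      have "?V * \<delta> ^ ?n * (1 - real ?n * (norm z / \<delta>)) \<le> ?V * (\<delta> * (1 - norm z / \<delta>)) ^ ?n"
        by (simp add: power_mult_distrib mult.assoc)
      moreover have "\<delta> * (1 - norm z / \<delta>) = ?r" using assms by (simp add: field_simps)
      ultimately show "?V * \<delta> ^ ?n - ?V * ?r ^ ?n \<le> ?V * \<delta> ^ ?n * (real ?n / \<delta>) * norm z"
        by (simp add: algebra_simps)
    qed
    finally show ?thesis .
  qed
qed

text \<open>
  Finiteness of the fractional perimeter of a ball. It is needed since the excess over a hemisphere may jump
  across the boundary of the ball.
\<close>

lemma fractional_perimeter_ball_finite:
  fixes a :: "'a::euclidean_space"
  assumes s: "0 < s" "s < 1" and delta: "0 < \<delta>"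
  shows "(\<integral>\<^sup>+x. \<integral>\<^sup>+y. ennreal (indicator (ball a \<delta>) x * indicator (- ball a \<delta>) y / norm (x - y) powr (real DIM('a) + s)) \<partial>lborel \<partial>lborel) < \<infinity>"
proof -
  let ?n = "DIM('a)" and ?V = "unit_ball_vol DIM('a)"
  define B where "B = ball a \<delta>"
  have [measurable]: "B \<in> sets borel" by (simp add: B_def)
  define k where "k z = norm z powr - (real ?n + s)" for z :: 'a
  have [measurable]: "k \<in> borel_measurable borel" unfolding k_def[abs_def] by measurable
  define c where "c = ?V * \<delta> ^ ?n * (real ?n / \<delta>)"
  have c: "0 \<le> c" using delta by (simp add: c_def)
  define d where "d = ?V * \<delta> ^ ?n"
  have d: "0 \<le> d" using delta by (simp add: d_def)
  have "(\<integral>\<^sup>+x. \<integral>\<^sup>+y. ennreal (indicator B x * indicator (- B) y / norm (x - y) powr (real ?n + s)) \<partial>lborel \<partial>lborel)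
    = (\<integral>\<^sup>+x. \<integral>\<^sup>+z. ennreal (k z) * (indicator B x * indicator (- B) (x + z)) \<partial>lborel \<partial>lborel)"
  proof (rule nn_integral_cong)
    fix x :: 'a
    have "(\<integral>\<^sup>+y. ennreal (indicator B x * indicator (- B) y / norm (x - y) powr (real ?n + s)) \<partial>lborel)
       = (\<integral>\<^sup>+y. (\<lambda>z. ennreal (k z) * (indicator B x * indicator (- B) (x + z))) (y - x) \<partial>lborel)"
    proof (rule nn_integral_cong)
      fix y :: 'a
      show "ennreal (indicator B x * indicator (- B) y / norm (x - y) powr (real ?n + s))
         = (\<lambda>z. ennreal (k z) * (indicator B x * indicator (- B) (x + z))) (y - x)"
        unfolding k_def powr_minus_divide by (simp add: indicator_def norm_minus_commute)
    qed
    also have "\<dots> = (\<integral>\<^sup>+z. ennreal (k z) * (indicator B x * indicator (- B) (x + z)) \<partial>lborel)"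
      by (rule nn_integral_lborel_translate) measurable
    finally show "(\<integral>\<^sup>+y. ennreal (indicator B x * indicator (- B) y / norm (x - y) powr (real ?n + s)) \<partial>lborel)
      = (\<integral>\<^sup>+z. ennreal (k z) * (indicator B x * indicator (- B) (x + z)) \<partial>lborel)" .
  qed
  also have "\<dots> = (\<integral>\<^sup>+z. \<integral>\<^sup>+x. ennreal (k z) * (indicator B x * indicator (- B) (x + z)) \<partial>lborel \<partial>lborel)"
    by (rule lborel_pair.Fubini') measurable
  also have "\<dots> \<le> (\<integral>\<^sup>+z. ennreal c * (ennreal (norm z powr ((1 - s) - real ?n)) * indicator {z. norm z \<le> 1} z) +
      ennreal d * (ennreal (k z) * indicator {z. 1 \<le> norm z} z) \<partial>lborel)"
  proof (rule nn_integral_mono)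
    fix z :: 'a
    have S: "{x \<in> B. x + z \<notin> B} \<in> sets borel"
      using measurable_sets_borel[of "\<lambda>x. x + z" borel "- B"]
      by (simp add: Collect_conj_eq vimage_def)
    have "(\<integral>\<^sup>+x. ennreal (k z) * (indicator B x * indicator (- B) (x + z)) \<partial>lborel)
      = (\<integral>\<^sup>+x. ennreal (k z) * indicator {x \<in> B. x + z \<notin> B} x \<partial>lborel)"
      by (intro nn_integral_cong) (auto simp: indicator_def)
    also have "\<dots> = ennreal (k z) * emeasure lborel {x \<in> B. x + z \<notin> B}"
      using S by (simp add: nn_integral_cmult_indicator)
    also have "\<dots> \<le> ennreal c * (ennreal (norm z powr ((1 - s) - real ?n)) * indicator {z. norm z \<le> 1} z) +
      ennreal d * (ennreal (k z) * indicator {z. 1 \<le> norm z} z)"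
    proof (cases "norm z \<le> 1")
      case True
      have "ennreal (k z) * emeasure lborel {x \<in> B. x + z \<notin> B} \<le> ennreal (k z) * ennreal (c * norm z)"
        unfolding B_def c_def by (intro mult_left_mono emeasure_ball_minus_translate_le delta) auto
      also have "\<dots> = ennreal (k z * (c * norm z))"
        using c by (simp add: ennreal_mult' k_def)
      also have "k z * (c * norm z) = c * norm z powr ((1 - s) - real ?n)"
      proof (cases "z = 0")
        case False
        have "k z * norm z = norm z powr - (real ?n + s) * norm z powr 1" using False by (simp add: k_def)
        also have "\<dots> = norm z powr ((1 - s) - real ?n)"
          by (subst powr_add[symmetric]) (simp add: algebra_simps)
        finally show ?thesis by simp
      qed (simp add: k_def)
      also have "ennreal (c * norm z powr ((1 - s) - real ?n)) = ennreal c * ennreal (norm z powr ((1 - s) - real ?n))"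
        using c by (rule ennreal_mult') 
      finally show ?thesis using True by (simp add: add_increasing2)
    next
      case False
      have "ennreal (k z) * emeasure lborel {x \<in> B. x + z \<notin> B} \<le> ennreal (k z) * emeasure lborel B"
        by (intro mult_left_mono emeasure_mono) auto
      also have "emeasure lborel B = ennreal d" unfolding B_def d_def using delta by (intro emeasure_ball) auto
      finally show ?thesis using False by (simp add: mult.commute)
    qed
    finally show "(\<integral>\<^sup>+x. ennreal (k z) * (indicator B x * indicator (- B) (x + z)) \<partial>lborel)
      \<le> ennreal c * (ennreal (norm z powr ((1 - s) - real ?n)) * indicator {z. norm z \<le> 1} z) +
      ennreal d * (ennreal (k z) * indicator {z. 1 \<le> norm z} z)" .
  qed
  also have "\<dots> = ennreal c * (\<integral>\<^sup>+z. ennreal (norm z powr ((1 - s) - real ?n)) * indicator {z::'a. norm z \<le> 1} z \<partial>lborel) +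
      ennreal d * (\<integral>\<^sup>+z. ennreal (k z) * indicator {z. 1 \<le> norm z} z \<partial>lborel)"
    by (simp add: nn_integral_add nn_integral_cmult)
  also have "\<dots> < \<infinity>"
    using nn_integral_riesz_ball_finite[of "1 - s" 1, where 'a='a] nn_integral_riesz_tail[of 1 s, where 'a='a] s
    by (simp add: k_def ennreal_mult_less_top)
  finally show ?thesis unfolding B_def .
qed

text \<open>
  The restriction \<open>s < 1/2\<close> comes from here: a hemisphere is only Hoelder continuous of exponent \<open>1/2\<close> up to
  the equator.
\<close>

lemma half_holder_seminorm_ball_finite:
  fixes a :: "'a::euclidean_space"
  assumes s: "0 < s" "s < 1/2" and delta: "0 < \<delta>"
  shows "(\<integral>\<^sup>+x. \<integral>\<^sup>+y. ennreal (indicator (ball a \<delta>) x * indicator (ball a \<delta>) y * norm (x - y) powr (1/2) / norm (x - y) powr (real DIM('a) + s)) \<partial>lborel \<partial>lborel) < \<infinity>"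
proof -
  let ?n = "DIM('a)"
  define B where "B = ball a \<delta>"
  have [measurable]: "B \<in> sets borel" by (simp add: B_def)
  define g where "g z = ennreal (norm z powr ((1/2 - s) - real ?n)) * indicator {z. norm z \<le> 2 * \<delta>} z" for z :: 'a
  have [measurable]: "g \<in> borel_measurable borel" unfolding g_def[abs_def] by measurable
  have "(\<integral>\<^sup>+x. \<integral>\<^sup>+y. ennreal (indicator B x * indicator B y * norm (x - y) powr (1/2) / norm (x - y) powr (real ?n + s)) \<partial>lborel \<partial>lborel)
    \<le> (\<integral>\<^sup>+x. indicator B x * (\<integral>\<^sup>+z. g z \<partial>lborel) \<partial>lborel)"
  proof (rule nn_integral_mono)
    fix x :: 'a
    have "(\<integral>\<^sup>+y. ennreal (indicator B x * indicator B y * norm (x - y) powr (1/2) / norm (x - y) powr (real ?n + s)) \<partial>lborel)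
      \<le> (\<integral>\<^sup>+y. indicator B x * g (y - x) \<partial>lborel)"
    proof (rule nn_integral_mono)
      fix y :: 'a
      show "ennreal (indicator B x * indicator B y * norm (x - y) powr (1/2) / norm (x - y) powr (real ?n + s))
        \<le> indicator B x * g (y - x)"
      proof (cases "x \<in> B \<and> y \<in> B")
        case True
        have "norm (y - x) \<le> dist a x + dist a y"
          using dist_triangle[of y x a] by (simp add: dist_norm norm_minus_commute)
        also have "\<dots> \<le> 2 * \<delta>" using True by (auto simp: B_def)
        finally have "norm (y - x) \<le> 2 * \<delta>" .
        moreover have "norm (x - y) powr (1/2) / norm (x - y) powr (real ?n + s) = norm (y - x) powr ((1/2 - s) - real ?n)"
          unfolding norm_minus_commute[of x y] by (subst powr_diff[symmetric]) (simp add: algebra_simps)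
        ultimately show ?thesis using True by (simp add: g_def)
      qed (auto simp: indicator_def)
    qed
    also have "\<dots> = indicator B x * (\<integral>\<^sup>+y. g (y - x) \<partial>lborel)"
      by (rule nn_integral_cmult) measurable
    also have "(\<integral>\<^sup>+y. g (y - x) \<partial>lborel) = (\<integral>\<^sup>+z. g z \<partial>lborel)"
      by (rule nn_integral_lborel_translate) measurable
    finally show "(\<integral>\<^sup>+y. ennreal (indicator B x * indicator B y * norm (x - y) powr (1/2) / norm (x - y) powr (real ?n + s)) \<partial>lborel)
      \<le> indicator B x * (\<integral>\<^sup>+z. g z \<partial>lborel)" .
  qed
  also have "\<dots> = emeasure lborel B * (\<integral>\<^sup>+z. g z \<partial>lborel)"
    by (subst nn_integral_multc) auto
  also have "\<dots> < \<infinity>"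
    using nn_integral_riesz_ball_finite[of "1/2 - s" "2 * \<delta>", where 'a='a] s delta
      emeasure_lborel_ball_finite[of a \<delta>]
    unfolding g_def B_def by (simp add: ennreal_mult_less_top)
  finally show ?thesis unfolding B_def .
qed

section \<open>Lower hemispheres\<close>

text \<open>
  The lower hemisphere of the sphere of radius \<open>\<delta>\<close> around \<open>p\<close>, as a graph over the ball around \<open>fst p\<close>; values
  outside that ball have no meaning.
\<close>

definition hemi :: "real \<Rightarrow> 'a::euclidean_space \<times> real \<Rightarrow> 'a \<Rightarrow> real"
  where "hemi \<delta> p x = snd p - sqrt (\<delta>\<^sup>2 - (norm (x - fst p))\<^sup>2)"

lemma borel_measurable_hemi [measurable]: "hemi \<delta> p \<in> borel_measurable borel"
  unfolding hemi_def[abs_def] by (intro borel_measurable_continuous_onI continuous_intros)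

lemma hemi_on_sphere:
  assumes "x \<in> ball (fst p) \<delta>"
  shows "norm ((x, hemi \<delta> p x) - p) = \<delta>"
proof -
  have 0: "0 < \<delta>" using assms zero_le_dist[of "fst p" x] unfolding mem_ball by linarith
  have "(norm (x - fst p))\<^sup>2 \<le> \<delta>\<^sup>2" using assms by (intro power_mono) (auto simp: dist_norm norm_minus_commute)
  moreover have "(x, hemi \<delta> p x) - p = (x - fst p, - sqrt (\<delta>\<^sup>2 - (norm (x - fst p))\<^sup>2))"
    by (simp add: prod_eq_iff hemi_def)
  ultimately show ?thesis using 0 by (simp add: norm_Pair)
qed

lemma mem_ball_above_hemi:
  assumes "(y, \<tau>) \<in> ball p \<delta>"
  shows "y \<in> ball (fst p) \<delta>" "hemi \<delta> p y < \<tau>"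
proof -
  have d: "dist p (y, \<tau>) < \<delta>" using assms by simp
  then show "y \<in> ball (fst p) \<delta>" using dist_fst_le[of p "(y, \<tau>)"] by simp
  have "(dist p (y, \<tau>))\<^sup>2 < \<delta>\<^sup>2" using d by (intro power_strict_mono) auto
  moreover have "(dist p (y, \<tau>))\<^sup>2 = (norm (y - fst p))\<^sup>2 + (snd p - \<tau>)\<^sup>2"
    by (cases p) (simp add: dist_Pair_Pair dist_norm norm_minus_commute norm_Pair)
  ultimately have "(snd p - \<tau>)\<^sup>2 < \<delta>\<^sup>2 - (norm (y - fst p))\<^sup>2" by simp
  then have "sqrt ((snd p - \<tau>)\<^sup>2) < sqrt (\<delta>\<^sup>2 - (norm (y - fst p))\<^sup>2)" by (rule real_sqrt_less_mono)
  then show "hemi \<delta> p y < \<tau>" unfolding hemi_def by simp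
qed

lemma hemi_approx_in_ball:
  assumes "x \<in> ball (fst p) \<delta>" "hemi \<delta> p x < \<tau>" "\<tau> \<le> snd p"
  shows "(x, \<tau>) \<in> ball p \<delta>"
proof -
  have 0: "0 < \<delta>" using assms(1) zero_le_dist[of "fst p" x] unfolding mem_ball by linarith
  have le: "(norm (x - fst p))\<^sup>2 \<le> \<delta>\<^sup>2" using assms by (intro power_mono) (auto simp: dist_norm norm_minus_commute)
  have "snd p - \<tau> < sqrt (\<delta>\<^sup>2 - (norm (x - fst p))\<^sup>2)" using assms by (simp add: hemi_def)
  then have "(snd p - \<tau>)\<^sup>2 < (sqrt (\<delta>\<^sup>2 - (norm (x - fst p))\<^sup>2))\<^sup>2"
    using assms by (intro power_strict_mono) auto
  also have "\<dots> = \<delta>\<^sup>2 - (norm (x - fst p))\<^sup>2" using le by simp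
  finally have "(dist p (x, \<tau>))\<^sup>2 < \<delta>\<^sup>2"
    by (cases p) (simp add: dist_Pair_Pair dist_norm norm_minus_commute norm_Pair)
  then show ?thesis using 0 by (simp add: power2_less_imp_less)
qed

lemma hemi_holder:
  assumes x: "x \<in> ball (fst p) \<delta>" and y: "y \<in> ball (fst p) \<delta>"
  shows "\<bar>hemi \<delta> p x - hemi \<delta> p y\<bar> \<le> sqrt (2 * \<delta>) * norm (x - y) powr (1/2)"
proof -
  let ?a = "\<delta>\<^sup>2 - (norm (x - fst p))\<^sup>2" and ?b = "\<delta>\<^sup>2 - (norm (y - fst p))\<^sup>2"
  have x': "norm (x - fst p) < \<delta>" and y': "norm (y - fst p) < \<delta>"
    using x y by (auto simp: dist_norm norm_minus_commute)
  have a: "0 \<le> ?a" and b: "0 \<le> ?b"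
    using x' y' by (simp_all add: power_mono)
  have root: "\<bar>sqrt r - sqrt t\<bar> \<le> sqrt \<bar>r - t\<bar>" if "0 \<le> r" "0 \<le> t" for r t :: real
  proof -
    have *: "sqrt r - sqrt t \<le> sqrt (r - t)" if "0 \<le> t" "t \<le> r" for r t :: real
    proof -
      have "sqrt (t + (r - t)) \<le> sqrt t + sqrt (r - t)" by (rule sqrt_add_le_add_sqrt) (use that in auto)
      then show ?thesis by simp
    qed
    show ?thesis using *[of t r] *[of r t] that by (cases "t \<le> r") (auto simp: abs_if)
  qed
  have "\<bar>?a - ?b\<bar> = \<bar>norm (x - fst p) - norm (y - fst p)\<bar> * (norm (x - fst p) + norm (y - fst p))"
  proof -
    have "?a - ?b = - ((norm (x - fst p) - norm (y - fst p)) * (norm (x - fst p) + norm (y - fst p)))"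
      by (simp add: power2_eq_square algebra_simps)
    then show ?thesis by (simp only: abs_minus_cancel abs_mult) simp
  qed
  also have "\<dots> \<le> norm (x - y) * (2 * \<delta>)"
    using norm_triangle_ineq3[of "x - fst p" "y - fst p"] x' y' by (intro mult_mono) auto
  finally have ab: "\<bar>?a - ?b\<bar> \<le> (2 * \<delta>) * norm (x - y)" by (simp add: mult.commute)
  have "\<bar>hemi \<delta> p x - hemi \<delta> p y\<bar> = \<bar>sqrt ?a - sqrt ?b\<bar>" by (simp add: hemi_def)
  also have "\<dots> \<le> sqrt \<bar>?a - ?b\<bar>" by (rule root[OF a b])
  also have "\<dots> \<le> sqrt ((2 * \<delta>) * norm (x - y))" using ab by simp
  finally show ?thesis by (simp add: real_sqrt_mult powr_half_sqrt)
qed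

text \<open>
  Truncation at \<open>1\<close> keeps the test function bounded, so that it has finite seminorm in spite of the jump at
  the boundary of the ball.
\<close>

definition excess :: "('a \<Rightarrow> real) \<Rightarrow> real \<Rightarrow> 'a::euclidean_space \<times> real \<Rightarrow> 'a \<Rightarrow> real"
  where "excess u \<delta> p x = (if x \<in> ball (fst p) \<delta> then min (max (u x - hemi \<delta> p x) 0) 1 else 0)"

lemma excess_bounds: "0 \<le> excess u \<delta> p x" "excess u \<delta> p x \<le> indicator (ball (fst p) \<delta>) x"
  by (auto simp: excess_def)

lemma borel_measurable_excess [measurable]:
  assumes [measurable]: "u \<in> borel_measurable borel"
  shows "excess u \<delta> p \<in> borel_measurable borel"
proof -
  have [measurable]: "ball (fst p) \<delta> \<in> sets borel" by simp
  show ?thesis unfolding excess_def[abs_def] by measurable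
qed

text \<open>
  Inside the ball the excess is a contraction of \<open>u\<close> minus the hemisphere; across its boundary it is at
  most the indicator function of the ball.
\<close>

lemma gagliardo_excess_finite:
  fixes u :: "'a::euclidean_space \<Rightarrow> real"
  assumes s: "0 < s" "s < 1/2" and delta: "0 < \<delta>"
    and [measurable]: "u \<in> borel_measurable borel"
    and fin: "(\<integral>\<^sup>+x. \<integral>\<^sup>+y. ennreal (indicator (ball (fst p) \<delta>) x * indicator (ball (fst p) \<delta>) y * \<bar>u x - u y\<bar> / norm (x - y) powr (real DIM('a) + s)) \<partial>lborel \<partial>lborel) < \<infinity>"
  shows "gagliardo s (excess u \<delta> p) < \<infinity>"
proof -
  define B where "B = ball (fst p) \<delta>"
  have [measurable]: "B \<in> sets borel" by (simp add: B_def)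
  let ?k = "\<lambda>x y::'a. norm (x - y) powr (real DIM('a) + s)"
  let ?i = "indicator B :: 'a \<Rightarrow> real" and ?j = "indicator (- B) :: 'a \<Rightarrow> real"
  let ?S1 = "\<lambda>x y. ennreal (?i x * ?i y * \<bar>u x - u y\<bar> / ?k x y)"
  let ?S2 = "\<lambda>x y. ennreal (?i x * ?i y * norm (x - y) powr (1/2) / ?k x y)"
  let ?S3 = "\<lambda>x y. ennreal (?i x * ?j y / ?k x y)"
  let ?f = "excess u \<delta> p" and ?w = "hemi \<delta> p"
  have S3': "(\<integral>\<^sup>+x. \<integral>\<^sup>+y. ?S3 y x \<partial>lborel \<partial>lborel) = (\<integral>\<^sup>+x. \<integral>\<^sup>+y. ?S3 x y \<partial>lborel \<partial>lborel)"
    by (rule lborel_pair.Fubini') measurable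
  have "gagliardo s ?f \<le> (\<integral>\<^sup>+x. \<integral>\<^sup>+y. (?S1 x y + ennreal (sqrt (2 * \<delta>)) * ?S2 x y) + (?S3 x y + ?S3 y x) \<partial>lborel \<partial>lborel)"
    unfolding gagliardo_def
  proof (intro nn_integral_mono)
    fix x y :: 'a
    have k: "0 \<le> ?k x y" by simp
    have main: "\<bar>?f x - ?f y\<bar> \<le> (?i x * ?i y * \<bar>u x - u y\<bar> + sqrt (2 * \<delta>) * (?i x * ?i y * norm (x - y) powr (1/2)))
        + (?i x * ?j y + ?i y * ?j x)"
    proof (cases "x \<in> B \<and> y \<in> B")
      case True
      have "\<bar>?f x - ?f y\<bar> \<le> \<bar>(u x - ?w x) - (u y - ?w y)\<bar>"
        using True unfolding excess_def B_def by (auto simp: min_def max_def)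
      also have "\<dots> \<le> \<bar>u x - u y\<bar> + \<bar>?w x - ?w y\<bar>" by simp
      also have "\<bar>?w x - ?w y\<bar> \<le> sqrt (2 * \<delta>) * norm (x - y) powr (1/2)"
        using True unfolding B_def by (intro hemi_holder) auto
      finally show ?thesis using True by simp
    next
      case False
      then show ?thesis
        using excess_bounds[of u \<delta> p x] excess_bounds[of u \<delta> p y] unfolding B_def[symmetric]
        by (auto simp: indicator_def)
    qed
    have "ennreal (\<bar>?f x - ?f y\<bar> / ?k x y) \<le> ennreal (((?i x * ?i y * \<bar>u x - u y\<bar> + sqrt (2 * \<delta>) * (?i x * ?i y * norm (x - y) powr (1/2)))
        + (?i x * ?j y + ?i y * ?j x)) / ?k x y)"
      by (intro ennreal_leI divide_right_mono main k)
    also have "\<dots> = ennreal ((?i x * ?i y * \<bar>u x - u y\<bar> / ?k x y + sqrt (2 * \<delta>) * (?i x * ?i y * norm (x - y) powr (1/2) / ?k x y))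
        + (?i x * ?j y / ?k x y + ?i y * ?j x / ?k y x))"
      by (simp add: add_divide_distrib norm_minus_commute)
    also have "\<dots> = (?S1 x y + ennreal (sqrt (2 * \<delta>)) * ?S2 x y) + (?S3 x y + ?S3 y x)"
      using delta by (simp add: ennreal_plus ennreal_mult'[symmetric])
    finally show "ennreal (\<bar>?f x - ?f y\<bar> / ?k x y) \<le> (?S1 x y + ennreal (sqrt (2 * \<delta>)) * ?S2 x y) + (?S3 x y + ?S3 y x)" .
  qed
  also have "\<dots> = ((\<integral>\<^sup>+x. \<integral>\<^sup>+y. ?S1 x y \<partial>lborel \<partial>lborel) + ennreal (sqrt (2 * \<delta>)) * (\<integral>\<^sup>+x. \<integral>\<^sup>+y. ?S2 x y \<partial>lborel \<partial>lborel))
     + ((\<integral>\<^sup>+x. \<integral>\<^sup>+y. ?S3 x y \<partial>lborel \<partial>lborel) + (\<integral>\<^sup>+x. \<integral>\<^sup>+y. ?S3 y x \<partial>lborel \<partial>lborel))"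
    by (simp add: nn_integral_add nn_integral_cmult)
  also have "\<dots> < \<infinity>"
    unfolding S3' using fin half_holder_seminorm_ball_finite[OF s delta, of "fst p"]
      fractional_perimeter_ball_finite[of s \<delta> "fst p"] s delta
    unfolding B_def by (simp add: ennreal_mult_less_top)
  finally show ?thesis .
qed

section \<open>The Euler-Lagrange inequality against a ball\<close>

lemma AE_lborel_fst:
  assumes "AE x in lborel. P x"
  shows "AE z in (lborel :: ('a::euclidean_space \<times> 'b::euclidean_space) measure). P (fst z)"
proof -
  obtain N where N: "{x. \<not> P x} \<subseteq> N" "N \<in> null_sets (lborel :: 'a measure)"
    using assms unfolding eventually_ae_filter by auto
  have "N \<times> UNIV \<in> null_sets (lborel :: ('a \<times> 'b) measure)"
    using N(2) lborel.emeasure_pair_measure_Times[of N lborel UNIV]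
    unfolding lborel_prod[symmetric] null_sets_def by auto
  then show ?thesis by (rule AE_I') (use N(1) in auto)
qed

lemma AE_lborel_snd:
  assumes "AE x in lborel. P x"
  shows "AE z in (lborel :: ('b::euclidean_space \<times> 'a::euclidean_space) measure). P (snd z)"
proof -
  obtain N where N: "{x. \<not> P x} \<subseteq> N" "N \<in> null_sets (lborel :: 'a measure)"
    using assms unfolding eventually_ae_filter by auto
  have "UNIV \<times> N \<in> null_sets (lborel :: ('b \<times> 'a) measure)"
    using N(2) lborel.emeasure_pair_measure_Times[of UNIV lborel N]
    unfolding lborel_prod[symmetric] null_sets_def by auto
  then show ?thesis by (rule AE_I') (use N(1) in auto)
qed

text \<open>
  The value of \<open>G_prim\<close> at the difference quotient between a point \<open>x\<close> of the ball and \<open>y\<close>, for the function which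
  is the hemisphere in the ball, \<open>+\<infinity>\<close> in the rest of \<open>ball 0 R\<close> and \<open>\<phi>\<close> elsewhere. The infinite value
  accounts for the clause \<open>- G_lim\<close>.
\<close>

definition barrier_slope ::
  "real \<Rightarrow> real \<Rightarrow> 'a::euclidean_space \<times> real \<Rightarrow> real \<Rightarrow> ('a \<Rightarrow> real) \<Rightarrow> 'a \<Rightarrow> 'a \<Rightarrow> real"
  where "barrier_slope s \<delta> p R \<phi> x y =
    (if y \<in> ball (fst p) \<delta> then G_prim DIM('a) s ((hemi \<delta> p x - hemi \<delta> p y) / norm (x - y))
     else if norm y < R then - G_lim DIM('a) s
     else G_prim DIM('a) s ((hemi \<delta> p x - \<phi> y) / norm (x - y)))"

text \<open>
  The subgraph of the function described for \<open>barrier_slope\<close>.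
\<close>

definition barrier_set :: "real \<Rightarrow> 'a::euclidean_space \<times> real \<Rightarrow> real \<Rightarrow> ('a \<Rightarrow> real) \<Rightarrow> ('a \<times> real) set"
  where "barrier_set \<delta> p R \<phi> =
    {Y. if fst Y \<in> ball (fst p) \<delta> then snd Y < hemi \<delta> p (fst Y) else norm (fst Y) < R \<or> snd Y < \<phi> (fst Y)}"

lemma barrier_set_borel:
  assumes [measurable]: "\<phi> \<in> borel_measurable borel"
  shows "barrier_set \<delta> p R \<phi> \<in> sets borel"
proof -
  define q where "q = fst p"
  have [measurable]: "ball q \<delta> \<in> sets borel" by simp
  have "barrier_set \<delta> p R \<phi> = {Y \<in> space (borel \<Otimes>\<^sub>M borel).
     if fst Y \<in> ball q \<delta> then snd Y < hemi \<delta> p (fst Y) else norm (fst Y) < R \<or> snd Y < \<phi> (fst Y)}"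
    by (simp add: barrier_set_def q_def space_pair_measure)
  also have "\<dots> \<in> sets (borel \<Otimes>\<^sub>M borel)" by measurable
  finally show ?thesis unfolding borel_prod .
qed

lemma riesz_vertical:
  fixes x y :: "'a::euclidean_space"
  shows "riesz s ((y, \<tau>) - (x, t)) = sqrt ((norm (x - y))\<^sup>2 + (\<tau> - t)\<^sup>2) powr - (real DIM('a) + 1 + s)"
  by (simp add: riesz_def norm_Pair norm_minus_commute add_ac)

text \<open>
  By Fubini, the horizontal integral of the slopes is one half of the curvature of the barrier set at \<open>X\<close>.
\<close>

lemma barrier_slope_integral_ge:
  fixes \<phi> :: "'a::euclidean_space \<Rightarrow> real"
  assumes s: "0 < s" and eps: "0 < \<epsilon>" and c: "0 \<le> c" and x: "x \<in> ball (fst p) \<delta>"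
    and phi[measurable]: "\<phi> \<in> borel_measurable borel"
    and X: "X = (x, hemi \<delta> p x)"
    and est: "2 * emeasure (riesz_measure s X) (barrier_set \<delta> p R \<phi> \<inter> {Y. \<epsilon> < norm (fst Y - fst X)}) + ennreal c
         \<le> emeasure (riesz_measure s X) {Y. \<epsilon> < norm (fst Y - fst X)}"
  shows "c \<le> 2 * (LINT y|lborel. (if \<epsilon> < norm (x - y) then barrier_slope s \<delta> p R \<phi> x y / norm (x - y) powr (real DIM('a) + s) else 0))"
proof -
  let ?n = "DIM('a)"
  let ?M = "riesz_measure s X"
  define F where "F = barrier_set \<delta> p R \<phi>"
  define Z where "Z = {Y::'a \<times> real. \<epsilon> < norm (fst Y - fst X)}"
  have F[measurable]: "F \<in> sets borel" unfolding F_def by (rule barrier_set_borel[OF phi])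
  have Z[measurable]: "Z \<in> sets borel"
    unfolding Z_def by (intro borel_open open_Collect_less continuous_intros)
  have K[measurable]: "(\<lambda>Y. riesz s (Y - X)) \<in> borel_measurable borel" by measurable
  have fin: "emeasure ?M Z < \<infinity>"
  proof -
    have "Z \<subseteq> {Y. \<epsilon> \<le> norm (Y - X)}"
    proof
      fix Y assume "Y \<in> Z"
      then show "Y \<in> {Y. \<epsilon> \<le> norm (Y - X)}"
        using norm_fst_le[of "fst (Y - X)" "snd (Y - X)"] unfolding Z_def prod.collapse
        by (simp add: fst_diff)
    qed
    then have "emeasure ?M Z \<le> emeasure ?M {Y. \<epsilon> \<le> norm (Y - X)}" by (intro emeasure_mono) auto
    also have "\<dots> < \<infinity>" using emeasure_riesz_measure_tail[OF eps s, of X] by simp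
    finally show ?thesis .
  qed
  have int: "integrable lborel (\<lambda>Y. indicator S Y * riesz s (Y - X))"
    and val: "ennreal (LINT Y|lborel. indicator S Y * riesz s (Y - X)) = emeasure ?M S"
    if S: "S \<in> sets borel" "S \<subseteq> Z" for S
  proof -
    have e: "emeasure ?M S = (\<integral>\<^sup>+Y. ennreal (indicator S Y * riesz s (Y - X)) \<partial>lborel)"
      using S by (subst emeasure_riesz_measure) (auto intro!: nn_integral_cong simp: indicator_def)
    have "emeasure ?M S \<le> emeasure ?M Z" using S by (intro emeasure_mono) auto
    then have f: "emeasure ?M S < \<infinity>" using fin by order
    have m: "(\<lambda>Y. indicator S Y * riesz s (Y - X)) \<in> borel_measurable lborel" using S by measurable
    show "integrable lborel (\<lambda>Y. indicator S Y * riesz s (Y - X))"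
      using m f unfolding e by (intro integrableI_nonneg) (auto simp: riesz_nonneg)
    then show "ennreal (LINT Y|lborel. indicator S Y * riesz s (Y - X)) = emeasure ?M S"
      unfolding e by (subst nn_integral_eq_integral) (auto simp: riesz_nonneg)
  qed
  define g where "g Y = indicator Z Y * riesz s (Y - X) - 2 * (indicator (F \<inter> Z) Y * riesz s (Y - X))" for Y
  have gint: "integrable lborel g"
    unfolding g_def by (intro Bochner_Integration.integrable_diff integrable_mult_right int) auto
  have lower: "c \<le> (LINT Y|lborel. g Y)"
  proof -
    define a where "a = (LINT Y|lborel. indicator (F \<inter> Z) Y * riesz s (Y - X))"
    define b where "b = (LINT Y|lborel. indicator Z Y * riesz s (Y - X))"
    have ab: "0 \<le> a" "0 \<le> b" unfolding a_def b_def by (auto intro!: integral_nonneg_AE simp: riesz_nonneg)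
    have "2 * ennreal a + ennreal c \<le> ennreal b"
      using est val[of "F \<inter> Z"] val[of Z] unfolding F_def[symmetric] Z_def[symmetric] a_def b_def by simp
    moreover have "2 * ennreal a + ennreal c = ennreal (2 * a + c)"
      using ab c by (simp add: ennreal_plus ennreal_mult')
    ultimately have "ennreal (2 * a + c) \<le> ennreal b" by simp
    then have "2 * a + c \<le> b" using ab by (simp add: ennreal_le_iff)
    moreover have "(LINT Y|lborel. g Y) = b - 2 * a"
      unfolding g_def a_def b_def
      by (subst Bochner_Integration.integral_diff) (auto intro!: int integrable_mult_right)
    ultimately show ?thesis by simp
  qed
  have "(LINT Y|lborel. g Y) = (LINT y|lborel. LINT \<tau>|lborel. g (y, \<tau>))"
    using lborel_pair.integral_fst'[of g] gint by (simp add: lborel_prod)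
  also have "\<dots> = (LINT y|lborel. 2 * (if \<epsilon> < norm (x - y) then barrier_slope s \<delta> p R \<phi> x y / norm (x - y) powr (real ?n + s) else 0))"
  proof (rule Bochner_Integration.integral_cong[OF refl])
    fix y :: 'a
    let ?k = "\<lambda>\<tau>. sqrt ((norm (x - y))\<^sup>2 + (\<tau> - hemi \<delta> p x)\<^sup>2) powr - (real ?n + 1 + s)"
    have n: "1 \<le> ?n" by (simp add: Suc_leI)
    show "(LINT \<tau>|lborel. g (y, \<tau>)) = 2 * (if \<epsilon> < norm (x - y) then barrier_slope s \<delta> p R \<phi> x y / norm (x - y) powr (real ?n + s) else 0)"
    proof (cases "\<epsilon> < norm (x - y)")
      case False
      then have "g (y, \<tau>) = 0" for \<tau> by (simp add: g_def Z_def X norm_minus_commute)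
      then show ?thesis using False by simp
    next
      case True
      then have r: "0 < norm (x - y)" using less_trans[OF eps] by blast
      note v = vertical_integral_kernel[OF n less_imp_le[OF s] r, where t="hemi \<delta> p x"]
      have g: "g (y, \<tau>) = (if (y, \<tau>) \<in> F then - 1 else 1) * ?k \<tau>" for \<tau>
        using True unfolding g_def X riesz_vertical by (simp add: Z_def X norm_minus_commute indicator_def)
      consider (a) "y \<in> ball (fst p) \<delta>" | (b) "y \<notin> ball (fst p) \<delta>" "norm y < R" | (c) "y \<notin> ball (fst p) \<delta>" "\<not> norm y < R" by blast
      then show ?thesis
      proof cases
        case a
        then have "(y, \<tau>) \<in> F \<longleftrightarrow> \<tau> < hemi \<delta> p y" for \<tau> by (simp add: F_def barrier_set_def)
        then show ?thesis using a True v(3)[where b="hemi \<delta> p y"] by (simp add: g barrier_slope_def)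
      next
        case b
        then have "(y, \<tau>) \<in> F" for \<tau> by (simp add: F_def barrier_set_def)
        then show ?thesis using b True v(2) by (simp add: g barrier_slope_def)
      next
        case c
        then have "(y, \<tau>) \<in> F \<longleftrightarrow> \<tau> < \<phi> y" for \<tau> by (simp add: F_def barrier_set_def)
        then show ?thesis using c True v(3)[where b="\<phi> y"] by (simp add: g barrier_slope_def)
      qed
    qed
  qed
  finally show ?thesis using lower by simp
qed

text \<open>
  Antisymmetry in \<open>x\<close> and \<open>y\<close> lets the double integral against increments \<open>f x - f y\<close> split into two equal halves.
\<close>

definition pair_slope ::
  "real \<Rightarrow> real \<Rightarrow> 'a::euclidean_space \<times> real \<Rightarrow> real \<Rightarrow> ('a \<Rightarrow> real) \<Rightarrow> 'a \<Rightarrow> 'a \<Rightarrow> real"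
  where "pair_slope s \<delta> p R \<phi> x y =
    (if x \<in> ball (fst p) \<delta> then barrier_slope s \<delta> p R \<phi> x y
     else if y \<in> ball (fst p) \<delta> then - barrier_slope s \<delta> p R \<phi> y x else 0)"

lemma pair_slope_antisym:
  fixes x y :: "'a::euclidean_space"
  assumes "0 \<le> s"
  shows "pair_slope s \<delta> p R \<phi> y x = - pair_slope s \<delta> p R \<phi> x y"
proof -
  have n: "1 \<le> DIM('a)" by (simp add: Suc_leI)
  have neg: "(hemi \<delta> p y - hemi \<delta> p x) / norm (y - x) = - ((hemi \<delta> p x - hemi \<delta> p y) / norm (x - y))"
    by (metis minus_diff_eq minus_divide_left norm_minus_commute)
  show ?thesis
  proof (cases "x \<in> ball (fst p) \<delta> \<and> y \<in> ball (fst p) \<delta>")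
    case True
    then show ?thesis
      unfolding pair_slope_def barrier_slope_def neg G_prim_minus[OF n assms] by simp
  qed (auto simp: pair_slope_def)
qed

lemma abs_pair_slope_le:
  fixes x y :: "'a::euclidean_space"
  assumes "0 \<le> s"
  shows "\<bar>pair_slope s \<delta> p R \<phi> x y\<bar> \<le> G_lim DIM('a) s"
proof -
  have n: "1 \<le> DIM('a)" by (simp add: Suc_leI)
  show ?thesis unfolding pair_slope_def barrier_slope_def
    using abs_G_prim_le[OF n assms] G_lim_nonneg[of "DIM('a)" s] by auto
qed

text \<open>
  Where the excess increases from \<open>y\<close> to \<open>x\<close>, the truncated function \<open>u\<close> minus excess increases at least as
  much as the barrier, since both the excess and the remainder are nondecreasing functions of \<open>u\<close> minus
  the hemisphere. As \<open>G_prim\<close> is nondecreasing, the increments of the barrier may be used instead.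
\<close>

lemma excess_slope_ge:
  fixes x y :: "'a::euclidean_space" and \<delta> :: real and p :: "'a \<times> real" and u \<phi> :: "'a \<Rightarrow> real"
  assumes s: "0 \<le> s"
    and ux: "R \<le> norm x \<Longrightarrow> u x = \<phi> x" and uy: "R \<le> norm y \<Longrightarrow> u y = \<phi> y"
  defines "f \<equiv> excess u \<delta> p"
  shows "pair_slope s \<delta> p R \<phi> x y * (f x - f y)
    \<le> G_prim DIM('a) s (((u x - f x) - (u y - f y)) / norm (x - y)) * (f x - f y)"
proof -
  let ?n = "DIM('a)" and ?G = "G_prim DIM('a) s" and ?w = "hemi \<delta> p" and ?B = "ball (fst p) \<delta>"
  have n: "1 \<le> ?n" by (simp add: Suc_leI)
  have one: "pair_slope s \<delta> p R \<phi> x y * (f x - f y)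
    \<le> ?G (((u x - f x) - (u y - f y)) / norm (x - y)) * (f x - f y)"
    if le: "f y \<le> f x" and ux: "R \<le> norm x \<Longrightarrow> u x = \<phi> x" and uy: "R \<le> norm y \<Longrightarrow> u y = \<phi> y" for x y :: 'a
  proof (cases "f y = f x")
    case False
    with le have lt: "f y < f x" by simp
    have fx: "0 < f x" using lt excess_bounds(1)[of u \<delta> p y] by (simp add: f_def)
    then have x: "x \<in> ?B" unfolding f_def excess_def by (auto split: if_splits)
    have wx: "?w x \<le> u x - f x" using fx x unfolding f_def excess_def by (auto simp: min_def max_def split: if_splits)
    have "pair_slope s \<delta> p R \<phi> x y \<le> ?G (((u x - f x) - (u y - f y)) / norm (x - y))"
    proof (cases "y \<in> ?B")
      case True
      have "?w x - ?w y \<le> (u x - f x) - (u y - f y)"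
        using lt x True unfolding f_def excess_def by (auto simp: min_def max_def split: if_splits)
      then show ?thesis using x True unfolding pair_slope_def barrier_slope_def
        by (auto intro!: G_prim_mono[OF n s] divide_right_mono)
    next
      case False
      then have fy: "f y = 0" by (auto simp: f_def excess_def)
      show ?thesis
      proof (cases "norm y < R")
        case True
        then show ?thesis using x False G_prim_bounds(2)[OF n s] unfolding pair_slope_def barrier_slope_def by auto
      next
        case nR: False
        then have "?w x - \<phi> y \<le> (u x - f x) - (u y - f y)" using wx fy uy by simp
        then show ?thesis using x False nR unfolding pair_slope_def barrier_slope_def
          by (auto intro!: G_prim_mono[OF n s] divide_right_mono)
      qed
    qed
    then show ?thesis using lt by (intro mult_right_mono) auto
  qed simp
  show ?thesis
  proof (cases "f y \<le> f x")
    case True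
    then show ?thesis by (rule one) (use ux uy in auto)
  next
    case False
    have neg: "((u y - f y) - (u x - f x)) / norm (y - x) = - (((u x - f x) - (u y - f y)) / norm (x - y))"
      by (metis minus_diff_eq minus_divide_left norm_minus_commute)
    have "pair_slope s \<delta> p R \<phi> y x * (f y - f x)
      \<le> ?G (((u y - f y) - (u x - f x)) / norm (y - x)) * (f y - f x)"
      by (rule one) (use False ux uy in auto)
    then show ?thesis unfolding neg G_prim_minus[OF n s] pair_slope_antisym[OF s, of \<delta> p R \<phi> y x]
      by (simp add: algebra_simps)
  qed
qed

lemma borel_measurable_pair_slope:
  fixes \<phi> :: "'a::euclidean_space \<Rightarrow> real"
  assumes [measurable]: "\<phi> \<in> borel_measurable borel"
  shows "(\<lambda>z. pair_slope s \<delta> p R \<phi> (fst z) (snd z)) \<in> borel_measurable (borel \<Otimes>\<^sub>M borel)"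
proof -
  define q where "q = fst p"
  have [measurable]: "ball q \<delta> \<in> sets borel" by simp
  show ?thesis unfolding pair_slope_def barrier_slope_def q_def[symmetric] by measurable
qed

text \<open>
  The competitor stays above the obstacle because it is at least the smaller of \<open>u\<close> and the hemisphere, and the latter
  lies above the obstacle.
\<close>

lemma subtract_excess_admissible:
  fixes u \<phi> \<psi> :: "'a::euclidean_space \<Rightarrow> real" and \<delta> :: real and p :: "'a \<times> real"
  assumes s: "0 < s" "s < 1/2" and delta: "0 < \<delta>"
    and Om: "open \<Omega>" "bounded \<Omega>" and B: "ball (fst p) \<delta> \<subseteq> \<Omega>"
    and u[measurable]: "u \<in> borel_measurable borel"
    and adm: "u \<in> W_obst s \<Omega> A \<phi> \<psi>"
    and obst: "\<And>x. x \<in> A \<Longrightarrow> x \<in> ball (fst p) \<delta> \<Longrightarrow> \<psi> x \<le> hemi \<delta> p x"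
  defines "f \<equiv> excess u \<delta> p"
  shows "gagliardo s f < \<infinity>" and "(\<lambda>x. u x - f x) \<in> W_obst s \<Omega> A \<phi> \<psi>"
proof -
  let ?k = "\<lambda>x y::'a. norm (x - y) powr (real DIM('a) + s)"
  have [measurable]: "\<Omega> \<in> sets borel" using Om by simp
  have f[measurable]: "f \<in> borel_measurable borel" unfolding f_def by measurable
  have f01: "0 \<le> f x" "f x \<le> 1" for x
    using excess_bounds[of u \<delta> p x] unfolding f_def by (auto simp: indicator_def of_bool_def split: if_splits)
  define I where "I = (\<integral>\<^sup>+x\<in>\<Omega>. (\<integral>\<^sup>+y\<in>\<Omega>. ennreal (\<bar>u x - u y\<bar> / ?k x y) \<partial>lborel) \<partial>lborel)"
  have W: "(\<integral>\<^sup>+x\<in>\<Omega>. ennreal \<bar>u x\<bar> \<partial>lborel) + I < \<infinity>"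
    using adm unfolding W_obst_def W_space_def I_def by (simp add: nn_integral_completion)
  then have W1: "(\<integral>\<^sup>+x\<in>\<Omega>. ennreal \<bar>u x\<bar> \<partial>lborel) < \<infinity>" and W2: "I < \<infinity>" by auto
  show g: "gagliardo s f < \<infinity>"
    unfolding f_def
  proof (rule gagliardo_excess_finite[OF s delta u])
    have "(\<integral>\<^sup>+x. \<integral>\<^sup>+y. ennreal (indicator (ball (fst p) \<delta>) x * indicator (ball (fst p) \<delta>) y * \<bar>u x - u y\<bar> / ?k x y) \<partial>lborel \<partial>lborel)
      \<le> (\<integral>\<^sup>+x. \<integral>\<^sup>+y. ennreal (\<bar>u x - u y\<bar> / ?k x y) * indicator \<Omega> y * indicator \<Omega> x \<partial>lborel \<partial>lborel)"
      by (intro nn_integral_mono) (use B in \<open>auto simp: indicator_def\<close>)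
    also have "\<dots> = I" unfolding I_def by (intro nn_integral_cong nn_integral_multc) measurable
    finally show "(\<integral>\<^sup>+x. \<integral>\<^sup>+y. ennreal (indicator (ball (fst p) \<delta>) x * indicator (ball (fst p) \<delta>) y * \<bar>u x - u y\<bar> / ?k x y) \<partial>lborel \<partial>lborel) < \<infinity>"
      using W2 by order
  qed
  show "(\<lambda>x. u x - f x) \<in> W_obst s \<Omega> A \<phi> \<psi>"
    unfolding W_obst_def
  proof (intro CollectI conjI)
    have "(\<integral>\<^sup>+x\<in>\<Omega>. ennreal \<bar>u x - f x\<bar> \<partial>lborel) \<le> (\<integral>\<^sup>+x. ennreal \<bar>u x\<bar> * indicator \<Omega> x + indicator \<Omega> x \<partial>lborel)"
    proof (rule nn_integral_mono)
      fix x
      have "\<bar>u x - f x\<bar> \<le> \<bar>u x\<bar> + 1" using f01[of x] by linarith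
      then have "ennreal \<bar>u x - f x\<bar> \<le> ennreal \<bar>u x\<bar> + 1"
        by (metis abs_ge_zero ennreal_1 ennreal_leI ennreal_plus zero_le_one)
      then show "ennreal \<bar>u x - f x\<bar> * indicator \<Omega> x \<le> ennreal \<bar>u x\<bar> * indicator \<Omega> x + indicator \<Omega> x"
        by (simp add: indicator_def)
    qed
    also have "\<dots> = (\<integral>\<^sup>+x\<in>\<Omega>. ennreal \<bar>u x\<bar> \<partial>lborel) + emeasure lborel \<Omega>"
      by (subst nn_integral_add) auto
    also have "\<dots> < \<infinity>" using W1 emeasure_bounded_finite[OF Om(2)] by simp
    finally have a: "(\<integral>\<^sup>+x\<in>\<Omega>. ennreal \<bar>u x - f x\<bar> \<partial>lborel) < \<infinity>" .
    have "(\<integral>\<^sup>+x\<in>\<Omega>. (\<integral>\<^sup>+y\<in>\<Omega>. ennreal (\<bar>(u x - f x) - (u y - f y)\<bar> / ?k x y) \<partial>lborel) \<partial>lborel)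
      \<le> (\<integral>\<^sup>+x\<in>\<Omega>. (\<integral>\<^sup>+y. ennreal (\<bar>u x - u y\<bar> / ?k x y) * indicator \<Omega> y + ennreal (\<bar>f x - f y\<bar> / ?k x y) \<partial>lborel) \<partial>lborel)"
    proof (intro nn_integral_mono mult_right_mono)
      fix x y :: 'a
      have "\<bar>(u x - f x) - (u y - f y)\<bar> / ?k x y \<le> (\<bar>u x - u y\<bar> + \<bar>f x - f y\<bar>) / ?k x y"
        by (intro divide_right_mono) auto
      then have "ennreal (\<bar>(u x - f x) - (u y - f y)\<bar> / ?k x y) \<le> ennreal (\<bar>u x - u y\<bar> / ?k x y) + ennreal (\<bar>f x - f y\<bar> / ?k x y)"
        by (simp add: add_divide_distrib ennreal_leI ennreal_plus[symmetric] del: ennreal_plus)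
      then show "ennreal (\<bar>(u x - f x) - (u y - f y)\<bar> / ?k x y) * indicator \<Omega> y
        \<le> ennreal (\<bar>u x - u y\<bar> / ?k x y) * indicator \<Omega> y + ennreal (\<bar>f x - f y\<bar> / ?k x y)"
        by (simp add: indicator_def)
    qed auto
    also have "\<dots> = (\<integral>\<^sup>+x. (\<integral>\<^sup>+y\<in>\<Omega>. ennreal (\<bar>u x - u y\<bar> / ?k x y) \<partial>lborel) * indicator \<Omega> x
        + (\<integral>\<^sup>+y. ennreal (\<bar>f x - f y\<bar> / ?k x y) \<partial>lborel) * indicator \<Omega> x \<partial>lborel)"
      by (simp add: nn_integral_add distrib_right)
    also have "\<dots> \<le> (\<integral>\<^sup>+x. (\<integral>\<^sup>+y\<in>\<Omega>. ennreal (\<bar>u x - u y\<bar> / ?k x y) \<partial>lborel) * indicator \<Omega> x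
        + (\<integral>\<^sup>+y. ennreal (\<bar>f x - f y\<bar> / ?k x y) \<partial>lborel) \<partial>lborel)"
      by (intro nn_integral_mono add_left_mono) (auto simp: indicator_def)
    also have "\<dots> = I + gagliardo s f"
      unfolding I_def gagliardo_def by (rule nn_integral_add) measurable
    also have "\<dots> < \<infinity>" using W2 g by simp
    finally have b: "(\<integral>\<^sup>+x\<in>\<Omega>. (\<integral>\<^sup>+y\<in>\<Omega>. ennreal (\<bar>(u x - f x) - (u y - f y)\<bar> / ?k x y) \<partial>lborel) \<partial>lborel) < \<infinity>" .
    show "(\<lambda>x. u x - f x) \<in> W_space s \<Omega>"
      unfolding W_space_def nn_integral_completion using a b
      by (auto intro!: measurable_completion)
    have out: "AE x in lebesgue. x \<notin> \<Omega> \<longrightarrow> u x = \<phi> x" and above: "AE x in lebesgue. x \<in> A \<longrightarrow> \<psi> x \<le> u x"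
      using adm unfolding W_obst_def by auto
    show "AE x in lebesgue. x \<notin> \<Omega> \<longrightarrow> u x - f x = \<phi> x"
      using out by eventually_elim (use B in \<open>auto simp: f_def excess_def\<close>)
    show "AE x in lebesgue. x \<in> A \<longrightarrow> \<psi> x \<le> u x - f x"
      using above
    proof eventually_elim
      case (elim x)
      show ?case
      proof
        assume x: "x \<in> A"
        show "\<psi> x \<le> u x - f x"
        proof (cases "x \<in> ball (fst p) \<delta>")
          case True
          then show ?thesis using elim x obst[OF x True] by (auto simp: f_def excess_def min_def max_def)
        qed (use elim x in \<open>auto simp: f_def excess_def\<close>)
      qed
    qed
  qed
qed

text \<open>
  The comparison principle. With \<open>f\<close> the excess of \<open>u\<close> over the hemisphere, minimality of \<open>u\<close> and the curvature
  estimate \<open>est\<close> give \<open>c\<close> times the integral of \<open>f\<close> at most \<open>0\<close>.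
\<close>

lemma ball_barrier:
  fixes u \<phi> \<psi> :: "'a::euclidean_space \<Rightarrow> real" and \<delta> :: real and p :: "'a \<times> real"
  assumes s: "0 < s" "s < 1/2" and delta: "0 < \<delta>"
    and Om: "open \<Omega>" "\<Omega> \<subseteq> ball 0 R" and B: "ball (fst p) \<delta> \<subseteq> \<Omega>"
    and u[measurable]: "u \<in> borel_measurable borel" and phi[measurable]: "\<phi> \<in> borel_measurable borel"
    and sol: "solves_obstacle s \<Omega> A \<phi> \<psi> u"
    and obst: "\<And>x. x \<in> A \<Longrightarrow> x \<in> ball (fst p) \<delta> \<Longrightarrow> \<psi> x \<le> hemi \<delta> p x"
    and c: "0 < c"
    and est: "\<And>x \<epsilon>. x \<in> ball (fst p) \<delta> \<Longrightarrow> 0 < \<epsilon> \<Longrightarrow> \<epsilon> \<le> 1 \<Longrightarrow>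
      2 * emeasure (riesz_measure s (x, hemi \<delta> p x)) (barrier_set \<delta> p R \<phi> \<inter> {Y. \<epsilon> < norm (fst Y - x)}) + ennreal c
         \<le> emeasure (riesz_measure s (x, hemi \<delta> p x)) {Y. \<epsilon> < norm (fst Y - x)}"
  shows "AE x in lborel. x \<in> ball (fst p) \<delta> \<longrightarrow> u x \<le> hemi \<delta> p x"
proof -
  let ?n = "DIM('a)"
  have n: "1 \<le> ?n" by (simp add: Suc_leI)
  have s0: "0 \<le> s" using s by simp
  define B where "B = ball (fst p) \<delta>"
  have Bm[measurable]: "B \<in> sets borel" by (simp add: B_def)
  have BOm: "B \<subseteq> \<Omega>" using B by (simp add: B_def)
  have bdd: "bounded \<Omega>" using Om(2) bounded_ball bounded_subset by blast
  define f where "f = excess u \<delta> p"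
  define v where "v x = u x - f x" for x
  have f[measurable]: "f \<in> borel_measurable borel" unfolding f_def by measurable
  have v[measurable]: "v \<in> borel_measurable borel" unfolding v_def by measurable
  have f0: "0 \<le> f x" and f1: "f x \<le> indicator B x" for x
    using excess_bounds[of u \<delta> p x] unfolding f_def B_def by auto
  have adm: "u \<in> W_obst s \<Omega> A \<phi> \<psi>" using sol by (simp add: solves_obstacle_def)
  have gag: "gagliardo s f < \<infinity>" and vadm: "v \<in> W_obst s \<Omega> A \<phi> \<psi>"
    using subtract_excess_admissible[OF s delta Om(1) bdd B u adm obst] unfolding f_def v_def[abs_def] by auto
  let ?k = "\<lambda>z::'a \<times> 'a. norm (fst z - snd z)"
  let ?G = "G_prim ?n s" and ?L = "G_lim ?n s" and ?H = "\<lambda>z. pair_slope s \<delta> p R \<phi> (fst z) (snd z)"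
  have Hm[measurable]: "?H \<in> borel_measurable (borel \<Otimes>\<^sub>M borel)"
    by (rule borel_measurable_pair_slope[OF phi])
  have L0: "0 \<le> ?L" by (rule G_lim_nonneg)
  have Hb: "\<bar>?H z\<bar> \<le> ?L" for z by (rule abs_pair_slope_le[OF s0])

  \<comment> \<open>The Bochner integral of a function that is not integrable is \<open>0\<close>, so \<open>E_le\<close> below carries information only
    together with \<open>Eint\<close>.\<close>
  define E where "E z = indicator (Q_dom \<Omega>) z *
      ((G_cal ?n s ((u (fst z) - u (snd z)) / ?k z) - G_cal ?n s ((v (fst z) - v (snd z)) / ?k z))
          / ?k z powr (real ?n - 1 + s))" for z
  have Qm[measurable]: "Q_dom \<Omega> \<in> sets (borel \<Otimes>\<^sub>M borel)"
    unfolding Q_dom_def borel_prod using Om(1)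
    by (intro sets.Diff borel_closed closed_Times closed_Diff) auto
  have Em: "E \<in> borel_measurable (borel \<Otimes>\<^sub>M borel)"
    unfolding E_def[abs_def] by measurable
  have E_le: "(LINT z|lborel. E z) \<le> 0"
  proof -
    have "set_lebesgue_integral lebesgue (Q_dom \<Omega>) (\<lambda>(x, y).
        (G_cal ?n s ((u x - u y) / norm (x - y)) - G_cal ?n s ((v x - v y) / norm (x - y)))
          / norm (x - y) powr (real ?n - 1 + s)) \<le> 0"
      using sol vadm unfolding solves_obstacle_def by blast
    also have "set_lebesgue_integral lebesgue (Q_dom \<Omega>) (\<lambda>(x, y).
        (G_cal ?n s ((u x - u y) / norm (x - y)) - G_cal ?n s ((v x - v y) / norm (x - y)))
          / norm (x - y) powr (real ?n - 1 + s)) = (LINT z|lebesgue. E z)"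
      unfolding set_lebesgue_integral_def E_def by (simp add: case_prod_beta)
    also have "\<dots> = (LINT z|lborel. E z)"
      by (rule integral_completion) (use Em in \<open>simp add: borel_prod\<close>)
    finally show ?thesis .
  qed

  define W where "W z = \<bar>f (fst z) - f (snd z)\<bar> / ?k z powr (real ?n + s)" for z
  have Wm[measurable]: "W \<in> borel_measurable (borel \<Otimes>\<^sub>M borel)"
    unfolding W_def[abs_def] by measurable
  have W0: "0 \<le> W z" for z by (simp add: W_def)
  have Wint: "integrable lborel W"
  proof (rule integrableI_nonneg)
    show "W \<in> borel_measurable lborel" using Wm by (simp add: borel_prod)
    have "(\<integral>\<^sup>+z. ennreal (W z) \<partial>lborel) = gagliardo s f"
      unfolding gagliardo_def lborel_prod[symmetric]
      by (subst lborel.nn_integral_fst[symmetric]) (simp_all add: W_def)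
    then show "(\<integral>\<^sup>+z. ennreal (W z) \<partial>lborel) < \<infinity>" using gag by simp
  qed (simp add: W0)
  have LWint: "integrable lborel (\<lambda>z. ?L * W z)" using Wint by simp

  have Eb: "\<bar>E z\<bar> \<le> ?L * W z" for z
  proof (cases "?k z = 0")
    case False
    then have k: "0 < ?k z" by simp
    have kk: "?k z * ?k z powr (real ?n - 1 + s) = ?k z powr (real ?n + s)"
    proof -
      have "?k z powr 1 * ?k z powr (real ?n - 1 + s) = ?k z powr (real ?n + s)"
        by (subst powr_add[symmetric]) simp
      then show ?thesis using k by simp
    qed
    let ?U = "(u (fst z) - u (snd z)) / ?k z" and ?V = "(v (fst z) - v (snd z)) / ?k z"
    have UV: "?U - ?V = (f (fst z) - f (snd z)) / ?k z" 
      by (simp add: v_def diff_divide_distrib[symmetric])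
    have "\<bar>E z\<bar> \<le> \<bar>G_cal ?n s ?U - G_cal ?n s ?V\<bar> / ?k z powr (real ?n - 1 + s)"
      unfolding E_def by (simp add: indicator_def)
    also have "\<dots> \<le> (?L * \<bar>?U - ?V\<bar>) / ?k z powr (real ?n - 1 + s)"
      by (intro divide_right_mono G_cal_lipschitz n s0) simp
    also have "\<dots> = ?L * W z"
      unfolding UV W_def kk[symmetric] using k by (simp add: abs_divide)
    finally show ?thesis .
  qed (simp add: E_def W_def)
  have Eint: "integrable lborel E"
    by (rule Bochner_Integration.integrable_bound[OF LWint])
       (use Em Eb L0 W0 in \<open>auto simp: borel_prod intro!: AE_I2\<close>)

  define T where "T z = ?H z * (f (fst z) - f (snd z)) / ?k z powr (real ?n + s)" for z
  have Tm[measurable]: "T \<in> borel_measurable (borel \<Otimes>\<^sub>M borel)"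
    unfolding T_def[abs_def] by measurable
  have Tb: "\<bar>T z\<bar> \<le> ?L * W z" for z
  proof -
    have "\<bar>T z\<bar> = \<bar>?H z\<bar> * W z" unfolding T_def W_def by (simp add: abs_mult)
    also have "\<dots> \<le> ?L * W z" by (intro mult_right_mono Hb W0)
    finally show ?thesis .
  qed
  have Tint: "integrable lborel T"
    by (rule Bochner_Integration.integrable_bound[OF LWint])
       (use Tm Tb L0 W0 in \<open>auto simp: borel_prod intro!: AE_I2\<close>)

  have ext: "AE x in lborel. x \<notin> \<Omega> \<longrightarrow> u x = \<phi> x"
    using adm unfolding W_obst_def by (simp add: AE_completion_iff)
  \<comment> \<open>Convexity bounds the energy difference below by the slope at the competitor, and \<open>excess_slope_ge\<close> bounds that by the slope of the barrier.\<close>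
  have TE: "AE z in lborel. T z \<le> E z"
    using AE_lborel_fst[OF ext] AE_lborel_snd[OF ext]
  proof eventually_elim
    case (elim z)
    show ?case
    proof (cases "z \<in> Q_dom \<Omega> \<and> ?k z \<noteq> 0")
      case False
      then have "T z = 0"
      proof (cases "?k z = 0")
        case knz: False
        with False have "fst z \<notin> \<Omega>" "snd z \<notin> \<Omega>" unfolding Q_dom_def by (auto simp: mem_Times_iff)
        then show ?thesis using BOm unfolding T_def f_def excess_def B_def by auto
      qed (simp add: T_def)
      moreover have "E z = 0" using False unfolding E_def by (auto simp: indicator_def)
      ultimately show ?thesis by simp
    next
      case True
      then have k: "0 < ?k z" by simp
      have kk: "?k z * ?k z powr (real ?n - 1 + s) = ?k z powr (real ?n + s)"
      proof -
        have "?k z powr 1 * ?k z powr (real ?n - 1 + s) = ?k z powr (real ?n + s)"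
          by (subst powr_add[symmetric]) simp
        then show ?thesis using k by simp
      qed
      let ?U = "(u (fst z) - u (snd z)) / ?k z" and ?V = "(v (fst z) - v (snd z)) / ?k z"
      have UV: "?U - ?V = (f (fst z) - f (snd z)) / ?k z" 
        by (simp add: v_def diff_divide_distrib[symmetric])
      have far: "R \<le> norm x \<Longrightarrow> x \<notin> \<Omega>" for x using Om(2) by force
      have "T z \<le> ?G ?V * (f (fst z) - f (snd z)) / ?k z powr (real ?n + s)"
        unfolding T_def f_def v_def
        by (intro divide_right_mono excess_slope_ge[OF s0]) (use elim far in auto)
      also have "\<dots> = ?G ?V * (?U - ?V) / ?k z powr (real ?n - 1 + s)"
        unfolding UV kk[symmetric] using k by simp
      also have "\<dots> \<le> (G_cal ?n s ?U - G_cal ?n s ?V) / ?k z powr (real ?n - 1 + s)"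
        by (intro divide_right_mono G_cal_convex n s0) simp
      also have "\<dots> = E z" using True unfolding E_def by simp
      finally show ?thesis .
    qed
  qed
  have T_le: "(LINT z|lborel. T z) \<le> 0"
    using integral_mono_AE[OF Tint Eint TE] E_le by simp

  have fint: "integrable lborel f"
  proof (rule Bochner_Integration.integrable_bound)
    show "integrable lborel (indicator B :: 'a \<Rightarrow> real)"
      using emeasure_lborel_ball_finite[of "fst p" \<delta>] unfolding B_def by (intro integrable_real_indicator) auto
  qed (use f0 f1 in \<open>auto intro!: AE_I2\<close>)

  \<comment> \<open>Away from the diagonal the contributions of \<open>f x\<close> and \<open>f y\<close> are integrable separately, and by antisymmetry
    of the slope they are equal. The diagonal is recovered afterwards by dominated convergence.\<close>
  have cut: "c * (LINT x|lborel. f x) \<le> (LINT z|lborel. indicator {z. \<epsilon> < ?k z} z * T z)"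
    if eps: "0 < \<epsilon>" "\<epsilon> \<le> 1" for \<epsilon>
  proof -
    define a where "a z = f (fst z) * (if \<epsilon> < ?k z then ?H z / ?k z powr (real ?n + s) else 0)" for z
    have am[measurable]: "a \<in> borel_measurable (borel \<Otimes>\<^sub>M borel)"
      unfolding a_def[abs_def] by measurable
    define b where "b z = ?L * (indicator B (fst z) * (indicator {z. \<epsilon> < norm z} (snd z - fst z) * norm (snd z - fst z) powr - (real ?n + s)))" for z :: "'a \<times> 'a"
    have bm[measurable]: "b \<in> borel_measurable (borel \<Otimes>\<^sub>M borel)"
      unfolding b_def[abs_def] by measurable
    have aint: "integrable lborel a"
    proof (rule Bochner_Integration.integrable_bound[where f=b])
      show "a \<in> borel_measurable lborel" using am by (simp add: borel_prod)
      show "AE z in lborel. norm (a z) \<le> norm (b z)"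
      proof (rule AE_I2)
        fix z :: "'a \<times> 'a"
        show "norm (a z) \<le> norm (b z)"
        proof (cases "\<epsilon> < ?k z")
          case True
          have "norm (a z) = f (fst z) * (\<bar>?H z\<bar> / ?k z powr (real ?n + s))"
            using True f0[of "fst z"] by (simp add: a_def abs_mult)
          also have "\<dots> \<le> indicator B (fst z) * (?L / ?k z powr (real ?n + s))"
            by (intro mult_mono divide_right_mono Hb f1) (auto simp: f0)
          also have "\<dots> = b z"
            using True unfolding b_def powr_minus_divide by (simp add: norm_minus_commute)
          also have "\<dots> \<le> norm (b z)" by simp
          finally show ?thesis .
        qed (simp add: a_def)
      qed
      show "integrable lborel b"
      proof (rule integrableI_nonneg)
        show "b \<in> borel_measurable lborel" using bm by (simp add: borel_prod)
        show "AE z in lborel. 0 \<le> b z" using L0 by (auto simp: b_def)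
        let ?t = "\<lambda>z::'a. ennreal (norm z powr - (real ?n + s)) * indicator {z. \<epsilon> \<le> norm z} z"
        have "(\<integral>\<^sup>+z. ennreal (b z) \<partial>lborel) = (\<integral>\<^sup>+x. \<integral>\<^sup>+y. ennreal (b (x, y)) \<partial>lborel \<partial>lborel)"
          unfolding lborel_prod[symmetric] using bm by (subst lborel.nn_integral_fst[symmetric]) auto
        also have "\<dots> \<le> (\<integral>\<^sup>+x. \<integral>\<^sup>+y. (ennreal ?L * indicator B x) * ?t (y - x) \<partial>lborel \<partial>lborel)"
          by (intro nn_integral_mono) (use L0 in \<open>auto simp: b_def indicator_def ennreal_mult'\<close>)
        also have "\<dots> = (\<integral>\<^sup>+x. (ennreal ?L * indicator B x) * (\<integral>\<^sup>+y. ?t y \<partial>lborel) \<partial>lborel)"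
        proof (rule nn_integral_cong)
          fix x :: 'a
          have "(\<integral>\<^sup>+y. (ennreal ?L * indicator B x) * ?t (y - x) \<partial>lborel) = (ennreal ?L * indicator B x) * (\<integral>\<^sup>+y. ?t (y - x) \<partial>lborel)"
            by (rule nn_integral_cmult) measurable
          also have "(\<integral>\<^sup>+y. ?t (y - x) \<partial>lborel) = (\<integral>\<^sup>+y. ?t y \<partial>lborel)"
            by (rule nn_integral_lborel_translate) measurable
          finally show "(\<integral>\<^sup>+y. (ennreal ?L * indicator B x) * ?t (y - x) \<partial>lborel) = (ennreal ?L * indicator B x) * (\<integral>\<^sup>+y. ?t y \<partial>lborel)" .
        qed
        also have "\<dots> = ennreal ?L * emeasure lborel B * (\<integral>\<^sup>+y. ?t y \<partial>lborel)"
        proof -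
          have "(\<integral>\<^sup>+x. (ennreal ?L * indicator B x) * (\<integral>\<^sup>+y. ?t y \<partial>lborel) \<partial>lborel)
            = (\<integral>\<^sup>+x. (ennreal ?L * indicator B x) \<partial>lborel) * (\<integral>\<^sup>+y. ?t y \<partial>lborel)"
            by (rule nn_integral_multc) measurable
          then show ?thesis by (simp add: nn_integral_cmult_indicator)
        qed
        also have "\<dots> < \<infinity>"
          using nn_integral_riesz_tail[OF eps(1) s(1), where 'a='a] emeasure_lborel_ball_finite[of "fst p" \<delta>]
          unfolding B_def by (simp add: ennreal_mult_less_top)
        finally show "(\<integral>\<^sup>+z. ennreal (b z) \<partial>lborel) < \<infinity>" .
      qed
    qed
    have flip: "(\<lambda>(x, y). a (y, x)) = (\<lambda>z. a (snd z, fst z))" by (simp add: fun_eq_iff)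
    have swap: "(LINT z|lborel. a (snd z, fst z)) = (LINT z|lborel. a z)"
      using lborel_pair.integral_product_swap[of a] am by (simp only: flip lborel_prod borel_prod measurable_lborel2 sets_lborel measurable_lborel1)
    have swapint: "integrable lborel (\<lambda>z. a (snd z, fst z))"
      using lborel_pair.integrable_product_swap[of a] aint by (simp only: flip lborel_prod)
    have "indicator {z. \<epsilon> < ?k z} z * T z = a z + a (snd z, fst z)" for z
    proof -
      have "pair_slope s \<delta> p R \<phi> (snd z) (fst z) = - ?H z" by (rule pair_slope_antisym[OF s0])
      then show ?thesis
        unfolding T_def a_def fst_conv snd_conv
        by (simp add: norm_minus_commute[of "snd z"] indicator_def algebra_simps diff_divide_distrib)
    qed
    then have "(LINT z|lborel. indicator {z. \<epsilon> < ?k z} z * T z) = 2 * (LINT z|lborel. a z)"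
      using aint swapint swap by simp
    also have "(LINT z|lborel. a z) = (LINT x|lborel. LINT y|lborel. a (x, y))"
      using lborel_pair.integral_fst'[of a] aint by (simp add: lborel_prod)
    also have "2 * (LINT x|lborel. LINT y|lborel. a (x, y)) = (LINT x|lborel. 2 * (LINT y|lborel. a (x, y)))"
      by simp
    also have "\<dots> \<ge> (LINT x|lborel. c * f x)"
    proof (rule integral_mono)
      show "integrable lborel (\<lambda>x. c * f x)" using fint by simp
      show "integrable lborel (\<lambda>x. 2 * (LINT y|lborel. a (x, y)))"
        using lborel_pair.integrable_fst'[of a] aint by (simp add: lborel_prod)
      fix x :: 'a
      let ?P = "LINT y|lborel. (if \<epsilon> < norm (x - y) then barrier_slope s \<delta> p R \<phi> x y / norm (x - y) powr (real ?n + s) else 0)"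
      show "c * f x \<le> 2 * (LINT y|lborel. a (x, y))"
      proof (cases "x \<in> B")
        case True
        have "c \<le> 2 * ?P"
          by (rule barrier_slope_integral_ge[OF s(1) eps(1) _ _ phi refl])
             (use c True est[OF _ eps, of x] in \<open>auto simp: B_def\<close>)
        moreover have "(LINT y|lborel. a (x, y)) = f x * ?P"
        proof -
          have "(LINT y|lborel. a (x, y)) = (LINT y|lborel. f x * (if \<epsilon> < norm (x - y) then barrier_slope s \<delta> p R \<phi> x y / norm (x - y) powr (real ?n + s) else 0))"
            using True by (intro Bochner_Integration.integral_cong) (simp_all add: a_def pair_slope_def B_def)
          then show ?thesis by simp
        qed
        ultimately show ?thesis using mult_left_mono[OF _ f0[of x], of c "2 * ?P"] by (simp add: mult_ac)
      next
        case False
        then have "f x = 0" by (simp add: f_def excess_def B_def)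
        then show ?thesis by (simp add: a_def)
      qed
    qed
    finally show ?thesis by simp
  qed

  have lim: "(\<lambda>m. LINT z|lborel. indicator {z. 1 / real (Suc m) < ?k z} z * T z) \<longlonglongrightarrow> (LINT z|lborel. T z)"
  proof (rule integral_dominated_convergence[where w="\<lambda>z. ?L * W z"])
    show "T \<in> borel_measurable lborel" using Tm by (simp add: borel_prod)
    show "(\<lambda>z. indicator {z. 1 / real (Suc m) < ?k z} z * T z) \<in> borel_measurable lborel" for m
    proof -
      have "(\<lambda>z. indicator {z. 1 / real (Suc m) < ?k z} z * T z) \<in> borel_measurable (borel \<Otimes>\<^sub>M borel)" by measurable
      then show ?thesis by (simp add: borel_prod)
    qed
    show "integrable lborel (\<lambda>z. ?L * W z)" by (rule LWint)
    show "AE z in lborel. norm (indicator {z. 1 / real (Suc m) < ?k z} z * T z) \<le> ?L * W z" for m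
      using Tb L0 W0 by (intro AE_I2) (auto simp: indicator_def)
    show "AE z in lborel. (\<lambda>m. indicator {z. 1 / real (Suc m) < ?k z} z * T z) \<longlonglongrightarrow> T z"
    proof (rule AE_I2)
      fix z :: "'a \<times> 'a"
      show "(\<lambda>m. indicator {z. 1 / real (Suc m) < ?k z} z * T z) \<longlonglongrightarrow> T z"
      proof (cases "?k z = 0")
        case True
        then show ?thesis by (simp add: T_def)
      next
        case False
        have "(\<lambda>m. 1 / real (Suc m)) \<longlonglongrightarrow> 0"
          using LIMSEQ_inverse_real_of_nat by (simp add: inverse_eq_divide)
        then have "\<forall>\<^sub>F m in sequentially. 1 / real (Suc m) < ?k z"
          by (rule order_tendstoD(2)) (use False in simp)
        then have "\<forall>\<^sub>F m in sequentially. indicator {z. 1 / real (Suc m) < ?k z} z * T z = T z"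
          by eventually_elim simp
        then show ?thesis by (rule tendsto_eventually)
      qed
    qed
  qed
  have "c * (LINT x|lborel. f x) \<le> (LINT z|lborel. T z)"
    by (rule LIMSEQ_le_const[OF lim]) (intro exI allI impI cut, auto simp: field_simps)
  then have "c * (LINT x|lborel. f x) \<le> 0" using T_le by simp
  then have "(LINT x|lborel. f x) \<le> 0" using c by (simp add: mult_le_0_iff)
  moreover have "0 \<le> (LINT x|lborel. f x)" by (intro integral_nonneg_AE AE_I2 f0)
  ultimately have "(LINT x|lborel. f x) = 0" by simp
  then have "AE x in lborel. f x = 0"
    using integral_nonneg_eq_0_iff_AE[OF fint] f0 by simp
  then show ?thesis
  proof eventually_elim
    case (elim x)
    show ?case
    proof
      assume "x \<in> ball (fst p) \<delta>"
      then show "u x \<le> hemi \<delta> p x" using elim unfolding f_def excess_def by (auto simp: min_def max_def split: if_splits)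
    qed
  qed
qed

section \<open>Barriers for solutions of the obstacle problem\<close>

text \<open>
  This and the next three lemmas allow to replace solutions and exterior data by Borel functions, for which product
  measurability and Fubini's theorem are available.
\<close>

lemma W_obst_cong_AE:
  assumes "AE x in lborel. \<phi> x = \<phi>' x"
  shows "W_obst s \<Omega> A \<phi> \<psi> = W_obst s \<Omega> A \<phi>' \<psi>"
proof -
  have "(AE x in lborel. x \<notin> \<Omega> \<longrightarrow> u x = \<phi> x) \<longleftrightarrow> (AE x in lborel. x \<notin> \<Omega> \<longrightarrow> u x = \<phi>' x)" for u
    using assms by (intro iffI; elim eventually_rev_mp) (auto elim!: eventually_mono)
  then show ?thesis unfolding W_obst_def AE_completion_iff by simp
qed

lemma W_obst_mem_cong_AE:
  fixes u :: "'a::euclidean_space \<Rightarrow> real"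
  assumes eq: "AE x in lborel. u x = u' x" and u': "u' \<in> borel_measurable borel"
    and u: "u \<in> W_obst s \<Omega> A \<phi> \<psi>"
  shows "u' \<in> W_obst s \<Omega> A \<phi> \<psi>"
proof -
  have a: "(\<integral>\<^sup>+x\<in>\<Omega>. ennreal \<bar>u x\<bar> \<partial>lborel) = (\<integral>\<^sup>+x\<in>\<Omega>. ennreal \<bar>u' x\<bar> \<partial>lborel)"
    using eq by (intro nn_integral_cong_AE) (auto elim!: eventually_mono)
  have b: "(\<integral>\<^sup>+x\<in>\<Omega>. (\<integral>\<^sup>+y\<in>\<Omega>. ennreal (\<bar>u x - u y\<bar> / norm (x - y) powr (real DIM('a) + s)) \<partial>lborel) \<partial>lborel)
      = (\<integral>\<^sup>+x\<in>\<Omega>. (\<integral>\<^sup>+y\<in>\<Omega>. ennreal (\<bar>u' x - u' y\<bar> / norm (x - y) powr (real DIM('a) + s)) \<partial>lborel) \<partial>lborel)"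
  proof (rule nn_integral_cong_AE)
    show "AE x in lborel. (\<integral>\<^sup>+y\<in>\<Omega>. ennreal (\<bar>u x - u y\<bar> / norm (x - y) powr (real DIM('a) + s)) \<partial>lborel) * indicator \<Omega> x
      = (\<integral>\<^sup>+y\<in>\<Omega>. ennreal (\<bar>u' x - u' y\<bar> / norm (x - y) powr (real DIM('a) + s)) \<partial>lborel) * indicator \<Omega> x"
      using eq
    proof eventually_elim
      case (elim x)
      show ?case using elim eq
        by (intro arg_cong2[where f="(*)"] nn_integral_cong_AE refl) (auto elim!: eventually_mono)
    qed
  qed
  have c: "AE x in lborel. x \<notin> \<Omega> \<longrightarrow> u' x = \<phi> x" and d: "AE x in lborel. x \<in> A \<longrightarrow> \<psi> x \<le> u' x"
  proof -
    have c: "AE x in lborel. x \<notin> \<Omega> \<longrightarrow> u x = \<phi> x" and d: "AE x in lborel. x \<in> A \<longrightarrow> \<psi> x \<le> u x"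
      using u unfolding W_obst_def AE_completion_iff by auto
    show "AE x in lborel. x \<notin> \<Omega> \<longrightarrow> u' x = \<phi> x" using c eq by eventually_elim auto
    show "AE x in lborel. x \<in> A \<longrightarrow> \<psi> x \<le> u' x" using d eq by eventually_elim auto
  qed
  show ?thesis
    using u c d u' unfolding W_obst_def W_space_def AE_completion_iff nn_integral_completion
    by (auto simp: a b intro: measurable_completion)
qed

lemma solves_obstacle_cong_AE:
  fixes u \<phi> \<psi> :: "'a::euclidean_space \<Rightarrow> real"
  assumes eq: "AE x in lborel. u x = u' x" and u'[measurable]: "u' \<in> borel_measurable borel"
    and phi: "AE x in lborel. \<phi> x = \<phi>' x" and Om: "open \<Omega>"
    and sol: "solves_obstacle s \<Omega> A \<phi> \<psi> u"
  shows "solves_obstacle s \<Omega> A \<phi>' \<psi> u'"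
  unfolding solves_obstacle_def W_obst_cong_AE[OF phi, symmetric]
proof (intro conjI ballI)
  let ?n = "DIM('a)"
  show "u' \<in> W_obst s \<Omega> A \<phi> \<psi>"
    using W_obst_mem_cong_AE[OF eq u'] sol unfolding solves_obstacle_def by blast
  fix v assume v: "v \<in> W_obst s \<Omega> A \<phi> \<psi>"
  then have "v \<in> borel_measurable lebesgue" unfolding W_obst_def W_space_def by auto
  then obtain v' where v'[measurable]: "v' \<in> borel_measurable borel" and veq: "AE x in lborel. v x = v' x"
    using completion_ex_borel_measurable_real[of v lborel] by auto
  define E where "E u v z = indicator (Q_dom \<Omega>) z *\<^sub>R (case z of (x, y) \<Rightarrow>
        (G_cal ?n s ((u x - u y) / norm (x - y)) - G_cal ?n s ((v x - v y) / norm (x - y)))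
          / norm (x - y) powr (real ?n - 1 + s))" for u v :: "'a \<Rightarrow> real" and z
  have Qm[measurable]: "Q_dom \<Omega> \<in> sets (borel \<Otimes>\<^sub>M borel)"
    unfolding Q_dom_def borel_prod using Om
    by (intro sets.Diff borel_closed closed_Times closed_Diff) auto
  have "E u' v' \<in> borel_measurable (borel \<Otimes>\<^sub>M borel)"
    unfolding E_def[abs_def] by measurable
  then have base: "E u' v' \<in> borel_measurable lebesgue"
    by (intro measurable_completion) (simp add: borel_prod)
  have ae: "AE z in lebesgue. E u' v' z = E u1 v z" if "AE x in lborel. u1 x = u' x" for u1
    unfolding AE_completion_iff
    using AE_lborel_fst[OF that, where 'b='a] AE_lborel_snd[OF that, where 'b='a] AE_lborel_fst[OF veq, where 'b='a] AE_lborel_snd[OF veq, where 'b='a]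
    by eventually_elim (simp add: E_def case_prod_beta)
  have int: "(LINT z|lebesgue. E u1 v z) = (LINT z|lebesgue. E u' v' z)" if "AE x in lborel. u1 x = u' x" for u1
    by (rule integral_cong_AE[OF borel_measurable_AE[OF base ae[OF that]] base]) (use ae[OF that] in \<open>auto elim!: eventually_mono\<close>)
  have "(LINT z|lebesgue. E u v z) \<le> 0"
    using sol v unfolding solves_obstacle_def set_lebesgue_integral_def E_def by blast
  then have "(LINT z|lebesgue. E u' v z) \<le> 0"
    using int[OF eq] int[of u'] by simp
  then show "set_lebesgue_integral lebesgue (Q_dom \<Omega>) (\<lambda>(x, y).
        (G_cal ?n s ((u' x - u' y) / norm (x - y)) - G_cal ?n s ((v x - v y) / norm (x - y)))
          / norm (x - y) powr (real ?n - 1 + s)) \<le> 0"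
    unfolding set_lebesgue_integral_def E_def .
qed

lemma alpha_bar_subgraph_cong_AE:
  fixes \<phi> \<phi>' :: "'a::euclidean_space \<Rightarrow> real"
  assumes "AE x in lborel. \<phi> x = \<phi>' x"
  shows "alpha_bar (subgraph \<phi>) = alpha_bar (subgraph \<phi>')"
proof -
  have ind: "AE Y in (lborel :: ('a \<times> real) measure). (indicator (subgraph \<phi>) Y :: real) = indicator (subgraph \<phi>') Y"
    using AE_lborel_fst[OF assms, where 'b=real] by eventually_elim (auto simp: indicator_def subgraph_def)
  have "(\<integral>\<^sup>+Y\<in>- ball 0 1. ennreal (indicator (subgraph \<phi>) Y / norm Y powr (real DIM('a \<times> real) + s)) \<partial>lborel)
    = (\<integral>\<^sup>+Y\<in>- ball 0 1. ennreal (indicator (subgraph \<phi>') Y / norm Y powr (real DIM('a \<times> real) + s)) \<partial>lborel)" for s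
    by (rule nn_integral_cong_AE) (use ind in eventually_elim, simp)
  then show ?thesis unfolding alpha_bar_def nn_integral_completion by simp
qed

text \<open>
  There are uncountably many balls, and \<open>ball_barrier\<close> has an exceptional null set for each of them. By
  Lindeloef's theorem countably many balls have the same union, so that one null set serves them all.
\<close>

lemma solutions_below_balls:
  fixes \<phi> \<psi> :: "'a::euclidean_space \<Rightarrow> real" and u :: "real \<Rightarrow> 'a \<Rightarrow> real"
  assumes Om: "open \<Omega>" "bounded \<Omega>" and phi: "\<phi> \<in> borel_measurable lebesgue"
    and alpha: "alpha_bar (subgraph \<phi>) < ennreal (omega (DIM('a) + 1) / 2)"
    and sol: "\<And>s. s \<in> {0<..<1} \<Longrightarrow> solves_obstacle s \<Omega> A \<phi> \<psi> (u s)"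
    and delta: "0 < \<delta>" "2 * \<delta> \<le> 1"
  shows "\<forall>\<^sub>F s in at_right 0. AE x in lebesgue. \<forall>p \<tau>. norm p \<le> M \<longrightarrow>
      ball p \<delta> \<subseteq> {(y, t). y \<in> \<Omega> \<and> (y \<in> A \<longrightarrow> \<psi> y < t)} \<longrightarrow> (x, \<tau>) \<in> ball p \<delta> \<longrightarrow> u s x \<le> \<tau>"
proof -
  let ?U = "{(y, t). y \<in> \<Omega> \<and> (y \<in> A \<longrightarrow> \<psi> y < t)}"
  obtain \<phi>' where phi'[measurable]: "\<phi>' \<in> borel_measurable borel" and phieq: "AE x in lborel. \<phi> x = \<phi>' x"
    using completion_ex_borel_measurable_real[OF phi] by auto
  have alpha': "alpha_bar (subgraph \<phi>') < ennreal (omega (DIM('a) + 1) / 2)"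
    using alpha alpha_bar_subgraph_cong_AE[OF phieq] by simp
  have sub: "subgraph \<phi>' \<in> sets borel"
  proof -
    have "subgraph \<phi>' = {Y \<in> space (borel \<Otimes>\<^sub>M borel). snd Y < \<phi>' (fst Y)}"
      by (auto simp: subgraph_def space_pair_measure)
    also have "\<dots> \<in> sets (borel \<Otimes>\<^sub>M borel)" by measurable
    finally show ?thesis unfolding borel_prod .
  qed
  obtain b where b: "\<And>x. x \<in> \<Omega> \<Longrightarrow> norm x \<le> b" using Om(2) unfolding bounded_iff by blast
  define R1 where "R1 = max 0 (max (M + 1) b)"
  have R1: "0 \<le> R1" by (simp add: R1_def)
  obtain c R where c: "0 < c" and R: "R1 < R"
    and ev: "\<forall>\<^sub>F s in at_right 0. \<forall>X p F \<epsilon>. norm X \<le> R1 \<longrightarrow> norm (X - p) = \<delta> \<longrightarrow> 0 < \<epsilon> \<longrightarrow> \<epsilon> \<le> 1 \<longrightarrow>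
       F \<in> sets borel \<longrightarrow> F \<inter> ball p \<delta> = {} \<longrightarrow> F \<inter> {Y. R \<le> norm (fst Y)} \<subseteq> subgraph \<phi>' \<longrightarrow>
       2 * emeasure (riesz_measure s X) (F \<inter> {Y. \<epsilon> < norm (fst Y - fst X)}) + ennreal (c / s)
         \<le> emeasure (riesz_measure s X) {Y. \<epsilon> < norm (fst Y - fst X)}"
    using riesz_measure_exterior_ball[OF sub alpha' R1 delta] by blast
  have OmR: "\<Omega> \<subseteq> ball 0 R" using b R by (force simp: R1_def)
  have ev2: "\<forall>\<^sub>F s::real in at_right 0. s < 1/2" 
    using eventually_at_right_field[of "\<lambda>s::real. s < 1/2" 0] by (auto intro!: exI[of _ "1/2"])
  show ?thesis
    using ev ev2 eventually_at_right_less[of 0]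
  proof eventually_elim
    case (elim s)
    have s: "0 < s" "s < 1/2" using elim by auto
    have sol_s: "solves_obstacle s \<Omega> A \<phi> \<psi> (u s)" using sol s by simp
    then have "u s \<in> borel_measurable lebesgue" unfolding solves_obstacle_def W_obst_def W_space_def by auto
    then obtain u' where u'[measurable]: "u' \<in> borel_measurable borel" and ueq: "AE x in lborel. u s x = u' x"
      using completion_ex_borel_measurable_real[of "u s" lborel] by auto
    have sol': "solves_obstacle s \<Omega> A \<phi>' \<psi> u'"
      by (rule solves_obstacle_cong_AE[OF ueq u' phieq Om(1) sol_s])
    have single: "AE x in lborel. \<forall>\<tau>. (x, \<tau>) \<in> ball p \<delta> \<longrightarrow> u' x \<le> \<tau>"
      if p: "norm p \<le> M" "ball p \<delta> \<subseteq> ?U" for p :: "'a \<times> real"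
    proof -
      have up: "(x, \<tau>) \<in> ball p \<delta>" if "x \<in> ball (fst p) \<delta>" "hemi \<delta> p x < \<tau>" "\<tau> \<le> snd p" for x \<tau>
        using hemi_approx_in_ball[OF that] .
      have lt: "hemi \<delta> p x < snd p" if "x \<in> ball (fst p) \<delta>" for x
      proof -
        have "(norm (x - fst p))\<^sup>2 < \<delta>\<^sup>2" using that delta by (intro power_strict_mono) (auto simp: dist_norm norm_minus_commute)
        then show ?thesis by (simp add: hemi_def)
      qed
      have BOm: "ball (fst p) \<delta> \<subseteq> \<Omega>"
      proof
        fix x assume x: "x \<in> ball (fst p) \<delta>"
        have "(x, snd p) \<in> ball p \<delta>" using up[OF x lt[OF x]] by simp
        then show "x \<in> \<Omega>" using p(2) by auto
      qed
      have "AE x in lborel. x \<in> ball (fst p) \<delta> \<longrightarrow> u' x \<le> hemi \<delta> p x"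
      proof (rule ball_barrier[OF s delta(1) Om(1) OmR BOm u' phi' sol'])
        fix x assume xA: "x \<in> A" and x: "x \<in> ball (fst p) \<delta>"
        show "\<psi> x \<le> hemi \<delta> p x"
        proof (rule dense_ge_bounded[OF lt[OF x]])
          fix \<tau> assume "hemi \<delta> p x < \<tau>" "\<tau> < snd p"
          then have "(x, \<tau>) \<in> ?U" using up[OF x] p(2) by fastforce
          then show "\<psi> x \<le> \<tau>" using xA by auto
        qed
      next
        show "0 < c / s" using c s by simp
      next
        fix x :: 'a and \<epsilon> :: real assume x: "x \<in> ball (fst p) \<delta>" and eps: "0 < \<epsilon>" "\<epsilon> \<le> 1"
        let ?X = "(x, hemi \<delta> p x)"
        have on: "norm (?X - p) = \<delta>" by (rule hemi_on_sphere[OF x])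
        have "norm ?X \<le> norm (?X - p) + norm p" using norm_triangle_ineq[of "?X - p" p] by simp
        then have nX: "norm ?X \<le> R1" using on p(1) delta by (simp add: R1_def)
        have F1: "barrier_set \<delta> p R \<phi>' \<inter> ball p \<delta> = {}"
        proof (rule ccontr)
          assume "barrier_set \<delta> p R \<phi>' \<inter> ball p \<delta> \<noteq> {}"
          then obtain y \<tau> where y: "(y, \<tau>) \<in> barrier_set \<delta> p R \<phi>'" "(y, \<tau>) \<in> ball p \<delta>" by auto
          show False using mem_ball_above_hemi[OF y(2)] y(1) by (simp add: barrier_set_def)
        qed
        have F2: "barrier_set \<delta> p R \<phi>' \<inter> {Y. R \<le> norm (fst Y)} \<subseteq> subgraph \<phi>'"
        proof
          fix Y assume Y: "Y \<in> barrier_set \<delta> p R \<phi>' \<inter> {Y. R \<le> norm (fst Y)}"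
          then have "fst Y \<notin> ball (fst p) \<delta>" using BOm OmR by (force simp: subset_iff)
          then show "Y \<in> subgraph \<phi>'" using Y by (auto simp: barrier_set_def subgraph_def)
        qed
        show "2 * emeasure (riesz_measure s ?X) (barrier_set \<delta> p R \<phi>' \<inter> {Y. \<epsilon> < norm (fst Y - x)}) + ennreal (c / s)
         \<le> emeasure (riesz_measure s ?X) {Y. \<epsilon> < norm (fst Y - x)}"
          using elim(1)[rule_format, OF nX on eps barrier_set_borel[OF phi'] F1 F2] by simp
      qed
      then show ?thesis
      proof eventually_elim
        case (elim x)
        show ?case
        proof (intro allI impI)
          fix \<tau> assume m: "(x, \<tau>) \<in> ball p \<delta>"
          show "u' x \<le> \<tau>" using elim mem_ball_above_hemi[OF m] by simp
        qed
      qed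
    qed
    define F where "F = (\<lambda>p::'a \<times> real. ball p \<delta>) ` {p. norm p \<le> M \<and> ball p \<delta> \<subseteq> ?U}"
    obtain F' where F': "F' \<subseteq> F" "countable F'" "\<Union>F' = \<Union>F"
      by (rule Lindelof[of F]) (auto simp: F_def)
    have "AE x in lborel. \<forall>S\<in>F'. \<forall>\<tau>. (x, \<tau>) \<in> S \<longrightarrow> u' x \<le> \<tau>"
    proof (rule AE_ball_countable'[OF _ F'(2)])
      fix S assume "S \<in> F'"
      then obtain p where "S = ball p \<delta>" "norm p \<le> M" "ball p \<delta> \<subseteq> ?U" using F'(1) unfolding F_def by blast
      then show "AE x in lborel. \<forall>\<tau>. (x, \<tau>) \<in> S \<longrightarrow> u' x \<le> \<tau>" using single[of p] by simp
    qed
    then have "AE x in lborel. \<forall>p \<tau>. norm p \<le> M \<longrightarrow> ball p \<delta> \<subseteq> ?U \<longrightarrow> (x, \<tau>) \<in> ball p \<delta> \<longrightarrow> u s x \<le> \<tau>"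
      using ueq
    proof eventually_elim
      case (elim x)
      show ?case
      proof (intro allI impI)
        fix p \<tau> assume p: "norm p \<le> M" "ball p \<delta> \<subseteq> ?U" "(x, \<tau>) \<in> ball p \<delta>"
        then have "(x, \<tau>) \<in> \<Union>F" unfolding F_def by blast
        then have "(x, \<tau>) \<in> \<Union>F'" using F'(3) by simp
        then show "u s x \<le> \<tau>" using elim by auto
      qed
    qed
    then show ?case by (simp only: AE_completion_iff)
  qed
qed

section \<open>Uniform interior balls\<close>

lemma ball_subset_smaller_radius:
  fixes z c :: "'b::euclidean_space"
  assumes z: "z \<in> ball c \<delta>" and V: "ball c \<delta> \<subseteq> V" and d: "0 < \<delta>'" "\<delta>' \<le> \<delta>"
  shows "\<exists>c'. z \<in> ball c' \<delta>' \<and> ball c' \<delta>' \<subseteq> V"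
proof -
  define l where "l = \<delta>' / \<delta>"
  have l: "0 < l" "l \<le> 1" "l * \<delta> = \<delta>'" using d by (auto simp: l_def)
  define c' where "c' = z + l *\<^sub>R (c - z)"
  have zc: "norm (c - z) < \<delta>" using z by (simp add: dist_norm)
  have "norm (c' - z) = l * norm (c - z)" using l by (simp add: c'_def)
  also have "\<dots> < \<delta>'" using zc l mult_strict_left_mono by fastforce
  finally have 1: "z \<in> ball c' \<delta>'" by (simp add: dist_norm)
  have "c - c' = (1 - l) *\<^sub>R (c - z)" by (simp add: c'_def algebra_simps)
  then have "norm (c - c') = (1 - l) * norm (c - z)" using l by simp
  also have "\<dots> \<le> (1 - l) * \<delta>" using zc l by (intro mult_left_mono) auto
  also have "\<dots> = \<delta> - \<delta>'" using l(3) by (simp add: algebra_simps)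
  finally have "dist c c' + \<delta>' \<le> \<delta>" by (simp add: dist_norm)
  then have "ball c' \<delta>' \<subseteq> ball c \<delta>" by (simp add: ball_subset_ball_iff dist_commute)
  with 1 V show ?thesis by blast
qed

text \<open>
  A Lebesgue number argument.
\<close>

lemma compact_uniform_radius:
  fixes K :: "'b::metric_space set" and Q :: "'b \<Rightarrow> real \<Rightarrow> bool"
  assumes K: "compact K"
    and loc: "\<And>p. p \<in> K \<Longrightarrow> \<exists>\<rho>>0. \<exists>\<delta>>0. \<forall>z\<in>K \<inter> ball p \<rho>. Q z \<delta>"
    and mono: "\<And>z \<delta> \<delta>'. Q z \<delta> \<Longrightarrow> 0 < \<delta>' \<Longrightarrow> \<delta>' \<le> \<delta> \<Longrightarrow> Q z \<delta>'"
  shows "\<exists>\<delta>>0. \<forall>z\<in>K. Q z \<delta>"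
proof -
  have "\<exists>r d. \<forall>p\<in>K. 0 < r p \<and> 0 < d p \<and> (\<forall>z\<in>K \<inter> ball p (r p). Q z (d p))"
    using loc by metis
  then obtain r d where rd: "\<And>p. p \<in> K \<Longrightarrow> 0 < r p" "\<And>p. p \<in> K \<Longrightarrow> (0::real) < d p"
    "\<And>p z. p \<in> K \<Longrightarrow> z \<in> K \<Longrightarrow> z \<in> ball p (r p) \<Longrightarrow> Q z (d p)"
    by blast
  obtain D where D: "D \<subseteq> K" "finite D" "K \<subseteq> (\<Union>p\<in>D. ball p (r p))"
    by (rule compactE_image[OF K, of K "\<lambda>p. ball p (r p)"]) (use rd(1) in auto)
  define \<delta> where "\<delta> = Min (insert 1 (d ` D))"
  have pos: "0 < \<delta>" unfolding \<delta>_def using D rd(2) by (subst Min_gr_iff) auto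
  have "Q z \<delta>" if z: "z \<in> K" for z
  proof -
    obtain p where p: "p \<in> D" "z \<in> ball p (r p)" using D(3) z by auto
    have "\<delta> \<le> d p" unfolding \<delta>_def using D(2) p(1) by (intro Min_le) auto
    then show ?thesis using mono[OF rd(3)[of p z] pos] p z D(1) by blast
  qed
  then show ?thesis using pos by blast
qed

lemma blinfun_inner_representation:
  fixes L :: "'b::euclidean_space \<Rightarrow>\<^sub>L real"
  obtains a where "\<And>y. blinfun_apply L y = y \<bullet> a"
proof
  fix y
  have "blinfun_apply L y = blinfun_apply L (\<Sum>b\<in>Basis. (y \<bullet> b) *\<^sub>R b)" by (simp add: euclidean_representation)
  also have "\<dots> = y \<bullet> (\<Sum>b\<in>Basis. blinfun_apply L b *\<^sub>R b)"
    by (simp add: blinfun.sum_right blinfun.scaleR_right inner_sum_right mult.commute)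
  finally show "blinfun_apply L y = y \<bullet> (\<Sum>b\<in>Basis. blinfun_apply L b *\<^sub>R b)" .
qed

text \<open>
  For use with graphs over the hyperplane orthogonal to \<open>e\<close>, where moving along \<open>e\<close> does not change the base
  point: a ball that reaches a point at any depth \<open>\<tau>\<close> below \<open>q\<close> becomes, moved up by \<open>t\<close>, the ball tangent at
  \<open>q\<close> to the hyperplane orthogonal to \<open>m\<close>. The quadratic inequality is the equation of that ball, weakened by
  means of \<open>norm m \<ge> 1\<close>; it compares directly with a Taylor expansion.
\<close>

lemma shifted_tangent_ball:
  fixes q e m :: "'b::euclidean_space"
  assumes e: "norm e = 1" and m: "m \<bullet> e = 1" and d: "0 < \<delta>" and tau: "0 < \<tau>"
  obtains c where "q - \<tau> *\<^sub>R e \<in> ball c \<delta>"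
    "\<And>y. y \<in> ball c \<delta> \<Longrightarrow> \<exists>t\<ge>0. norm (y + t *\<^sub>R e - q) < 2 * \<delta> \<and> norm (y - (q - \<tau> *\<^sub>R e)) < 3 * \<delta> \<and>
       (y + t *\<^sub>R e - q) \<bullet> m < - (1 / (2 * \<delta>)) * (norm (y + t *\<^sub>R e - q))\<^sup>2"
proof -
  have "1 = \<bar>m \<bullet> e\<bar>" using m by simp
  also have "\<dots> \<le> norm m * norm e" by (rule Cauchy_Schwarz_ineq2)
  finally have m1: "1 \<le> norm m" using e by simp
  then have m0: "0 < norm m" by linarith
  \<comment> \<open>The tangent ball is moved by \<open>\<tau> - \<sigma>\<close>, so that the point lies \<open>\<sigma>\<close> below the moved point \<open>q\<close>; this has to be small enough to be inside the ball.\<close>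
  define \<sigma> where "\<sigma> = min \<tau> (\<delta> / norm m)"
  have sig: "0 < \<sigma>" "\<sigma> \<le> \<tau>" "\<sigma> \<le> \<delta> / norm m" using d tau m0 by (auto simp: \<sigma>_def)
  have sd: "\<sigma> \<le> \<delta>"
  proof -
    have "\<delta> / norm m \<le> \<delta> / 1" using m1 d by (intro divide_left_mono) auto
    then show ?thesis using sig by simp
  qed
  define t where "t = \<tau> - \<sigma>"
  have t: "0 \<le> t" using sig by (simp add: t_def)
  define c0 where "c0 = q - (\<delta> / norm m) *\<^sub>R m"
  define c where "c = c0 - t *\<^sub>R e"
  have c0q: "norm (c0 - q) = \<delta>" using m0 d by (simp add: c0_def)
  have tang: "(z - q) \<bullet> m < - (1 / (2 * \<delta>)) * (norm (z - q))\<^sup>2" if z: "z \<in> ball c0 \<delta>" for z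
  proof -
    have "(norm (z - c0))\<^sup>2 < \<delta>\<^sup>2"
      using z d by (intro power_strict_mono) (auto simp: dist_norm norm_minus_commute)
    moreover have "z - c0 = (z - q) + (\<delta> / norm m) *\<^sub>R m" by (simp add: c0_def)
    moreover have "(norm ((z - q) + (\<delta> / norm m) *\<^sub>R m))\<^sup>2
        = (norm (z - q))\<^sup>2 + 2 * (\<delta> / norm m) * ((z - q) \<bullet> m) + \<delta>\<^sup>2"
    proof -
      have "(\<delta> / norm m)\<^sup>2 * (m \<bullet> m) = \<delta>\<^sup>2" using m0 by (simp add: power2_norm_eq_inner[symmetric] power_divide)
      moreover have "(norm (w + k *\<^sub>R m))\<^sup>2 = (norm w)\<^sup>2 + 2 * k * (w \<bullet> m) + k\<^sup>2 * (m \<bullet> m)" for w k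
        unfolding power2_norm_eq_inner
        by (simp add: inner_add_left inner_add_right inner_commute[of m w] power2_eq_square distrib_left)
      ultimately show ?thesis by simp
    qed
    ultimately have "(norm (z - q))\<^sup>2 < - (2 * (\<delta> / norm m) * ((z - q) \<bullet> m))" by simp
    then have "(norm (z - q))\<^sup>2 * norm m < - (2 * \<delta> * ((z - q) \<bullet> m))"
      using m0 by (simp add: field_simps)
    moreover have "(norm (z - q))\<^sup>2 * 1 \<le> (norm (z - q))\<^sup>2 * norm m" using m1 by (intro mult_left_mono) auto
    ultimately have "(norm (z - q))\<^sup>2 < - (2 * \<delta> * ((z - q) \<bullet> m))" by simp
    then show ?thesis using d by (simp add: field_simps)
  qed
  have close: "norm (z - q) < 2 * \<delta>" if z: "z \<in> ball c0 \<delta>" for z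
  proof -
    have "norm (z - q) \<le> norm (z - c0) + norm (c0 - q)" using norm_triangle_ineq[of "z - c0" "c0 - q"] by simp
    moreover have "norm (z - c0) < \<delta>" using z by (simp add: dist_norm norm_minus_commute)
    ultimately show ?thesis using c0q by simp
  qed
  show thesis
  proof (rule that)
    have "(q - \<tau> *\<^sub>R e) - c = (\<delta> / norm m) *\<^sub>R m - \<sigma> *\<^sub>R e"
      by (simp add: c_def c0_def t_def algebra_simps)
    moreover have "(norm ((\<delta> / norm m) *\<^sub>R m - \<sigma> *\<^sub>R e))\<^sup>2 < \<delta>\<^sup>2"
    proof -
      have "(\<delta> / norm m)\<^sup>2 * (m \<bullet> m) = \<delta>\<^sup>2" using m0 by (simp add: power2_norm_eq_inner[symmetric] power_divide)
      moreover have "e \<bullet> e = 1" using e by (simp add: dot_square_norm)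
      ultimately have "(norm ((\<delta> / norm m) *\<^sub>R m - \<sigma> *\<^sub>R e))\<^sup>2 = \<delta>\<^sup>2 - 2 * \<sigma> * (\<delta> / norm m) + \<sigma>\<^sup>2"
        unfolding power2_norm_eq_inner using m
        by (simp add: inner_diff_left inner_diff_right inner_commute[of e m] power2_eq_square algebra_simps)
      moreover have "\<sigma> * \<sigma> < 2 * (\<sigma> * (\<delta> / norm m))"
      proof -
        define k where "k = \<sigma> * (\<delta> / norm m)"
        have "\<sigma> * \<sigma> \<le> k" unfolding k_def using sig by (intro mult_left_mono) auto
        moreover have "0 < k" unfolding k_def using sig d m0 by simp
        ultimately have "\<sigma> * \<sigma> < 2 * k" by linarith
        then show ?thesis unfolding k_def .
      qed
      ultimately show ?thesis by (simp add: power2_eq_square)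
    qed
    ultimately have "norm ((q - \<tau> *\<^sub>R e) - c) < \<delta>" using d by (simp add: power2_less_imp_less)
    then show "q - \<tau> *\<^sub>R e \<in> ball c \<delta>" by (simp add: dist_norm norm_minus_commute)
    fix y assume "y \<in> ball c \<delta>"
    then have z: "y + t *\<^sub>R e \<in> ball c0 \<delta>" by (simp add: c_def dist_norm algebra_simps)
    have "y - (q - \<tau> *\<^sub>R e) = (y + t *\<^sub>R e - q) + \<sigma> *\<^sub>R e" by (simp add: t_def algebra_simps)
    then have "norm (y - (q - \<tau> *\<^sub>R e)) \<le> norm (y + t *\<^sub>R e - q) + norm (\<sigma> *\<^sub>R e)"
      by (simp only: norm_triangle_ineq)
    then have "norm (y - (q - \<tau> *\<^sub>R e)) < 3 * \<delta>" using close[OF z] sd sig e by simp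
    then show "\<exists>t\<ge>0. norm (y + t *\<^sub>R e - q) < 2 * \<delta> \<and> norm (y - (q - \<tau> *\<^sub>R e)) < 3 * \<delta> \<and>
       (y + t *\<^sub>R e - q) \<bullet> m < - (1 / (2 * \<delta>)) * (norm (y + t *\<^sub>R e - q))\<^sup>2"
      using t close[OF z] tang[OF z] by blast
  qed
qed

lemma C2_derivs_lipschitz_segment:
  fixes f :: "'b::euclidean_space \<Rightarrow> real"
  assumes d: "C2_derivs S f f' f''" and C: "\<And>x. x \<in> S \<Longrightarrow> norm (f'' x) \<le> C"
    and seg: "closed_segment a b \<subseteq> S" and z: "z \<in> closed_segment a b" and w: "w \<in> closed_segment a b"
  shows "norm (f' z - f' w) \<le> C * norm (z - w)"
proof (rule differentiable_bound[where S="closed_segment a b" and f'="\<lambda>x. blinfun_apply (f'' x)"])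
  fix x assume x: "x \<in> closed_segment a b"
  show "(f' has_derivative blinfun_apply (f'' x)) (at x within closed_segment a b)"
    using d x seg unfolding C2_derivs_def by (blast intro: has_derivative_at_withinI)
  show "onorm (blinfun_apply (f'' x)) \<le> C"
    using C[of x] x seg by (auto simp: norm_blinfun.rep_eq)
qed (use z w in auto)

lemma C2_derivs_segment_bound:
  fixes f :: "'b::euclidean_space \<Rightarrow> real"
  assumes d: "C2_derivs S f f' f''" and seg: "closed_segment a b \<subseteq> S"
    and B: "\<And>z. z \<in> closed_segment a b \<Longrightarrow> norm (f' z - L) \<le> B"
  shows "\<bar>f b - f a - blinfun_apply L (b - a)\<bar> \<le> B * norm (b - a)"
proof -
  have "norm ((\<lambda>x. f x - blinfun_apply L x) b - (\<lambda>x. f x - blinfun_apply L x) a) \<le> B * norm (b - a)"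
  proof (rule differentiable_bound[where S="closed_segment a b" and f'="\<lambda>x. blinfun_apply (f' x - L)"])
    fix x assume x: "x \<in> closed_segment a b"
    have "(f has_derivative blinfun_apply (f' x)) (at x within closed_segment a b)"
      using d x seg unfolding C2_derivs_def by (blast intro: has_derivative_at_withinI)
    then have "((\<lambda>x. f x - blinfun_apply L x) has_derivative (\<lambda>y. blinfun_apply (f' x) y - blinfun_apply L y)) (at x within closed_segment a b)"
      by (intro has_derivative_diff bounded_linear_imp_has_derivative blinfun.bounded_linear_right)
    moreover have "blinfun_apply (f' x - L) = (\<lambda>y. blinfun_apply (f' x) y - blinfun_apply L y)"
      by (simp add: fun_eq_iff blinfun.diff_left)
    ultimately show "((\<lambda>x. f x - blinfun_apply L x) has_derivative blinfun_apply (f' x - L)) (at x within closed_segment a b)"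
      by (simp only:)
    show "onorm (blinfun_apply (f' x - L)) \<le> B"
      using B[OF x] by (simp add: norm_blinfun.rep_eq)
  qed auto
  then show ?thesis by (simp add: blinfun.diff_right algebra_simps)
qed

lemma C2_derivs_taylor_segment:
  fixes f :: "'b::euclidean_space \<Rightarrow> real"
  assumes d: "C2_derivs S f f' f''" and C: "\<And>x. x \<in> S \<Longrightarrow> norm (f'' x) \<le> C" "0 \<le> C"
    and seg: "closed_segment a b \<subseteq> S"
  shows "\<bar>f b - f a - blinfun_apply (f' a) (b - a)\<bar> \<le> C * (norm (b - a))\<^sup>2"
proof -
  have "\<bar>f b - f a - blinfun_apply (f' a) (b - a)\<bar> \<le> (C * norm (b - a)) * norm (b - a)"
  proof (rule C2_derivs_segment_bound[OF d seg])
    fix z assume z: "z \<in> closed_segment a b"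
    have "norm (f' z - f' a) \<le> C * norm (z - a)"
      by (rule C2_derivs_lipschitz_segment[OF d C(1) seg z]) auto
    also have "\<dots> \<le> C * norm (b - a)"
      using segment_bound(1)[OF z] C(2) by (intro mult_left_mono) auto
    finally show "norm (f' z - f' a) \<le> C * norm (b - a)" .
  qed
  then show ?thesis by (simp add: power2_eq_square mult.assoc)
qed

text \<open>
  One chart from the definition of a \<open>C\<^sup>2\<close> boundary. The derivatives of the graph function are bounded by
  compactness of the projection of the chart.
\<close>

lemma C2_boundary_chart:
  fixes S :: "'b::euclidean_space set"
  assumes "C2_boundary S" "p \<in> frontier S"
  obtains r e g g' g'' C where "0 < r" "norm e = 1" "C2_derivs UNIV g g' g''" "continuous_on UNIV g" "0 < C"
    "\<And>x. x \<in> ball p r \<Longrightarrow> x \<in> S \<longleftrightarrow> x \<bullet> e < g (x - (x \<bullet> e) *\<^sub>R e)"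
    "\<And>x. x \<in> ball (p - (p \<bullet> e) *\<^sub>R e) r \<Longrightarrow> norm (g' x) \<le> C \<and> norm (g'' x) \<le> C"
proof -
  obtain r e g where r: "0 < r" "norm e = 1" "C2_on UNIV g"
    "S \<inter> ball p r = {x \<in> ball p r. x \<bullet> e < g (x - (x \<bullet> e) *\<^sub>R e)}"
    using assms unfolding C2_boundary_def by blast
  obtain g' g'' where g: "C2_derivs UNIV g g' g''" "continuous_on UNIV g''"
    using r(3) unfolding C2_on_def by blast
  have c: "continuous_on UNIV g" "continuous_on UNIV g'"
    using g(1) unfolding C2_derivs_def by (auto intro!: has_derivative_continuous_on[where f'="\<lambda>x. _ x"] simp: has_derivative_at_withinI)
  let ?K = "cball (p - (p \<bullet> e) *\<^sub>R e) r"
  have "compact (g' ` ?K)" "compact (g'' ` ?K)"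
    by (auto intro!: compact_continuous_image continuous_on_subset[OF c(2)] continuous_on_subset[OF g(2)])
  then have "bounded (g' ` ?K)" "bounded (g'' ` ?K)" by (auto intro: compact_imp_bounded)
  then obtain C1 C2 where C: "\<And>x. x \<in> ?K \<Longrightarrow> norm (g' x) \<le> C1" "\<And>x. x \<in> ?K \<Longrightarrow> norm (g'' x) \<le> C2"
    unfolding bounded_iff by (metis image_eqI)
  show thesis
  proof (rule that[OF r(1,2) g(1) c(1), of "max 1 (max C1 C2)"])
    show "x \<in> S \<longleftrightarrow> x \<bullet> e < g (x - (x \<bullet> e) *\<^sub>R e)" if "x \<in> ball p r" for x
      using r(4) that by blast
    show "norm (g' x) \<le> max 1 (max C1 C2) \<and> norm (g'' x) \<le> max 1 (max C1 C2)" if "x \<in> ball (p - (p \<bullet> e) *\<^sub>R e) r" for x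
      using C[of x] that by (auto simp: max_def)
  qed simp
qed

lemma norm_hyperplane_projection_le:
  fixes e z :: "'b::euclidean_space"
  assumes "norm e = 1"
  shows "norm (z - (z \<bullet> e) *\<^sub>R e) \<le> norm z"
proof -
  have "e \<bullet> e = 1" using assms by (simp add: dot_square_norm)
  then have "(norm (z - (z \<bullet> e) *\<^sub>R e))\<^sup>2 = (norm z)\<^sup>2 - (z \<bullet> e)\<^sup>2"
    unfolding power2_norm_eq_inner by (simp add: inner_diff_left inner_diff_right inner_commute[of e z] power2_eq_square)
  then have "(norm (z - (z \<bullet> e) *\<^sub>R e))\<^sup>2 \<le> (norm z)\<^sup>2" by simp
  then show ?thesis by (rule power2_le_imp_le) simp
qed

lemma hyperplane_projection_diff:
  fixes e :: "'b::euclidean_space"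
  shows "(x - (x \<bullet> e) *\<^sub>R e) - (y - (y \<bullet> e) *\<^sub>R e) = (x - y) - ((x - y) \<bullet> e) *\<^sub>R e"
  by (simp add: inner_diff_left algebra_simps)

lemma hyperplane_projection_shift:
  fixes e :: "'b::euclidean_space"
  assumes "norm e = 1"
  shows "(x + t *\<^sub>R e) - ((x + t *\<^sub>R e) \<bullet> e) *\<^sub>R e = x - (x \<bullet> e) *\<^sub>R e"
  using assms by (simp add: inner_add_left dot_square_norm algebra_simps)

text \<open>
  In a chart, the tangent ball at the boundary point above \<open>z\<close> lies below the graph by Taylor's formula if its
  radius is at most half the inverse of the bound on the second derivative. Moving the ball down keeps it below
  the graph and makes it reach \<open>z\<close>.
\<close>

lemma C2_boundary_uniform_balls:
  fixes S K :: "'b::euclidean_space set"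
  assumes bd: "C2_boundary S" and op: "open S" and K: "compact K"
  shows "\<exists>\<delta>>0. \<forall>z\<in>S \<inter> K. \<exists>c. z \<in> ball c \<delta> \<and> ball c \<delta> \<subseteq> S"
proof -
  have "\<exists>\<delta>>0. \<forall>z\<in>K. z \<in> S \<longrightarrow> (\<exists>c. z \<in> ball c \<delta> \<and> ball c \<delta> \<subseteq> S)"
  proof (rule compact_uniform_radius[OF K])
    fix z and \<delta> \<delta>' :: real assume "z \<in> S \<longrightarrow> (\<exists>c. z \<in> ball c \<delta> \<and> ball c \<delta> \<subseteq> S)" "0 < \<delta>'" "\<delta>' \<le> \<delta>"
    then show "z \<in> S \<longrightarrow> (\<exists>c. z \<in> ball c \<delta>' \<and> ball c \<delta>' \<subseteq> S)"
      using ball_subset_smaller_radius by blast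
  next
    fix p assume "p \<in> K"
    consider "p \<in> S" | "p \<notin> closure S" | "p \<in> frontier S"
      using op by (auto simp: frontier_def interior_open)
    then show "\<exists>\<rho>>0. \<exists>\<delta>>0. \<forall>z\<in>K \<inter> ball p \<rho>. z \<in> S \<longrightarrow> (\<exists>c. z \<in> ball c \<delta> \<and> ball c \<delta> \<subseteq> S)"
    proof cases
      case 1
      then obtain r where r: "0 < r" "ball p r \<subseteq> S" using op openE by blast
      then show ?thesis by blast
    next
      case 2
      then have "p \<in> - closure S" by simp
      then obtain r where r: "0 < r" "ball p r \<subseteq> - closure S" using openE[of "- closure S" p] by blast
      then have "ball p r \<inter> S = {}" using closure_subset by blast
      then show ?thesis using r(1) by (intro exI[of _ r]) (auto intro: exI[of _ 1])
    next
      case 3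
      obtain r e g g' g'' C where r: "0 < r" and e: "norm e = 1" and g: "C2_derivs UNIV g g' g''" and C0: "0 < C"
        and S: "\<And>x. x \<in> ball p r \<Longrightarrow> x \<in> S \<longleftrightarrow> x \<bullet> e < g (x - (x \<bullet> e) *\<^sub>R e)"
        and C: "\<And>x. x \<in> ball (p - (p \<bullet> e) *\<^sub>R e) r \<Longrightarrow> norm (g' x) \<le> C \<and> norm (g'' x) \<le> C"
        using C2_boundary_chart[OF bd 3] by metis
      define P where "P x = x - (x \<bullet> e) *\<^sub>R e" for x
      have ee: "e \<bullet> e = 1" using e by (simp add: dot_square_norm)
      have Pball: "P x \<in> ball (P p) r" if "x \<in> ball p r" for x
        using that norm_hyperplane_projection_le[OF e, of "p - x"]
        unfolding P_def by (simp add: dist_norm hyperplane_projection_diff)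
      define \<delta> where "\<delta> = min (r / 6) (1 / (2 * C))"
      have d: "0 < \<delta>" "6 * \<delta> \<le> r" "C \<le> 1 / (2 * \<delta>)"
      proof -
        show "0 < \<delta>" "6 * \<delta> \<le> r" using r C0 by (auto simp: \<delta>_def)
        have "\<delta> \<le> 1 / (2 * C)" by (simp add: \<delta>_def)
        then show "C \<le> 1 / (2 * \<delta>)" using \<open>0 < \<delta>\<close> C0 by (simp add: field_simps)
      qed
      have "\<exists>c. z \<in> ball c \<delta> \<and> ball c \<delta> \<subseteq> S" if z: "z \<in> ball p (r / 2)" "z \<in> S" for z
      proof -
        have zr: "z \<in> ball p r" using z(1) r by auto
        define \<tau> where "\<tau> = g (P z) - z \<bullet> e"
        have tau: "0 < \<tau>" using S[OF zr] z(2) by (simp add: \<tau>_def P_def)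
        define q where "q = z + \<tau> *\<^sub>R e"
        have Pq: "P q = P z" unfolding P_def q_def by (rule hyperplane_projection_shift[OF e])
        have qe: "q \<bullet> e = g (P z)" by (simp add: q_def \<tau>_def inner_add_left ee)
        obtain a where a: "\<And>y. blinfun_apply (g' (P z)) y = y \<bullet> a"
          using blinfun_inner_representation[of "g' (P z)"] by blast
        define m where "m = e - P a"
        have Pe: "P a \<bullet> e = 0" by (simp add: P_def inner_diff_left ee)
        have me: "m \<bullet> e = 1" by (simp add: m_def inner_diff_left ee Pe)
        have ym: "y \<bullet> m = y \<bullet> e - blinfun_apply (g' (P z)) (P y)" for y
          unfolding m_def a by (simp add: P_def inner_diff_left inner_diff_right inner_commute)
        obtain c where c1: "q - \<tau> *\<^sub>R e \<in> ball c \<delta>"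
          and c2: "\<And>y. y \<in> ball c \<delta> \<Longrightarrow> \<exists>t\<ge>0. norm (y + t *\<^sub>R e - q) < 2 * \<delta> \<and> norm (y - (q - \<tau> *\<^sub>R e)) < 3 * \<delta> \<and>
             (y + t *\<^sub>R e - q) \<bullet> m < - (1 / (2 * \<delta>)) * (norm (y + t *\<^sub>R e - q))\<^sup>2"
          using shifted_tangent_ball[OF e me d(1) tau, of q] by blast
        have qz: "q - \<tau> *\<^sub>R e = z" by (simp add: q_def)
        have "ball c \<delta> \<subseteq> S"
        proof
          fix y assume "y \<in> ball c \<delta>"
          then obtain t where t: "0 \<le> t" "norm (y - z) < 3 * \<delta>"
            "(y + t *\<^sub>R e - q) \<bullet> m < - (1 / (2 * \<delta>)) * (norm (y + t *\<^sub>R e - q))\<^sup>2"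
            using c2 unfolding qz by blast
          have yr: "y \<in> ball p r"
          proof -
            have "dist p y \<le> dist p z + norm (y - z)" using dist_triangle[of p y z] by (simp add: dist_norm norm_minus_commute)
            then show ?thesis using z(1) t(2) d(2) by simp
          qed
          let ?h = "P y - P z"
          have Ph: "P (y + t *\<^sub>R e - q) = ?h"
            unfolding P_def by (simp add: q_def inner_add_left inner_diff_left ee algebra_simps)
          have hle: "norm ?h \<le> norm (y + t *\<^sub>R e - q)"
            using norm_hyperplane_projection_le[OF e, of "y + t *\<^sub>R e - q"] Ph unfolding P_def by simp
          have seg: "closed_segment (P z) (P y) \<subseteq> ball (P p) r"
            using Pball[OF zr] Pball[OF yr] by (intro closed_segment_subset convex_ball)
          have gd: "C2_derivs (ball (P p) r) g g' g''" using g by (simp add: C2_derivs_def)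
          have "\<bar>g (P y) - g (P z) - blinfun_apply (g' (P z)) ?h\<bar> \<le> C * (norm ?h)\<^sup>2"
            by (rule C2_derivs_taylor_segment[OF gd _ _ seg]) (use C C0 in \<open>auto simp: P_def\<close>)
          also have "\<dots> \<le> 1 / (2 * \<delta>) * (norm (y + t *\<^sub>R e - q))\<^sup>2"
            using hle d C0 by (intro mult_mono power_mono) auto
          finally have "g (P z) + blinfun_apply (g' (P z)) ?h - 1 / (2 * \<delta>) * (norm (y + t *\<^sub>R e - q))\<^sup>2 \<le> g (P y)" by simp
          moreover have "(y + t *\<^sub>R e - q) \<bullet> m = y \<bullet> e + t - g (P z) - blinfun_apply (g' (P z)) ?h"
            unfolding ym Ph by (simp add: inner_add_left inner_diff_left ee qe)
          ultimately have "y \<bullet> e < g (P y)" using t(1,3) by simp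
          then show "y \<in> S" using S[OF yr] by (simp add: P_def)
        qed
        then show ?thesis using c1 unfolding qz by blast
      qed
      then show ?thesis using r d(1) by (intro exI[of _ "r / 2"] conjI exI[of _ \<delta>]) auto
    qed
  qed
  then show ?thesis by blast
qed

text \<open>
  Points on the graph are limits of points pushed down in the direction \<open>- e\<close>.
\<close>

lemma C2_boundary_closure_chart:
  fixes S :: "'b::euclidean_space set"
  assumes r: "0 < r" and e: "norm e = 1" and g: "continuous_on UNIV g"
    and S: "\<And>x. x \<in> ball p r \<Longrightarrow> x \<in> S \<longleftrightarrow> x \<bullet> e < g (x - (x \<bullet> e) *\<^sub>R e)" and x: "x \<in> ball p r"
  shows "x \<in> closure S \<longleftrightarrow> x \<bullet> e \<le> g (x - (x \<bullet> e) *\<^sub>R e)"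
proof
  assume xc: "x \<in> closure S"
  have "x \<in> closure (ball p r \<inter> S)" using open_Int_closure_subset[OF open_ball] x xc by blast
  also have "\<dots> \<subseteq> closure {x. x \<bullet> e \<le> g (x - (x \<bullet> e) *\<^sub>R e)}"
    using S by (intro closure_mono) auto
  also have "\<dots> = {x. x \<bullet> e \<le> g (x - (x \<bullet> e) *\<^sub>R e)}"
    by (intro closure_closed closed_Collect_le continuous_intros continuous_on_compose2[OF g]) auto
  finally show "x \<bullet> e \<le> g (x - (x \<bullet> e) *\<^sub>R e)" by simp
next
  assume le: "x \<bullet> e \<le> g (x - (x \<bullet> e) *\<^sub>R e)"
  show "x \<in> closure S"
    unfolding closure_approachable
  proof (intro allI impI)
    fix \<epsilon> :: real assume eps: "0 < \<epsilon>"
    define t where "t = min \<epsilon> (r - dist p x) / 2"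
    have t: "0 < t" "t < \<epsilon>" "t < r - dist p x" using eps x by (auto simp: t_def min_def)
    let ?y = "x + (- t) *\<^sub>R e"
    have dy: "dist ?y x = t" using e t by (simp add: dist_norm)
    have "dist p ?y \<le> dist p x + t" using dist_triangle[of p ?y x] dy by (simp add: dist_commute)
    then have yb: "?y \<in> ball p r" using t by simp
    have "?y \<bullet> e < g (?y - (?y \<bullet> e) *\<^sub>R e)"
      unfolding hyperplane_projection_shift[OF e] using le t e by (simp add: inner_diff_left dot_square_norm)
    then have "?y \<in> S" using S[OF yb] by simp
    then show "\<exists>y\<in>S. dist y x < \<epsilon>" by (rule bexI[rotated]) (use dy t in simp)
  qed
qed

text \<open>
  The two boundaries are disjoint, and at the boundary of \<open>A\<close> the complement of the closure is described by the
  same chart turned upside down.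
\<close>

lemma C2_boundary_Diff_closure:
  fixes \<Omega> A :: "'b::euclidean_space set"
  assumes Om: "C2_boundary \<Omega>" "open \<Omega>" and A: "C2_boundary A" "open A" "closure A \<subseteq> \<Omega>"
  shows "C2_boundary (\<Omega> - closure A)"
  unfolding C2_boundary_def
proof
  fix p assume p: "p \<in> frontier (\<Omega> - closure A)"
  have "frontier (\<Omega> \<inter> - closure A) \<subseteq> frontier \<Omega> \<union> frontier (- closure A)" by (rule frontier_Int_subset)
  moreover have "frontier (closure A) \<subseteq> frontier A"
    using interior_mono[OF closure_subset[of A]] by (auto simp: frontier_def)
  then have "frontier (- closure A) \<subseteq> frontier A" by (simp only: frontier_complement)
  ultimately have "p \<in> frontier \<Omega> \<or> p \<in> frontier A" using p by (auto simp: Diff_eq)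
  then show "\<exists>r>0. \<exists>e g. norm e = 1 \<and> C2_on UNIV g \<and>
       (\<Omega> - closure A) \<inter> ball p r = {x \<in> ball p r. x \<bullet> e < g (x - (x \<bullet> e) *\<^sub>R e)}"
  proof
    assume pO: "p \<in> frontier \<Omega>"
    then have "p \<notin> \<Omega>" using Om(2) by (simp add: frontier_def interior_open)
    then have "p \<in> - closure A" using A(3) by blast
    then obtain r0 where r0: "0 < r0" "ball p r0 \<subseteq> - closure A" using openE[of "- closure A" p] by blast
    obtain r e g where r: "0 < r" "norm e = 1" "C2_on UNIV g"
      "\<Omega> \<inter> ball p r = {x \<in> ball p r. x \<bullet> e < g (x - (x \<bullet> e) *\<^sub>R e)}"
      using Om(1) pO unfolding C2_boundary_def by blast
    have "(\<Omega> - closure A) \<inter> ball p (min r r0) = {x \<in> ball p (min r r0). x \<bullet> e < g (x - (x \<bullet> e) *\<^sub>R e)}"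
    proof -
      have "x \<in> \<Omega> - closure A \<longleftrightarrow> x \<bullet> e < g (x - (x \<bullet> e) *\<^sub>R e)" if x: "x \<in> ball p (min r r0)" for x
      proof -
        have "x \<in> ball p r" "x \<notin> closure A" using x r0(2) by auto
        then show ?thesis using r(4) by blast
      qed
      then show ?thesis by blast
    qed
    then show ?thesis using r r0 by (intro exI[of _ "min r r0"] conjI exI[of _ e] exI[of _ g]) auto
  next
    assume pA: "p \<in> frontier A"
    then have "p \<in> \<Omega>" using A(3) by (auto simp: frontier_def)
    then obtain r0 where r0: "0 < r0" "ball p r0 \<subseteq> \<Omega>" using Om(2) openE by blast
    obtain r1 e1 g1 where r1: "0 < r1" "norm e1 = 1" "C2_on UNIV g1"
      "A \<inter> ball p r1 = {x \<in> ball p r1. x \<bullet> e1 < g1 (x - (x \<bullet> e1) *\<^sub>R e1)}"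
      using A(1) pA unfolding C2_boundary_def by blast
    obtain h' h'' where h: "C2_derivs UNIV g1 h' h''" "continuous_on UNIV h''"
      using r1(3) unfolding C2_on_def by blast
    have g1c: "continuous_on UNIV g1"
      using h(1) unfolding C2_derivs_def by (meson UNIV_I has_derivative_continuous continuous_at_imp_continuous_on)
    have neg: "C2_on UNIV (\<lambda>x. - g1 x)"
      unfolding C2_on_def
    proof (intro exI conjI)
      show "C2_derivs UNIV (\<lambda>x. - g1 x) (\<lambda>x. - h' x) (\<lambda>x. - h'' x)"
        using h(1) unfolding C2_derivs_def
        by (auto simp: uminus_blinfun.rep_eq intro!: has_derivative_minus)
      show "continuous_on UNIV (\<lambda>x. - h'' x)" using h(2) by (intro continuous_intros)
    qed
    have "(\<Omega> - closure A) \<inter> ball p (min r1 r0) = {x \<in> ball p (min r1 r0). x \<bullet> (- e1) < - g1 (x - (x \<bullet> (- e1)) *\<^sub>R (- e1))}"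
    proof -
      have "x \<in> \<Omega> - closure A \<longleftrightarrow> x \<bullet> (- e1) < - g1 (x - (x \<bullet> (- e1)) *\<^sub>R (- e1))" if x: "x \<in> ball p (min r1 r0)" for x
      proof -
        have x1: "x \<in> ball p r1" "x \<in> \<Omega>" using x r0(2) by auto
        have "x \<in> closure A \<longleftrightarrow> x \<bullet> e1 \<le> g1 (x - (x \<bullet> e1) *\<^sub>R e1)"
          by (rule C2_boundary_closure_chart[OF r1(1,2) g1c _ x1(1)]) (use r1(4) in blast)
        then show ?thesis using x1 by auto
      qed
      then show ?thesis by blast
    qed
    then show ?thesis using r0 r1(1,2) neg by (intro exI[of _ "min r1 r0"] conjI exI[of _ "- e1"] exI[of _ "\<lambda>x. - g1 x"]) auto
  qed
qed

section \<open>Null boundaries\<close>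

text \<open>
  Translates of a graph in the direction of \<open>e\<close> are disjoint, and arbitrarily many of them fit into a fixed
  ball.
\<close>

lemma graph_piece_null:
  fixes e p :: "'b::euclidean_space"
  assumes e: "norm e = 1" and g: "continuous_on UNIV g"
  shows "{x \<in> cball p r. x \<bullet> e = g (x - (x \<bullet> e) *\<^sub>R e)} \<in> null_sets lborel" (is "?S \<in> _")
proof -
  have S: "?S \<in> sets borel"
    unfolding Collect_conj_eq Collect_mem_eq
    by (intro sets.Int borel_closed closed_Collect_eq continuous_intros continuous_on_compose2[OF g]) auto
  have "of_nat m * emeasure lborel ?S \<le> emeasure lborel (cball p (r + 1))" for m
  proof -
    have "of_nat (card {..<m}) * emeasure lborel ?S \<le> emeasure lborel (cball p (r + 1))"
    proof (rule packing_translates[OF S, where t="\<lambda>j. (real j / real m) *\<^sub>R e"])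
      show "norm ((real j / real m) *\<^sub>R e) \<le> 1" if "j \<in> {..<m}" for j
        using that e by auto
      fix i j x y assume ij: "i \<in> {..<m}" "j \<in> {..<m}" "i \<noteq> j" and x: "x \<in> ?S" and y: "y \<in> ?S"
      show "x + (real i / real m) *\<^sub>R e \<noteq> y + (real j / real m) *\<^sub>R e"
      proof
        assume eq: "x + (real i / real m) *\<^sub>R e = y + (real j / real m) *\<^sub>R e"
        then have "x - (x \<bullet> e) *\<^sub>R e = y - (y \<bullet> e) *\<^sub>R e"
          using hyperplane_projection_shift[OF e, of x "real i / real m"] hyperplane_projection_shift[OF e, of y "real j / real m"]
          by simp
        then have "x \<bullet> e = y \<bullet> e" using x y by auto
        moreover have "(x + (real i / real m) *\<^sub>R e) \<bullet> e = (y + (real j / real m) *\<^sub>R e) \<bullet> e" using eq by simp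
        ultimately have "real i / real m = real j / real m"
          using e by (simp add: inner_add_left dot_square_norm)
        then show False using ij by simp
      qed
    qed auto
    then show ?thesis by simp
  qed
  note bound = this
  have fin: "emeasure lborel (cball p (r + 1)) < \<infinity>" using emeasure_bounded_finite[OF bounded_cball] by simp
  have "emeasure lborel ?S < \<infinity>" using bound[of 1] fin by (simp add: order_le_less_trans)
  then obtain a where a: "emeasure lborel ?S = ennreal a" "0 \<le> a" by (cases "emeasure lborel ?S") auto
  obtain V where V: "emeasure lborel (cball p (r + 1)) = ennreal V" "0 \<le> V" using fin by (cases "emeasure lborel (cball p (r + 1))") auto
  have "a \<le> 0"
  proof (rule ccontr)
    assume "\<not> a \<le> 0"
    then obtain m where m: "V < of_nat m * a" using reals_Archimedean3[of a] by auto
    have "ennreal (of_nat m * a) \<le> ennreal V"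
      using bound[of m] a V by (simp add: ennreal_mult' ennreal_of_nat_eq_real_of_nat)
    then show False using m V(2) by (simp add: ennreal_le_iff)
  qed
  then show ?thesis using a S by (simp add: null_sets_def)
qed

lemma C2_boundary_frontier_null:
  fixes A :: "'b::euclidean_space set"
  assumes bd: "C2_boundary A" and op: "open A" and bounded: "bounded A"
  shows "frontier A \<in> null_sets lborel"
proof -
  have loc: "\<exists>r>0. frontier A \<inter> ball p r \<in> null_sets lborel" if p: "p \<in> frontier A" for p
  proof -
    obtain r e g g' g'' C where r: "0 < r" and e: "norm e = 1" and g: "continuous_on UNIV g"
      and S: "\<And>x. x \<in> ball p r \<Longrightarrow> x \<in> A \<longleftrightarrow> x \<bullet> e < g (x - (x \<bullet> e) *\<^sub>R e)"
      using C2_boundary_chart[OF bd p] by metis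
    have "frontier A \<inter> ball p r \<subseteq> {x \<in> cball p r. x \<bullet> e = g (x - (x \<bullet> e) *\<^sub>R e)}"
    proof
      fix x assume x: "x \<in> frontier A \<inter> ball p r"
      then have "x \<notin> A" "x \<in> closure A" using op by (auto simp: frontier_def interior_open)
      moreover have "x \<in> closure A \<longleftrightarrow> x \<bullet> e \<le> g (x - (x \<bullet> e) *\<^sub>R e)"
        by (rule C2_boundary_closure_chart[OF r e g]) (use S x in auto)
      ultimately show "x \<in> {x \<in> cball p r. x \<bullet> e = g (x - (x \<bullet> e) *\<^sub>R e)}"
        using x S[of x] by auto
    qed
    then have "frontier A \<inter> ball p r \<in> null_sets lborel"
      by (rule null_sets_subset[OF graph_piece_null[OF e g], rotated]) (simp add: frontier_def)
    then show ?thesis using r by blast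
  qed
  then obtain r where r: "\<And>p. p \<in> frontier A \<Longrightarrow> 0 < r p \<and> frontier A \<inter> ball p (r p) \<in> null_sets lborel"
    by metis
  have "compact (frontier A)" using bounded by (rule compact_frontier_bounded)
  then obtain D where D: "D \<subseteq> frontier A" "finite D" "frontier A \<subseteq> (\<Union>p\<in>D. ball p (r p))"
    by (rule compactE_image[of "frontier A" "frontier A" "\<lambda>p. ball p (r p)"]) (use r in auto)
  have "(\<Union>p\<in>D. frontier A \<inter> ball p (r p)) \<in> null_sets lborel"
    using D r by (intro null_sets_UN') (auto intro: countable_finite)
  moreover have "(\<Union>p\<in>D. frontier A \<inter> ball p (r p)) = frontier A" using D(3) by auto
  ultimately show ?thesis by simp
qed

section \<open>Balls above the obstacle\<close>

text \<open>
  Taylor's formula up to the boundary. The segment between two nearby points of \<open>A\<close> may leave \<open>A\<close>; it is replaced by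
  a path of three segments that goes down in a chart, across, and up again, and whose length is
  comparable to the distance of the points.
\<close>

lemma C2_on_closure_quadratic_bound:
  fixes A :: "'b::euclidean_space set"
  assumes bd: "C2_boundary A" and op: "open A" and bounded: "bounded A"
    and psi: "C2_derivs A \<psi> \<psi>' \<psi>''" and cont: "continuous_on (closure A) \<psi>''"
  shows "\<exists>\<delta>>0. \<forall>x\<in>A. \<forall>y\<in>A. norm (y - x) < \<delta> \<longrightarrow>
    \<psi> y \<le> \<psi> x + blinfun_apply (\<psi>' x) (y - x) + 1 / \<delta> * (norm (y - x))\<^sup>2"
proof -
  have K: "compact (closure A)" using bounded by (simp add: compact_closure)
  have "bounded (\<psi>'' ` closure A)"
    by (intro compact_imp_bounded compact_continuous_image cont K)
  then obtain B0 where "\<And>x. x \<in> closure A \<Longrightarrow> norm (\<psi>'' x) \<le> B0" unfolding bounded_iff by blast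
  then have "\<And>x. x \<in> A \<Longrightarrow> norm (\<psi>'' x) \<le> max 1 B0" using closure_subset by (fastforce simp: max_def)
  then obtain B where B: "\<And>x. x \<in> A \<Longrightarrow> norm (\<psi>'' x) \<le> B" "0 < B"
    by (metis less_max_iff_disj zero_less_one)
  note lip = C2_derivs_lipschitz_segment[OF psi B(1)]
  let ?T = "\<lambda>x y. \<psi> y - \<psi> x - blinfun_apply (\<psi>' x) (y - x)"
  have "\<exists>\<delta>>0. \<forall>x\<in>closure A. x \<in> A \<longrightarrow> (\<forall>y\<in>A. norm (y - x) < \<delta> \<longrightarrow> ?T x y \<le> 1 / \<delta> * (norm (y - x))\<^sup>2)"
  proof (rule compact_uniform_radius[OF K])
    fix x and \<delta> \<delta>' :: real
    assume Q: "x \<in> A \<longrightarrow> (\<forall>y\<in>A. norm (y - x) < \<delta> \<longrightarrow> ?T x y \<le> 1 / \<delta> * (norm (y - x))\<^sup>2)" and d: "0 < \<delta>'" "\<delta>' \<le> \<delta>"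
    show "x \<in> A \<longrightarrow> (\<forall>y\<in>A. norm (y - x) < \<delta>' \<longrightarrow> ?T x y \<le> 1 / \<delta>' * (norm (y - x))\<^sup>2)"
    proof (intro impI ballI)
      fix y assume "x \<in> A" "y \<in> A" "norm (y - x) < \<delta>'"
      then have "?T x y \<le> 1 / \<delta> * (norm (y - x))\<^sup>2" using Q d by auto
      also have "\<dots> \<le> 1 / \<delta>' * (norm (y - x))\<^sup>2"
        using d by (intro mult_right_mono divide_left_mono) auto
      finally show "?T x y \<le> 1 / \<delta>' * (norm (y - x))\<^sup>2" .
    qed
  next
    fix p assume p: "p \<in> closure A"
    have "\<exists>\<rho>>0. \<exists>C>0. \<forall>x\<in>A \<inter> ball p \<rho>. \<forall>y\<in>A \<inter> ball p \<rho>. ?T x y \<le> C * (norm (y - x))\<^sup>2"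
    proof (cases "p \<in> A")
      case True
      then obtain \<rho> where rho: "0 < \<rho>" "ball p \<rho> \<subseteq> A" using op openE by blast
      have "?T x y \<le> B * (norm (y - x))\<^sup>2" if "x \<in> ball p \<rho>" "y \<in> ball p \<rho>" for x y
      proof -
        have "closed_segment x y \<subseteq> A" using closed_segment_subset[OF that convex_ball] rho(2) by blast
        from C2_derivs_taylor_segment[OF psi B(1) _ this] show ?thesis using B(2) by simp
      qed
      then show ?thesis using rho(1) B(2) by blast
    next
      case False
      then have "p \<in> frontier A" using p op by (simp add: frontier_def interior_open)
      then obtain r e g g' g'' C where r: "0 < r" and e: "norm e = 1" and g: "C2_derivs UNIV g g' g''" and C0: "0 < C"
        and S: "\<And>x. x \<in> ball p r \<Longrightarrow> x \<in> A \<longleftrightarrow> x \<bullet> e < g (x - (x \<bullet> e) *\<^sub>R e)"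
        and C: "\<And>x. x \<in> ball (p - (p \<bullet> e) *\<^sub>R e) r \<Longrightarrow> norm (g' x) \<le> C \<and> norm (g'' x) \<le> C"
        using C2_boundary_chart[OF bd] by metis
      define P where "P x = x - (x \<bullet> e) *\<^sub>R e" for x
      have ee: "e \<bullet> e = 1" using e by (simp add: dot_square_norm)
      have Pdiff: "norm (P x - P y) \<le> norm (x - y)" for x y
        unfolding P_def hyperplane_projection_diff by (rule norm_hyperplane_projection_le[OF e])
      have Pball: "P x \<in> ball (P p) r" if "x \<in> ball p r" for x
        using that Pdiff[of p x] by (simp add: dist_norm)
      have Pshift: "P (x + t *\<^sub>R e) = P x" for x t unfolding P_def by (rule hyperplane_projection_shift[OF e])
      have glip: "\<bar>g a - g b\<bar> \<le> C * norm (a - b)" if "a \<in> ball (P p) r" "b \<in> ball (P p) r" for a b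
      proof -
        have "norm (g a - g b) \<le> C * norm (a - b)"
        proof (rule differentiable_bound[where S="ball (P p) r" and f'="\<lambda>x. blinfun_apply (g' x)"])
          fix x assume x: "x \<in> ball (P p) r"
          show "(g has_derivative blinfun_apply (g' x)) (at x within ball (P p) r)"
            using g unfolding C2_derivs_def by (blast intro: has_derivative_at_withinI)
          show "onorm (blinfun_apply (g' x)) \<le> C" using C[of x] x by (simp add: P_def norm_blinfun.rep_eq)
        qed (use that in auto)
        then show ?thesis by simp
      qed
      define \<rho> where "\<rho> = r / (2 * C + 3)"
      have rho: "0 < \<rho>" "\<rho> + 2 * (C + 1) * \<rho> = r"
      proof -
        show "0 < \<rho>" using r C0 by (simp add: \<rho>_def)
        have "\<rho> * (2 * C + 3) = r" using C0 by (simp add: \<rho>_def)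
        then show "\<rho> + 2 * (C + 1) * \<rho> = r" by (simp add: algebra_simps)
      qed
      define l where "l = 2 * C + 3"
      have "?T x y \<le> (B * l\<^sup>2) * (norm (y - x))\<^sup>2" if x: "x \<in> A \<inter> ball p \<rho>" and y: "y \<in> A \<inter> ball p \<rho>" for x y
      proof -
        define d where "d = norm (y - x)"
        \<comment> \<open>Deep enough to pass below the graph, whose slope is at most \<open>C\<close>.\<close>
        define h where "h = (C + 1) * d"
        have d0: "0 \<le> d" by (simp add: d_def)
        have h0: "0 \<le> h" using C0 d0 by (simp add: h_def)
        have d2: "d \<le> 2 * \<rho>"
        proof -
          have "dist y x \<le> dist y p + dist p x" by (rule dist_triangle)
          also have "\<dots> \<le> 2 * \<rho>" using x y by (simp add: dist_commute)
          finally show ?thesis by (simp add: d_def dist_norm)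
        qed
        have h2: "\<rho> + h \<le> r"
        proof -
          have "(C + 1) * d \<le> (C + 1) * (2 * \<rho>)" using d2 C0 by (intro mult_left_mono) auto
          then show ?thesis using rho(2) by (simp add: h_def mult_ac)
        qed
        have low: "z + (- t) *\<^sub>R e \<in> ball p r" if "z \<in> ball p \<rho>" "0 \<le> t" "t \<le> h" for z t
        proof -
          have "dist p (z + (- t) *\<^sub>R e) \<le> dist p z + dist z (z + (- t) *\<^sub>R e)" by (rule dist_triangle)
          also have "dist z (z + (- t) *\<^sub>R e) = t" using that e by (simp add: dist_norm)
          finally show ?thesis using that h2 by simp
        qed
        have down: "closed_segment z (z + (- h) *\<^sub>R e) \<subseteq> A" if z: "z \<in> A \<inter> ball p \<rho>" for z
        proof
          fix w assume "w \<in> closed_segment z (z + (- h) *\<^sub>R e)"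
          then obtain v where v: "0 \<le> v" "v \<le> 1" "w = (1 - v) *\<^sub>R z + v *\<^sub>R (z + (- h) *\<^sub>R e)"
            unfolding in_segment by blast
          have w: "w = z + (- (v * h)) *\<^sub>R e" unfolding v(3) by (simp add: algebra_simps)
          have vh: "0 \<le> v * h" "v * h \<le> h" using v h0 by (auto intro: mult_left_le_one_le)
          have wb: "w \<in> ball p r" unfolding w using z vh by (intro low) auto
          have zb: "z \<in> ball p r" using low[of z 0] z h0 by simp
          have "w \<bullet> e = z \<bullet> e - v * h" unfolding w by (simp add: inner_diff_left ee)
          moreover have "z \<bullet> e < g (P z)" using S[OF zb] z by (simp add: P_def)
          moreover have "P w = P z" unfolding w by (rule Pshift)
          ultimately have "w \<bullet> e < g (P w)" using vh by simp
          then show "w \<in> A" using S[OF wb] by (simp add: P_def)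
        qed
        let ?x1 = "x + (- h) *\<^sub>R e" and ?y1 = "y + (- h) *\<^sub>R e"
        have across: "closed_segment ?x1 ?y1 \<subseteq> A"
        proof
          fix w assume "w \<in> closed_segment ?x1 ?y1"
          then obtain v where v: "0 \<le> v" "v \<le> 1" "w = (1 - v) *\<^sub>R ?x1 + v *\<^sub>R ?y1"
            unfolding in_segment by blast
          define z where "z = (1 - v) *\<^sub>R x + v *\<^sub>R y"
          have w: "w = z + (- h) *\<^sub>R e" unfolding v(3) z_def by (simp add: algebra_simps)
          have "z \<in> closed_segment x y" unfolding in_segment z_def using v by blast
          then have zb: "z \<in> ball p \<rho>" using closed_segment_subset[OF _ _ convex_ball, of x p \<rho> y] x y by blast
          have wb: "w \<in> ball p r" unfolding w using zb h0 by (intro low) auto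
          have xb: "x \<in> ball p r" "z \<in> ball p r" using low[of x 0] low[of z 0] x zb h0 by simp_all
          have zx: "z - x = v *\<^sub>R (y - x)" unfolding z_def by (simp add: algebra_simps)
          have nzx: "norm (z - x) \<le> d" unfolding zx d_def using v by (simp add: mult_left_le_one_le)
          have "(z - x) \<bullet> e \<le> norm (z - x) * norm e" by (rule norm_cauchy_schwarz)
          then have "z \<bullet> e \<le> x \<bullet> e + d" using nzx e by (simp add: inner_diff_left)
          then have "w \<bullet> e \<le> x \<bullet> e + d - h" unfolding w by (simp add: inner_diff_left ee)
          moreover have "x \<bullet> e < g (P x)" using S[OF xb(1)] x by (simp add: P_def)
          moreover have "g (P x) - g (P z) \<le> C * d"
          proof -
            have "\<bar>g (P x) - g (P z)\<bar> \<le> C * norm (P x - P z)" by (rule glip) (use Pball xb in auto)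
            also have "\<dots> \<le> C * d"
              using Pdiff[of x z] nzx C0 by (intro mult_left_mono) (auto simp: norm_minus_commute)
            finally show ?thesis by simp
          qed
          moreover have "P w = P z" unfolding w by (rule Pshift)
          ultimately have "w \<bullet> e < g (P w)" by (simp add: h_def algebra_simps)
          then show "w \<in> A" using S[OF wb] by (simp add: P_def)
        qed
        have n1: "norm (?x1 - x) = h" "norm (?y1 - ?x1) = d" "norm (y - ?y1) = h"
          using e h0 by (simp_all add: d_def)
        have ld: "h + d + h = l * d" by (simp add: h_def l_def algebra_simps)
        have segl: "norm (z - a) \<le> norm (b - a)" if "z \<in> closed_segment a b" for z a b :: 'b
          using segment_bound(1)[OF that] by simp
        \<comment> \<open>The derivative varies along the path by at most \<open>B\<close> times the length covered so far.\<close>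
        have e1: "norm (\<psi>' z - \<psi>' x) \<le> B * h" if z: "z \<in> closed_segment x ?x1" for z
        proof -
          have "norm (\<psi>' z - \<psi>' x) \<le> B * norm (z - x)" by (rule lip[OF _ down z]) (use x in auto)
          also have "\<dots> \<le> B * h" using segl[OF z] n1 B(2) by (intro mult_left_mono) auto
          finally show ?thesis .
        qed
        have e2: "norm (\<psi>' z - \<psi>' x) \<le> B * (h + d)" if z: "z \<in> closed_segment ?x1 ?y1" for z
        proof -
          have "norm (\<psi>' z - \<psi>' ?x1) \<le> B * norm (z - ?x1)" by (rule lip[OF _ across z]) auto
          also have "\<dots> \<le> B * d" using segl[OF z] n1 B(2) by (intro mult_left_mono) auto
          finally have "norm (\<psi>' z - \<psi>' ?x1) \<le> B * d" .
          moreover have "norm (\<psi>' ?x1 - \<psi>' x) \<le> B * h" by (rule e1) auto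
          ultimately show ?thesis
            using norm_triangle_ineq[of "\<psi>' z - \<psi>' ?x1" "\<psi>' ?x1 - \<psi>' x"] by (simp add: distrib_left)
        qed
        have e3: "norm (\<psi>' z - \<psi>' x) \<le> B * (h + d + h)" if z: "z \<in> closed_segment ?y1 y" for z
        proof -
          have z': "z \<in> closed_segment y ?y1" using z by (simp add: closed_segment_commute)
          have "norm (\<psi>' z - \<psi>' ?y1) \<le> B * norm (z - ?y1)" by (rule lip[OF _ down z']) (use y in auto)
          also have "\<dots> \<le> B * h" using segl[OF z] n1 B(2) by (intro mult_left_mono) auto
          finally have "norm (\<psi>' z - \<psi>' ?y1) \<le> B * h" .
          moreover have "norm (\<psi>' ?y1 - \<psi>' x) \<le> B * (h + d)" by (rule e2) auto
          ultimately show ?thesis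
            using norm_triangle_ineq[of "\<psi>' z - \<psi>' ?y1" "\<psi>' ?y1 - \<psi>' x"] by (simp add: distrib_left)
        qed
        have bl: "B * h \<le> B * (l * d)" "B * (h + d) \<le> B * (l * d)" "B * (h + d + h) \<le> B * (l * d)"
          unfolding ld[symmetric] using B(2) h0 d0 by (intro mult_left_mono; simp)+
        let ?L = "\<psi>' x"
        have s1: "\<bar>\<psi> ?x1 - \<psi> x - blinfun_apply ?L (?x1 - x)\<bar> \<le> B * (l * d) * h"
          using C2_derivs_segment_bound[OF psi down, of x ?L "B * (l * d)"] x e1 bl(1) n1(1) by (fastforce intro: order_trans)
        have s2: "\<bar>\<psi> ?y1 - \<psi> ?x1 - blinfun_apply ?L (?y1 - ?x1)\<bar> \<le> B * (l * d) * d"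
          using C2_derivs_segment_bound[OF psi across, of ?L "B * (l * d)"] e2 bl(2) n1(2) by (fastforce intro: order_trans)
        have s3: "\<bar>\<psi> y - \<psi> ?y1 - blinfun_apply ?L (y - ?y1)\<bar> \<le> B * (l * d) * h"
        proof -
          have "closed_segment ?y1 y \<subseteq> A" using down[OF y] by (simp add: closed_segment_commute)
          from C2_derivs_segment_bound[OF psi this, of ?L "B * (l * d)"] show ?thesis
            using e3 bl(3) n1(3) by (fastforce intro: order_trans)
        qed
        have sum: "?T x y = (\<psi> ?x1 - \<psi> x - blinfun_apply ?L (?x1 - x)) + (\<psi> ?y1 - \<psi> ?x1 - blinfun_apply ?L (?y1 - ?x1))
            + (\<psi> y - \<psi> ?y1 - blinfun_apply ?L (y - ?y1))"
          by (simp only: blinfun.diff_right)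
        have "?T x y \<le> B * (l * d) * h + B * (l * d) * d + B * (l * d) * h"
          unfolding sum using s1 s2 s3 by linarith
        also have "\<dots> = B * (l * d) * (h + d + h)" by (simp add: algebra_simps)
        also have "\<dots> = (B * l\<^sup>2) * (norm (y - x))\<^sup>2" unfolding ld by (simp add: power2_eq_square d_def)
        finally show ?thesis .
      qed
      moreover have "0 < B * l\<^sup>2" using B(2) C0 by (simp add: l_def)
      ultimately show ?thesis using rho(1) by blast
    qed
    then obtain \<rho> C where rho: "0 < \<rho>" "0 < C"
      and T: "\<And>x y. x \<in> A \<inter> ball p \<rho> \<Longrightarrow> y \<in> A \<inter> ball p \<rho> \<Longrightarrow> ?T x y \<le> C * (norm (y - x))\<^sup>2" by blast
    define \<delta> where "\<delta> = min (\<rho> / 2) (1 / C)"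
    have d: "0 < \<delta>" "\<delta> \<le> \<rho> / 2" "C \<le> 1 / \<delta>"
    proof -
      show "0 < \<delta>" "\<delta> \<le> \<rho> / 2" using rho by (auto simp: \<delta>_def)
      have "\<delta> \<le> 1 / C" by (simp add: \<delta>_def)
      then show "C \<le> 1 / \<delta>" using \<open>0 < \<delta>\<close> rho by (simp add: field_simps)
    qed
    show "\<exists>\<rho>>0. \<exists>\<delta>>0. \<forall>z\<in>closure A \<inter> ball p \<rho>. z \<in> A \<longrightarrow> (\<forall>y\<in>A. norm (y - z) < \<delta> \<longrightarrow> ?T z y \<le> 1 / \<delta> * (norm (y - z))\<^sup>2)"
    proof (rule exI[of _ "\<rho> / 2"], intro exI[of _ \<delta>] conjI ballI impI)
      fix z y assume z: "z \<in> closure A \<inter> ball p (\<rho> / 2)" "z \<in> A" and y: "y \<in> A" "norm (y - z) < \<delta>"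
      have "dist p y \<le> dist p z + dist z y" by (rule dist_triangle)
      then have "y \<in> ball p \<rho>" using z y d by (simp add: dist_norm norm_minus_commute)
      then have "?T z y \<le> C * (norm (y - z))\<^sup>2" using z y rho by (intro T) auto
      also have "\<dots> \<le> 1 / \<delta> * (norm (y - z))\<^sup>2" using d by (intro mult_right_mono) auto
      finally show "?T z y \<le> 1 / \<delta> * (norm (y - z))\<^sup>2" .
    qed (use rho d in auto)
  qed
  then obtain \<delta> where "0 < \<delta>" "\<And>x y. x \<in> A \<Longrightarrow> y \<in> A \<Longrightarrow> norm (y - x) < \<delta> \<Longrightarrow> ?T x y \<le> 1 / \<delta> * (norm (y - x))\<^sup>2"
    using closure_subset by blast
  then show ?thesis by (intro exI[of _ \<delta>]) (force simp: algebra_simps)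
qed

text \<open>
  A function below a paraboloid at \<open>x\<close> admits a ball tangent to its graph from above; moved upwards, that ball
  contains the given point above the graph.
\<close>

lemma ball_above_graph:
  fixes x :: "'a::euclidean_space"
  assumes quad: "\<And>y. y \<in> A \<Longrightarrow> norm (y - x) < \<delta>\<^sub>0 \<Longrightarrow> \<psi> y \<le> \<psi> x + blinfun_apply L (y - x) + 1 / \<delta>\<^sub>0 * (norm (y - x))\<^sup>2"
    and Om: "ball x \<delta>\<^sub>0 \<subseteq> \<Omega>" and d: "0 < \<delta>" "2 * \<delta> \<le> \<delta>\<^sub>0" and tau: "0 < \<tau>"
  shows "\<exists>c. (x, \<psi> x + \<tau>) \<in> ball c \<delta> \<and> ball c \<delta> \<subseteq> {(y, t). y \<in> \<Omega> \<and> (y \<in> A \<longrightarrow> \<psi> y < t)}"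
proof -
  obtain a where a: "\<And>y. blinfun_apply L y = y \<bullet> a" using blinfun_inner_representation[of L] by blast
  let ?q = "(x, \<psi> x)" and ?e = "(0, - 1) :: 'a \<times> real" and ?m = "(a, - 1) :: 'a \<times> real"
  have qe: "?q - \<tau> *\<^sub>R ?e = (x, \<psi> x + \<tau>)" by simp
  obtain c where c1: "(x, \<psi> x + \<tau>) \<in> ball c \<delta>"
    and c2: "\<And>Y. Y \<in> ball c \<delta> \<Longrightarrow> \<exists>t\<ge>0. norm (Y + t *\<^sub>R ?e - ?q) < 2 * \<delta> \<and> norm (Y - (?q - \<tau> *\<^sub>R ?e)) < 3 * \<delta> \<and>
       (Y + t *\<^sub>R ?e - ?q) \<bullet> ?m < - (1 / (2 * \<delta>)) * (norm (Y + t *\<^sub>R ?e - ?q))\<^sup>2"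
    using shifted_tangent_ball[of ?e ?m \<delta> \<tau> ?q] d tau unfolding qe by (auto simp: norm_Pair)
  have "ball c \<delta> \<subseteq> {(y, t). y \<in> \<Omega> \<and> (y \<in> A \<longrightarrow> \<psi> y < t)}"
  proof clarify
    fix y t' assume "(y, t') \<in> ball c \<delta>"
    then obtain t where t: "0 \<le> t" "norm ((y, t') + t *\<^sub>R ?e - ?q) < 2 * \<delta>"
       "((y, t') + t *\<^sub>R ?e - ?q) \<bullet> ?m < - (1 / (2 * \<delta>)) * (norm ((y, t') + t *\<^sub>R ?e - ?q))\<^sup>2"
      using c2 by blast
    define Z where "Z = (y, t') + t *\<^sub>R ?e - ?q"
    have Z: "Z = (y - x, t' - t - \<psi> x)" by (simp add: Z_def)
    have nZ: "norm (y - x) \<le> norm Z" unfolding Z by (rule norm_fst_le)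
    then have lt: "norm (y - x) < \<delta>\<^sub>0" using t(2) d unfolding Z_def[symmetric] by simp
    have "1 / \<delta>\<^sub>0 * (norm (y - x))\<^sup>2 \<le> 1 / (2 * \<delta>) * (norm Z)\<^sup>2"
      using d nZ by (intro mult_mono power_mono divide_left_mono) auto
    moreover have "Z \<bullet> ?m = blinfun_apply L (y - x) - (t' - t - \<psi> x)" unfolding Z a by simp
    ultimately have gt: "\<psi> x + blinfun_apply L (y - x) + 1 / \<delta>\<^sub>0 * (norm (y - x))\<^sup>2 < t'"
      using t(1,3) unfolding Z_def[symmetric] by simp
    show "y \<in> \<Omega> \<and> (y \<in> A \<longrightarrow> \<psi> y < t')"
    proof (intro conjI impI)
      show "y \<in> \<Omega>" using Om lt by (auto simp: dist_norm norm_minus_commute)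
      assume "y \<in> A"
      from quad[OF this lt] gt show "\<psi> y < t'" by simp
    qed
  qed
  with c1 show ?thesis by blast
qed

text \<open>
  In the first case the balls come from Taylor's formula for \<open>\<psi>\<close>. In the second case, where the gradient of
  \<open>\<psi>\<close> may blow up at the boundary of \<open>A\<close>, they come from the \<open>C\<^sup>2\<close> boundary of the complement of the obstacle.
\<close>

lemma obstacle_uniform_balls:
  fixes \<Omega> A :: "'a::euclidean_space set"
  assumes Om: "open \<Omega>" and A: "open A" "bounded A" "closure A \<subseteq> \<Omega>" "C2_boundary A"
    and psi: "C2_on_closure A \<psi> \<or>
      (continuous_on (closure A) \<psi> \<and> C2_on A \<psi> \<and>
       open (\<Omega> \<times> (UNIV :: real set) - {(x, t). x \<in> closure A \<and> t \<le> \<psi> x}) \<and>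
       C2_boundary (\<Omega> \<times> (UNIV :: real set) - {(x, t). x \<in> closure A \<and> t \<le> \<psi> x}))"
    and bound: "\<And>x. x \<in> closure A \<Longrightarrow> \<bar>\<psi> x\<bar> \<le> m"
  shows "\<exists>\<delta>>0. \<forall>x\<in>A. \<forall>\<tau>. 0 < \<tau> \<longrightarrow> \<tau> \<le> 1 \<longrightarrow>
    (\<exists>c. (x, \<psi> x + \<tau>) \<in> ball c \<delta> \<and> ball c \<delta> \<subseteq> {(y, t). y \<in> \<Omega> \<and> (y \<in> A \<longrightarrow> \<psi> y < t)})"
  using psi
proof
  assume "C2_on_closure A \<psi>"
  then obtain \<psi>' \<psi>'' where d: "C2_derivs A \<psi> \<psi>' \<psi>''" "continuous_on (closure A) \<psi>''"
    unfolding C2_on_closure_def by blast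
  obtain d1 where d1: "0 < d1" "\<And>x y. x \<in> A \<Longrightarrow> y \<in> A \<Longrightarrow> norm (y - x) < d1 \<Longrightarrow>
    \<psi> y \<le> \<psi> x + blinfun_apply (\<psi>' x) (y - x) + 1 / d1 * (norm (y - x))\<^sup>2"
    using C2_on_closure_quadratic_bound[OF A(4,1,2) d] by blast
  have "\<exists>\<delta>>0. \<forall>x\<in>closure A. ball x \<delta> \<subseteq> \<Omega>"
  proof (rule compact_uniform_radius)
    show "compact (closure A)" using A(2) by (simp add: compact_closure)
    show "ball x \<delta>' \<subseteq> \<Omega>" if "ball x \<delta> \<subseteq> \<Omega>" "\<delta>' \<le> \<delta>" for x \<delta> \<delta>'
      using that subset_ball[of \<delta>' \<delta> x] by blast
    fix p assume "p \<in> closure A"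
    then obtain r where r: "0 < r" "ball p r \<subseteq> \<Omega>" using A(3) Om openE by blast
    have "ball z (r / 2) \<subseteq> \<Omega>" if "z \<in> ball p (r / 2)" for z
    proof -
      have "ball z (r / 2) \<subseteq> ball p r" using that by (simp add: ball_subset_ball_iff dist_commute)
      then show ?thesis using r(2) by blast
    qed
    then show "\<exists>\<rho>>0. \<exists>\<delta>>0. \<forall>z\<in>closure A \<inter> ball p \<rho>. ball z \<delta> \<subseteq> \<Omega>"
      using r(1) half_gt_zero by blast
  qed
  then obtain d2 where d2: "0 < d2" "\<And>x. x \<in> closure A \<Longrightarrow> ball x d2 \<subseteq> \<Omega>" by blast
  define d0 where "d0 = min d1 d2"
  have d0: "0 < d0" "d0 \<le> d1" "d0 \<le> d2" using d1 d2 by (auto simp: d0_def)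
  show ?thesis
  proof (intro exI[of _ "d0 / 2"] conjI ballI allI impI)
    show "0 < d0 / 2" using d0 by simp
    fix x \<tau> assume x: "x \<in> A" and tau: "(0::real) < \<tau>"
    show "\<exists>c. (x, \<psi> x + \<tau>) \<in> ball c (d0 / 2) \<and> ball c (d0 / 2) \<subseteq> {(y, t). y \<in> \<Omega> \<and> (y \<in> A \<longrightarrow> \<psi> y < t)}"
    proof (rule ball_above_graph[where \<delta>\<^sub>0=d0 and L="\<psi>' x"])
      fix y assume y: "y \<in> A" "norm (y - x) < d0"
      have "1 / d1 * (norm (y - x))\<^sup>2 \<le> 1 / d0 * (norm (y - x))\<^sup>2"
        using d0 by (intro mult_right_mono divide_left_mono) auto
      then show "\<psi> y \<le> \<psi> x + blinfun_apply (\<psi>' x) (y - x) + 1 / d0 * (norm (y - x))\<^sup>2"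
        using d1(2)[OF x y(1)] y(2) d0 by simp
    next
      have "x \<in> closure A" using x closure_subset by blast
      then show "ball x d0 \<subseteq> \<Omega>" using d2(2) subset_ball[OF d0(3), of x] by blast
    qed (use d0 tau in auto)
  qed
next
  let ?O = "\<Omega> \<times> (UNIV :: real set) - {(x, t). x \<in> closure A \<and> t \<le> \<psi> x}"
  assume b: "continuous_on (closure A) \<psi> \<and> C2_on A \<psi> \<and> open ?O \<and> C2_boundary ?O"
  let ?K = "closure A \<times> {- m..m + 1}"
  have "compact ?K" using A(2) by (intro compact_Times) (auto simp: compact_closure)
  then obtain \<delta> where d: "0 < \<delta>" "\<And>z. z \<in> ?O \<inter> ?K \<Longrightarrow> \<exists>c. z \<in> ball c \<delta> \<and> ball c \<delta> \<subseteq> ?O"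
    using C2_boundary_uniform_balls[of ?O ?K] b by blast
  have sub: "?O \<subseteq> {(y, t). y \<in> \<Omega> \<and> (y \<in> A \<longrightarrow> \<psi> y < t)}"
    using closure_subset[of A] by (auto simp: not_le)
  show ?thesis
  proof (intro exI[of _ \<delta>] conjI ballI allI impI d(1))
    fix x \<tau> assume x: "x \<in> A" and tau: "0 < \<tau>" "\<tau> \<le> (1::real)"
    have xc: "x \<in> closure A" using x closure_subset by blast
    have "(x, \<psi> x + \<tau>) \<in> ?O \<inter> ?K" using xc A(3) bound[OF xc] tau by auto
    from d(2)[OF this] sub
    show "\<exists>c. (x, \<psi> x + \<tau>) \<in> ball c \<delta> \<and> ball c \<delta> \<subseteq> {(y, t). y \<in> \<Omega> \<and> (y \<in> A \<longrightarrow> \<psi> y < t)}"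
      by (meson order_trans)
  qed
qed

section \<open>Complete stickiness\<close>

text \<open>
  Balls with centres at height \<open>-k\<close> over \<open>\<Omega> - closure A\<close> give the first claim, up to the null set \<open>frontier A\<close>;
  balls that reach down to the graph of \<open>\<psi>\<close> give the second.
\<close>

lemma complete_stickiness:
  fixes \<Omega> A :: "'a::euclidean_space set" and \<phi> \<psi> :: "'a \<Rightarrow> real" and u :: "real \<Rightarrow> 'a \<Rightarrow> real"
  assumes Om: "open \<Omega>" "bounded \<Omega>" "C2_boundary \<Omega>"
    and phi: "\<phi> \<in> borel_measurable lebesgue"
    and alpha: "alpha_bar (subgraph \<phi>) < ennreal (omega (DIM('a) + 1) / 2)"
    and A: "open A" "bounded A" "closure A \<subseteq> \<Omega>" "C2_boundary A"
    and psi: "C2_on_closure A \<psi> \<or>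
      (continuous_on (closure A) \<psi> \<and> C2_on A \<psi> \<and>
       open (\<Omega> \<times> (UNIV :: real set) - {(x, t). x \<in> closure A \<and> t \<le> \<psi> x}) \<and>
       C2_boundary (\<Omega> \<times> (UNIV :: real set) - {(x, t). x \<in> closure A \<and> t \<le> \<psi> x}))"
    and sol: "\<And>s. s \<in> {0<..<1} \<Longrightarrow> solves_obstacle s \<Omega> A \<phi> \<psi> (u s)"
  shows "\<forall>\<^sub>F s in at_right 0. (AE x in lebesgue. x \<in> \<Omega> - A \<longrightarrow> u s x \<le> - k) \<and>
      (AE x in lebesgue. x \<in> A \<longrightarrow> u s x = \<psi> x)"
proof -
  let ?U = "{(y, t). y \<in> \<Omega> \<and> (y \<in> A \<longrightarrow> \<psi> y < t)}"
  have "continuous_on (closure A) \<psi>" using psi unfolding C2_on_closure_def by blast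
  then have "compact (\<psi> ` closure A)" using A(2) by (intro compact_continuous_image) (auto simp: compact_closure)
  then have "bounded (\<psi> ` closure A)" by (rule compact_imp_bounded)
  then obtain m where m: "\<And>x. x \<in> closure A \<Longrightarrow> \<bar>\<psi> x\<bar> \<le> m"
    unfolding bounded_iff by auto
  obtain b where b: "\<And>x. x \<in> \<Omega> \<Longrightarrow> norm x \<le> b" using Om(2) unfolding bounded_iff by blast
  obtain d1 where d1: "0 < d1" "\<And>x \<tau>. x \<in> A \<Longrightarrow> 0 < \<tau> \<Longrightarrow> \<tau> \<le> 1 \<Longrightarrow>
      \<exists>c. (x, \<psi> x + \<tau>) \<in> ball c d1 \<and> ball c d1 \<subseteq> ?U"
    using obstacle_uniform_balls[OF Om(1) A psi m] by blast
  let ?S = "\<Omega> - closure A"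
  have "open ?S" using Om(1) by (intro open_Diff) auto
  moreover have "compact (closure \<Omega>)" using Om(2) by (simp add: compact_closure)
  ultimately obtain d2 where d2_pos: "0 < d2" and d2_ball: "\<And>x. x \<in> ?S \<inter> closure \<Omega> \<Longrightarrow> \<exists>c. x \<in> ball c d2 \<and> ball c d2 \<subseteq> ?S"
    using C2_boundary_uniform_balls[OF C2_boundary_Diff_closure[OF Om(3,1) A(4,1,3)], of "closure \<Omega>"] by blast
  have d2: "0 < d2" "\<And>x. x \<in> ?S \<Longrightarrow> \<exists>c. x \<in> ball c d2 \<and> ball c d2 \<subseteq> ?S"
    using d2_pos d2_ball closure_subset[of \<Omega>] by blast+
  define \<delta> where "\<delta> = min (1/2) (min d1 d2)"
  have d: "0 < \<delta>" "\<delta> \<le> 1/2" "\<delta> \<le> d1" "\<delta> \<le> d2" using d1 d2 by (auto simp: \<delta>_def)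
  define M where "M = b + \<bar>m\<bar> + \<bar>k\<bar> + 2"
  have nrm: "norm p \<le> M" if "x \<in> \<Omega>" "\<bar>t\<bar> \<le> \<bar>m\<bar> + \<bar>k\<bar> + 1" "(x, t) \<in> ball p \<delta>" for p x t
  proof -
    have "norm p \<le> norm (x, t) + norm (p - (x, t))" using norm_triangle_ineq[of "(x, t)" "p - (x, t)"] by simp
    also have "norm (x, t) \<le> norm x + norm t" by (rule norm_Pair_le)
    finally show ?thesis using b[OF that(1)] that(2,3) d unfolding M_def by (simp add: dist_norm)
  qed
  have key: "\<forall>\<^sub>F s in at_right 0. AE x in lebesgue. \<forall>p \<tau>. norm p \<le> M \<longrightarrow>
      ball p \<delta> \<subseteq> ?U \<longrightarrow> (x, \<tau>) \<in> ball p \<delta> \<longrightarrow> u s x \<le> \<tau>"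
    by (rule solutions_below_balls[OF Om(1,2) phi alpha sol d(1)]) (use d in auto)
  have small: "\<forall>\<^sub>F s::real in at_right 0. s < 1"
    using eventually_at_right_field[of "\<lambda>s::real. s < 1" 0] by (auto intro!: exI[of _ 1])
  have null: "AE x in lebesgue. x \<notin> frontier A"
    unfolding AE_completion_iff by (rule AE_not_in[OF C2_boundary_frontier_null[OF A(4,1,2)]])
  show ?thesis
    using key small eventually_at_right_less[of 0]
  proof eventually_elim
    case (elim s)
    note K = elim(1)
    have "solves_obstacle s \<Omega> A \<phi> \<psi> (u s)" using sol elim by simp
    then have above: "AE x in lebesgue. x \<in> A \<longrightarrow> \<psi> x \<le> u s x"
      unfolding solves_obstacle_def W_obst_def by blast
    show ?case
    proof
      show "AE x in lebesgue. x \<in> \<Omega> - A \<longrightarrow> u s x \<le> - k"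
        using K null
      proof eventually_elim
        case (elim x)
        show ?case
        proof
          assume x: "x \<in> \<Omega> - A"
          then have xS: "x \<in> ?S" using elim(2) A(1) by (auto simp: frontier_def interior_open)
          obtain c0 where c0: "x \<in> ball c0 d2" "ball c0 d2 \<subseteq> ?S" using d2(2)[OF xS] by blast
          then obtain c where c: "x \<in> ball c \<delta>" "ball c \<delta> \<subseteq> ?S"
            using ball_subset_smaller_radius[OF c0 d(1,4)] by blast
          have in_ball: "(x, - k) \<in> ball (c, - k) \<delta>" using c(1) by (simp add: dist_Pair_Pair)
          have "ball (c, - k) \<delta> \<subseteq> ?U"
          proof clarify
            fix y t assume "(y, t) \<in> ball (c, - k) \<delta>"
            then have "y \<in> ball c \<delta>" using dist_fst_le[of "(c, - k)" "(y, t)"] by simp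
            then have "y \<in> ?S" using c(2) by blast
            then show "y \<in> \<Omega> \<and> (y \<in> A \<longrightarrow> \<psi> y < t)" using closure_subset[of A] by blast
          qed
          moreover have "norm (c, - k) \<le> M" by (rule nrm[OF _ _ in_ball]) (use x in auto)
          ultimately show "u s x \<le> - k" using elim(1) in_ball by blast
        qed
      qed
      show "AE x in lebesgue. x \<in> A \<longrightarrow> u s x = \<psi> x"
        using K above
      proof eventually_elim
        case (elim x)
        show ?case
        proof
          assume x: "x \<in> A"
          have xc: "x \<in> closure A" using x closure_subset by blast
          have le: "u s x \<le> \<psi> x + \<tau>" if tau: "0 < \<tau>" "\<tau> \<le> 1" for \<tau>
          proof -
            obtain c0 where c0: "(x, \<psi> x + \<tau>) \<in> ball c0 d1" "ball c0 d1 \<subseteq> ?U" using d1(2)[OF x tau] by blast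
            then obtain c where c: "(x, \<psi> x + \<tau>) \<in> ball c \<delta>" "ball c \<delta> \<subseteq> ?U"
              using ball_subset_smaller_radius[OF c0 d(1,3)] by blast
            have "norm c \<le> M" by (rule nrm[OF _ _ c(1)]) (use xc A(3) m[OF xc] tau in auto)
            then show ?thesis using elim(1) c by blast
          qed
          have "u s x \<le> \<psi> x"
          proof (rule field_le_epsilon)
            fix e :: real assume "0 < e"
            then have "u s x \<le> \<psi> x + min e 1" by (intro le) auto
            then show "u s x \<le> \<psi> x + e" by simp
          qed
          then show "u s x = \<psi> x" using elim(2) x by simp
        qed
      qed
    qed
  qed
qed

theorem theorem4p2:
  fixes \<Omega> A :: "(real ^ 'n) set"
    and \<phi> \<psi> :: "real ^ 'n \<Rightarrow> real"
    and u :: "real \<Rightarrow> real ^ 'n \<Rightarrow> real"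
  assumes "open \<Omega>" and "bounded \<Omega>" and "connected \<Omega>" and "C2_boundary \<Omega>"
    and "Linf_loc \<phi>"
    and "alpha_bar (subgraph \<phi>) < ennreal (omega (CARD('n) + 1) / 2)"
    and "open A" and "bounded A" and "closure A \<subseteq> \<Omega>" and "C2_boundary A"
    and "C2_on_closure A \<psi> \<or>
      (continuous_on (closure A) \<psi> \<and> C2_on A \<psi> \<and>
       open (\<Omega> \<times> (UNIV :: real set) - {(x, t). x \<in> closure A \<and> t \<le> \<psi> x}) \<and>
       C2_boundary (\<Omega> \<times> (UNIV :: real set) - {(x, t). x \<in> closure A \<and> t \<le> \<psi> x}))"
    and "\<And>s. s \<in> {0<..<1} \<Longrightarrow> solves_obstacle s \<Omega> A \<phi> \<psi> (u s)"
  shows "(\<forall>k::real. k \<ge> of_int (2 + \<lceil>max (Linf_norm A \<psi>) (Linf_norm (nbhd \<Omega> 1 - \<Omega>) \<phi>)\<rceil>) \<longrightarrow>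
      (\<exists>s\<^sub>k\<in>{0<..<1}. \<forall>s\<in>{0<..<s\<^sub>k}.
         (AE x in lebesgue. x \<in> \<Omega> - A \<longrightarrow> u s x \<le> - k) \<and>
         (AE x in lebesgue. x \<in> A \<longrightarrow> u s x = \<psi> x)))
    \<and> (\<forall>M::real. \<forall>\<^sub>F s in at_right 0. AE x in lebesgue. x \<in> \<Omega> - A \<longrightarrow> u s x \<le> M)"
proof -
  have "\<phi> \<in> borel_measurable lebesgue" using assms(5) by (simp add: Linf_loc_def)
  note stick = complete_stickiness[OF assms(1,2,4) this _ assms(7-12)]
  have ev: "\<forall>\<^sub>F s in at_right 0. (AE x in lebesgue. x \<in> \<Omega> - A \<longrightarrow> u s x \<le> - k) \<and>
      (AE x in lebesgue. x \<in> A \<longrightarrow> u s x = \<psi> x)" for k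
    by (rule stick) (use assms(6) in auto)
  have "\<exists>s\<^sub>k\<in>{0<..<1}. \<forall>s\<in>{0<..<s\<^sub>k}.
         (AE x in lebesgue. x \<in> \<Omega> - A \<longrightarrow> u s x \<le> - k) \<and> (AE x in lebesgue. x \<in> A \<longrightarrow> u s x = \<psi> x)" for k
  proof -
    obtain b where b: "0 < b" "\<And>s. 0 < s \<Longrightarrow> s < b \<Longrightarrow>
         (AE x in lebesgue. x \<in> \<Omega> - A \<longrightarrow> u s x \<le> - k) \<and> (AE x in lebesgue. x \<in> A \<longrightarrow> u s x = \<psi> x)"
      using ev[of k] unfolding eventually_at_right_field by blast
    show ?thesis by (rule bexI[of _ "min b (1/2)"]) (use b in auto)
  qed
  moreover have "\<forall>\<^sub>F s in at_right 0. AE x in lebesgue. x \<in> \<Omega> - A \<longrightarrow> u s x \<le> M" for M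
    using ev[of "- M"] by (auto elim!: eventually_mono)
  ultimately show ?thesis by blast
qed

end
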